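(* Let $p \geq 5$ be a prime. For $p \equiv 1 \pmod{3}$, write $p = x^2+3y^2$ with $x, y \in \mathbb{Z}$. Let $\chi_{-3}$ denote the non-principal Dirichlet character modulo $3$. Then for $m \in \mathbb{Z}$, \[ H_{m,6}(p) = \begin{cases} \frac{p+1}{3}+\frac{1}{3}\chi_{-3}(x)x&\text{if }m \equiv 0 \pmod{6},\ p \equiv 1 \pmod{3},\\ \frac{2p-4}{3}&\text{if }m \equiv 0 \pmod{6},\ p \equiv 2 \pmod{3},\\ \frac{p+1}{4}+\frac{1}{6}\chi_{-3}(x)x&\text{if }m \equiv 1, 5 \pmod{6},\ p \equiv 1 \pmod{3},\\ \frac{p+1}{6}&\text{if }m \equiv 1, 5 \pmod{6},\ p \equiv 2 \pmod{3},\\ \frac{p-1}{2}-\frac{1}{6}\chi_{-3}(x)x&\text{if }m \equiv 2, 4 \pmod{6},\ p \equiv 1 \pmod{3},\\ \frac{p+1}{3}&\text{if }m \equiv 2,3,4 \pmod{6},\ p \equiv 2 \pmod{3},\\ \frac{p+1}{6}-\frac{1}{3}\chi_{-3}(x)x&\text{if }m \equiv 3 \pmod{6},\ p \equiv 1 \pmod{3}. \end{cases} \]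
   Context: For an integer $n>0$ with $n \equiv 0,3 \pmod 4$, the Hurwitz class number $H(n)$ is $\sum_{Q}1/\omega_Q$, where $Q$ runs over $\mathrm{SL}_2(\mathbb{Z})$-equivalence classes of positive definite binary integral quadratic forms of discriminant $-n$, and $\omega_Q = 2$ if $Q$ is equivalent to $a(x^2+y^2)$, $\omega_Q=3$ if $Q$ is equivalent to $a(x^2+xy+y^2)$, and $\omega_Q=1$ otherwise. Also $H(0) = -\frac{1}{12}$ and $H(n)=0$ if $n<0$ or $n \equiv 1,2 \pmod 4$. For $m \in \mathbb{Z}$, $M \in \mathbb{Z}_{\geq 1}$, $n \in \mathbb{Z}_{\geq 0}$, define $H_{m,M}(n) := \sum_{t \in \mathbb{Z},\, t \equiv m \pmod{M}} H(4n-t^2)$. *)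

theory Defs
  imports "HOL-Analysis.Analysis" "HOL-Number_Theory.Number_Theory"
begin

text \<open>The triple \<open>(a, b, c)\<close> stands for the form \<open>a x\<^sup>2 + b x y + c y\<^sup>2\<close>.\<close>

type_synonym bqf = "int \<times> int \<times> int"

fun bqf_eval :: "bqf \<Rightarrow> 'a::comm_ring_1 \<Rightarrow> 'a \<Rightarrow> 'a" where
  "bqf_eval (a, b, c) x y = of_int a * x^2 + of_int b * x * y + of_int c * y^2"

fun bqf_disc :: "bqf \<Rightarrow> int" where
  "bqf_disc (a, b, c) = b^2 - 4 * a * c"

definition bqf_pos_def :: "bqf \<Rightarrow> bool" where
  "bqf_pos_def Q \<longleftrightarrow> (\<forall>x y :: real. (x, y) \<noteq> (0, 0) \<longrightarrow> bqf_eval Q x y > 0)"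

text \<open>Proper equivalence, i.e. equivalence under \<open>SL\<^sub>2(\<int>)\<close>.\<close>

definition bqf_equiv :: "bqf \<Rightarrow> bqf \<Rightarrow> bool" where
  "bqf_equiv Q R \<longleftrightarrow> (\<exists>\<alpha> \<beta> \<gamma> \<delta> :: int. \<alpha> * \<delta> - \<beta> * \<gamma> = 1 \<and>
     (\<forall>x y :: int. bqf_eval R x y = bqf_eval Q (\<alpha> * x + \<beta> * y) (\<gamma> * x + \<delta> * y)))"

text \<open>Imprimitive forms are included, as the Hurwitz class number requires.\<close>

definition pos_def_forms :: "int \<Rightarrow> bqf set" where
  "pos_def_forms n = {Q. bqf_pos_def Q \<and> bqf_disc Q = - n}"

definition bqf_equiv_rel :: "int \<Rightarrow> (bqf \<times> bqf) set" where
  "bqf_equiv_rel n = {(Q, R). Q \<in> pos_def_forms n \<and> R \<in> pos_def_forms n \<and> bqf_equiv Q R}"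

definition bqf_weight :: "bqf \<Rightarrow> nat" where
  "bqf_weight Q =
     (if \<exists>a. bqf_equiv Q (a, 0, a) then 2
      else if \<exists>a. bqf_equiv Q (a, a, a) then 3
      else 1)"

text \<open>
  The weight is constant on equivalence classes (\<open>bqf_weight_cong\<close> below), so the choice of
  the representative is immaterial.
\<close>

definition hurwitz_class_number :: "int \<Rightarrow> real" where
  "hurwitz_class_number n =
     (if n = 0 then - 1 / 12
      else if n < 0 \<or> n mod 4 = 1 \<or> n mod 4 = 2 then 0
      else (\<Sum>C \<in> pos_def_forms n // bqf_equiv_rel n. 1 / real (bqf_weight (SOME Q. Q \<in> C))))"

text \<open>
  The sum ranges over a full residue class, but only the finitely many \<open>t\<close> with
  \<open>t\<^sup>2 \<le> 4 n\<close> contribute (\<open>hurwitz_sum_eq_finite_sum\<close> below).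
\<close>

definition hurwitz_sum :: "int \<Rightarrow> nat \<Rightarrow> nat \<Rightarrow> real" where
  "hurwitz_sum m M n =
     (\<Sum>\<^sub>\<infinity>t \<in> {t :: int. [t = m] (mod int M)}. hurwitz_class_number (4 * int n - t^2))"

definition dirichlet_char :: "nat \<Rightarrow> (int \<Rightarrow> complex) \<Rightarrow> bool" where
  "dirichlet_char N \<psi> \<longleftrightarrow>
     (\<forall>a b. \<psi> (a * b) = \<psi> a * \<psi> b) \<and>
     (\<forall>a b. [a = b] (mod int N) \<longrightarrow> \<psi> a = \<psi> b) \<and>
     (\<forall>a. \<psi> a \<noteq> 0 \<longleftrightarrow> coprime a (int N))"

definition principal_char :: "nat \<Rightarrow> int \<Rightarrow> complex" where
  "principal_char N a = (if coprime a (int N) then 1 else 0)"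

text \<open>
  The explicit, integer-valued form of the non-principal Dirichlet character modulo 3;
  see \<open>nonprincipal_dirichlet_char_3_iff\<close> below.
\<close>

definition chi_minus_3 :: "int \<Rightarrow> int" where
  "chi_minus_3 a = (if a mod 3 = 1 then 1 else if a mod 3 = 2 then - 1 else 0)"

lemma bqf_equiv_refl: "bqf_equiv Q Q"
  unfolding bqf_equiv_def
  by (rule exI[of _ 1], rule exI[of _ 0], rule exI[of _ 0], rule exI[of _ 1]) simp

lemma bqf_equiv_sym:
  assumes "bqf_equiv Q R"
  shows "bqf_equiv R Q"
proof -
  obtain \<alpha> \<beta> \<gamma> \<delta> :: int where d: "\<alpha> * \<delta> - \<beta> * \<gamma> = 1"
    and e: "\<And>x y :: int. bqf_eval R x y = bqf_eval Q (\<alpha> * x + \<beta> * y) (\<gamma> * x + \<delta> * y)"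
    using assms unfolding bqf_equiv_def by blast
  have "bqf_eval Q x y = bqf_eval R (\<delta> * x + (- \<beta>) * y) ((- \<gamma>) * x + \<alpha> * y)" for x y :: int
  proof -
    have "\<alpha> * (\<delta> * x + (- \<beta>) * y) + \<beta> * ((- \<gamma>) * x + \<alpha> * y) = (\<alpha> * \<delta> - \<beta> * \<gamma>) * x"
      and "\<gamma> * (\<delta> * x + (- \<beta>) * y) + \<delta> * ((- \<gamma>) * x + \<alpha> * y) = (\<alpha> * \<delta> - \<beta> * \<gamma>) * y"
      by (simp_all add: algebra_simps)
    then show ?thesis unfolding e d by simp
  qed
  moreover have "\<delta> * \<alpha> - (- \<beta>) * (- \<gamma>) = 1" using d by (simp add: algebra_simps)
  ultimately show ?thesis unfolding bqf_equiv_def by blast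
qed

lemma bqf_equiv_trans:
  assumes "bqf_equiv Q R" "bqf_equiv R S"
  shows "bqf_equiv Q S"
proof -
  obtain \<alpha> \<beta> \<gamma> \<delta> :: int where d: "\<alpha> * \<delta> - \<beta> * \<gamma> = 1"
    and e: "\<And>x y :: int. bqf_eval R x y = bqf_eval Q (\<alpha> * x + \<beta> * y) (\<gamma> * x + \<delta> * y)"
    using assms(1) unfolding bqf_equiv_def by blast
  obtain \<alpha>' \<beta>' \<gamma>' \<delta>' :: int where d': "\<alpha>' * \<delta>' - \<beta>' * \<gamma>' = 1"
    and e': "\<And>x y :: int. bqf_eval S x y = bqf_eval R (\<alpha>' * x + \<beta>' * y) (\<gamma>' * x + \<delta>' * y)"
    using assms(2) unfolding bqf_equiv_def by blast
  have "(\<alpha> * \<alpha>' + \<beta> * \<gamma>') * (\<gamma> * \<beta>' + \<delta> * \<delta>') - (\<alpha> * \<beta>' + \<beta> * \<delta>') * (\<gamma> * \<alpha>' + \<delta> * \<gamma>')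
        = (\<alpha> * \<delta> - \<beta> * \<gamma>) * (\<alpha>' * \<delta>' - \<beta>' * \<gamma>')"
    by (simp add: algebra_simps)
  then have "(\<alpha> * \<alpha>' + \<beta> * \<gamma>') * (\<gamma> * \<beta>' + \<delta> * \<delta>') - (\<alpha> * \<beta>' + \<beta> * \<delta>') * (\<gamma> * \<alpha>' + \<delta> * \<gamma>') = 1"
    using d d' by simp
  moreover have "bqf_eval S x y = bqf_eval Q ((\<alpha> * \<alpha>' + \<beta> * \<gamma>') * x + (\<alpha> * \<beta>' + \<beta> * \<delta>') * y)
      ((\<gamma> * \<alpha>' + \<delta> * \<gamma>') * x + (\<gamma> * \<beta>' + \<delta> * \<delta>') * y)" for x y :: int
    unfolding e e' by (simp add: algebra_simps)
  ultimately show ?thesis unfolding bqf_equiv_def by blast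
qed

lemma equiv_bqf_equiv_rel: "equiv (pos_def_forms n) (bqf_equiv_rel n)"
proof (rule equivI)
  show "bqf_equiv_rel n \<subseteq> pos_def_forms n \<times> pos_def_forms n"
    by (auto simp: bqf_equiv_rel_def)
  show "refl_on (pos_def_forms n) (bqf_equiv_rel n)"
    by (auto simp: refl_on_def bqf_equiv_rel_def bqf_equiv_refl)
  show "sym (bqf_equiv_rel n)"
    by (auto simp: sym_def bqf_equiv_rel_def bqf_equiv_sym)
  show "trans (bqf_equiv_rel n)"
    unfolding trans_def bqf_equiv_rel_def using bqf_equiv_trans by blast
qed

lemma bqf_weight_cong:
  assumes "bqf_equiv Q R"
  shows "bqf_weight Q = bqf_weight R"
proof -
  have "bqf_equiv Q S \<longleftrightarrow> bqf_equiv R S" for S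
    using assms bqf_equiv_sym bqf_equiv_trans by blast
  then show ?thesis by (simp add: bqf_weight_def)
qed

lemma hurwitz_sum_eq_finite_sum:
  "hurwitz_sum m M n =
     (\<Sum>t \<in> {t. [t = m] (mod int M) \<and> t^2 \<le> 4 * int n}. hurwitz_class_number (4 * int n - t^2))"
proof -
  let ?A = "{t. [t = m] (mod int M) \<and> t^2 \<le> 4 * int n}"
  have "?A \<subseteq> {- (4 * int n) .. 4 * int n}"
  proof
    fix t assume "t \<in> ?A"
    then have t: "t^2 \<le> 4 * int n" by simp
    have "\<bar>t\<bar> \<le> t^2"
    proof (cases "t = 0")
      case False
      then have "\<bar>t\<bar> * 1 \<le> \<bar>t\<bar> * \<bar>t\<bar>" by (intro mult_left_mono) auto
      then show ?thesis by (simp add: power2_eq_square)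
    qed simp
    with t have "\<bar>t\<bar> \<le> 4 * int n" by linarith
    then show "t \<in> {- (4 * int n) .. 4 * int n}" by auto
  qed
  then have fin: "finite ?A" using finite_subset by blast
  have "hurwitz_sum m M n = (\<Sum>\<^sub>\<infinity>t \<in> ?A. hurwitz_class_number (4 * int n - t^2))"
    unfolding hurwitz_sum_def
    by (rule infsum_cong_neutral) (auto simp: hurwitz_class_number_def)
  with fin show ?thesis by simp
qed

lemma nonprincipal_dirichlet_char_3_iff:
  "dirichlet_char 3 \<psi> \<and> \<psi> \<noteq> principal_char 3 \<longleftrightarrow> \<psi> = (\<lambda>a. of_int (chi_minus_3 a))"
proof -
  have cop: "coprime a 3 \<longleftrightarrow> a mod 3 \<noteq> 0" for a :: int
    using prime_imp_coprime[of "3 :: int" a] coprime_commute[of a 3]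
    by (auto simp: dvd_eq_mod_eq_0[symmetric])
  have mod3: "a mod 3 = 0 \<or> a mod 3 = 1 \<or> a mod 3 = 2" for a :: int by presburger
  show ?thesis
  proof
    assume A: "dirichlet_char 3 \<psi> \<and> \<psi> \<noteq> principal_char 3"
    have mult: "\<psi> (a * b) = \<psi> a * \<psi> b" for a b
      using A unfolding dirichlet_char_def by blast
    have cong: "[a = b] (mod int 3) \<Longrightarrow> \<psi> a = \<psi> b" for a b
      using A unfolding dirichlet_char_def by blast
    have per: "a mod 3 = b mod 3 \<Longrightarrow> \<psi> a = \<psi> b" for a b
      by (rule cong) (simp add: cong_def)
    have "\<psi> a \<noteq> 0 \<longleftrightarrow> coprime a (int 3)" for a
      using A unfolding dirichlet_char_def by blast
    then have nz: "\<psi> a \<noteq> 0 \<longleftrightarrow> a mod 3 \<noteq> 0" for a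
      using cop by simp
    have one: "\<psi> 1 = 1" using mult[of 1 1] nz[of 1] by simp
    have "\<psi> 2 * \<psi> 2 = 1" using mult[of 2 2] per[of 4 1] one by simp
    then have "\<psi> 2 = 1 \<or> \<psi> 2 = - 1" using square_eq_1_iff by blast
    moreover have "\<psi> 2 \<noteq> 1"
    proof
      assume two: "\<psi> 2 = 1"
      have "\<psi> a = principal_char 3 a" for a
        using mod3[of a] per[of a 1] per[of a 2] nz[of a] one two
        by (elim disjE) (simp_all add: principal_char_def cop)
      with A show False by blast
    qed
    ultimately have two: "\<psi> 2 = - 1" by blast
    show "\<psi> = (\<lambda>a. of_int (chi_minus_3 a))"
    proof
      fix a
      show "\<psi> a = of_int (chi_minus_3 a)"
        using mod3[of a] per[of a 1] per[of a 2] nz[of a] one two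
        by (elim disjE) (simp_all add: chi_minus_3_def)
    qed
  next
    assume A: "\<psi> = (\<lambda>a. of_int (chi_minus_3 a))"
    have "chi_minus_3 (a * b) = chi_minus_3 a * chi_minus_3 b" for a b
    proof -
      have "(a * b) mod 3 = ((a mod 3) * (b mod 3)) mod 3" by (simp add: mod_mult_eq)
      then show ?thesis using mod3[of a] mod3[of b] by (elim disjE) (simp_all add: chi_minus_3_def)
    qed
    then have "dirichlet_char 3 \<psi>"
      using mod3 by (auto simp: A dirichlet_char_def cop cong_def chi_minus_3_def)
    moreover have "\<psi> 2 \<noteq> principal_char 3 2"
      by (simp add: A principal_char_def chi_minus_3_def cop)
    ultimately show "dirichlet_char 3 \<psi> \<and> \<psi> \<noteq> principal_char 3" by auto
  qed
qed

end

theory Submission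
  imports Defs
begin

text \<open>
  Writing a positive definite form as \<open>(l x\<^sup>2 + m y\<^sup>2 + v (x - y)\<^sup>2) / 2\<close> with \<open>l, m, v \<ge> 0\<close> (Selling reduction)
  turns \<open>3 H(N)\<close> into a count of triples with \<open>lm + mv + vl = N\<close>, and \<open>3 \<Sum>\<^sub>t f(t) H(4n - t\<^sup>2)\<close> into a sum over the
  solutions of \<open>t\<^sup>2 + lm + mv + vl = 4n\<close>. Elementary substitutions in the style of Liouville rewrite it, for
  every even \<open>f\<close>, as \<open>\<Sum> (f(x + z - 2e) - f(x + z + 2e))\<close> over \<open>xz + ae = n\<close> plus boundary terms. For \<open>n = p\<close> this
  evaluates the sums over all \<open>t\<close>, over odd \<open>t\<close> and over multiples \<open>t\<close> of 3.

  What remains is the sum over odd multiples of 3. With \<open>f(t) = n - t\<^sup>2\<close> on odd \<open>t\<close> the same formula yields a recursion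
  that characterises the cube of \<open>\<Sum> q\<^bsup>t\<^sup>2\<^esup>\<close> (\<open>t\<close> odd), so \<open>24 H(N)\<close> counts sums of three odd squares for
  \<open>N \<equiv> 3 (mod 8)\<close>, and one has to count the representations of \<open>4p\<close> by four odd squares with a coordinate divisible by 3.
  For \<open>p \<equiv> 2 (mod 3)\<close> always two coordinates are. For \<open>p \<equiv> 1 (mod 3)\<close> Riemann's quartic theta relation reduces the
  count to the coefficient of \<open>q\<^sup>p\<close> in \<open>\<eta>(6\<tau>)\<^sup>4 = \<eta>(6\<tau>) \<eta>(6\<tau>)\<^sup>3\<close>. Jacobi's series for \<open>\<eta>\<^sup>3\<close>, again obtained from the
  recursion, expresses it by the solutions of \<open>a\<^sup>2 + 3 b\<^sup>2 = 4p\<close>, that is by \<open>p = x\<^sup>2 + 3 y\<^sup>2\<close>.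
\<close>

text \<open>By t -> -t the six residue classes modulo 6 give only four unknown sums. The sums over
  all t, odd t, multiples of 3 and odd multiples of 3 are four linear conditions that determine
  them. For the first two choices of f the differences f(x + z - 2e) - f(x + z + 2e) vanish
  identically. For multiples of 3 they become a character sum that Liouville's identity reduces to
  diagonal terms. The odd multiples of 3 are the obstacle: the answer contains the coefficient of a
  cusp form, which is no divisor sum in p. Restricting to odd t is what makes the detour possible.
  Then 4p - t^2 is 3 modulo 8, the range in which H counts sums of three odd squares, and t joins
  them as a fourth square. In the resulting set all four coordinates are interchangeable, so the
  condition 3 | t can be symmetrized. Modular forms enter only through coefficients: a first-order
  recursion with one initial value replaces every comparison of theta series.\<close>

section \<open>Selling triples and the trace sum\<close>

text \<open>Forms on the boundary of the Selling domain belong to two domains.\<close>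

definition half_weight :: "int \<Rightarrow> real" where
  "half_weight k = (if k = 0 then 1 / 2 else 1)"

text \<open>\<open>(l, m, v)\<close> stands for the form \<open>(l x\<^sup>2 + m y\<^sup>2 + v (x - y)\<^sup>2) / 2\<close> of discriminant \<open>- (lm + mv + vl)\<close>.\<close>

definition selling_triples :: "int \<Rightarrow> (int \<times> int \<times> int) set" where
  "selling_triples N = {(l, m, v). 0 \<le> l \<and> 0 \<le> m \<and> 0 \<le> v \<and> even (l - m) \<and> even (m - v)
     \<and> l * m + m * v + v * l = N}"

definition trace_selling :: "int \<Rightarrow> (int \<times> int \<times> int \<times> int) set" where
  "trace_selling n = {(t, l, m, v). t\<^sup>2 < 4 * n \<and> (l, m, v) \<in> selling_triples (4 * n - t\<^sup>2)}"

definition quads :: "int \<Rightarrow> (int \<times> int \<times> int \<times> int) set" where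
  "quads n = {(x, z, a, e). 0 < x \<and> 0 < z \<and> 0 < a \<and> 0 < e \<and> x * z + a * e = n}"

section \<open>Finiteness of the index sets\<close>

lemma le_mult_pos:
  fixes a m :: int
  assumes "0 < a" "0 \<le> m"
  shows "m \<le> a * m" "m \<le> m * a"
  using mult_right_mono[of 1 a m] assms by (simp_all add: mult.commute)

lemma quads_bound:
  assumes "(x, z, a, e) \<in> quads n"
  shows "x \<le> n" "z \<le> n" "a \<le> n" "e \<le> n"
proof -
  have "x \<le> x * z" "z \<le> x * z" "a \<le> a * e" "e \<le> a * e" "0 < x * z" "0 < a * e"
    using assms unfolding quads_def by (auto intro!: le_mult_pos)
  then show "x \<le> n" "z \<le> n" "a \<le> n" "e \<le> n"
    using assms unfolding quads_def mem_Collect_eq prod.case by linarith+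
qed

lemma finite_quads [simp]: "finite (quads n)"
proof (rule finite_subset)
  show "quads n \<subseteq> {0..n} \<times> {0..n} \<times> {0..n} \<times> {0..n}"
  proof
    fix q assume q: "q \<in> quads n"
    obtain x z a e where [simp]: "q = (x, z, a, e)" by (cases q)
    have "x \<le> n" "z \<le> n" "a \<le> n" "e \<le> n" using quads_bound q by simp_all
    then show "q \<in> {0..n} \<times> {0..n} \<times> {0..n} \<times> {0..n}" using q by (simp add: quads_def)
  qed
qed auto

text \<open>Half of \<open>quads n\<close>. The weight \<open>half_weight (z - x)\<close> shares the
  diagonal \<open>x = z\<close> between the two halves, see
  \<open>upper_quads_symmetric\<close>.\<close>

definition upper_quads :: "int \<Rightarrow> (int \<times> int \<times> int \<times> int) set" where
  "upper_quads n = {(x, z, a, e) \<in> quads n. x \<le> z}"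

lemma finite_upper_quads [simp]: "finite (upper_quads n)"
  by (rule finite_subset[of _ "quads n"]) (auto simp: upper_quads_def)

text \<open>
  The coordinates \<open>a = (l + v) / 2\<close>, \<open>b = t + (l - v) / 2\<close> on \<open>trace_selling n\<close>, in which \<open>t = v + b - a\<close>, with the
  condition \<open>v \<le> 2 a\<close> (i.e. \<open>0 \<le> l\<close>) dropped. The part \<open>v \<ge> 2 a\<close> to be subtracted is \<open>sum_quads n\<close>, by \<open>v \<mapsto> v - 2 a\<close>.
\<close>

definition difference_quads :: "int \<Rightarrow> (int \<times> int \<times> int \<times> int) set" where
  "difference_quads n = {(a, b, m, v). 0 < a \<and> 0 < b \<and> 0 \<le> m \<and> 0 \<le> v \<and> 0 < m + v \<and>
     even (a - b) \<and> even (m - v) \<and> (b - a)\<^sup>2 + 2 * a * m + 2 * b * v = 4 * n}"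

definition sum_quads :: "int \<Rightarrow> (int \<times> int \<times> int \<times> int) set" where
  "sum_quads n = {(a, b, m, v). 0 < a \<and> 0 < b \<and> 0 \<le> m \<and> 0 \<le> v \<and>
     even (a - b) \<and> even (m - v) \<and> (a + b)\<^sup>2 + 2 * a * m + 2 * b * v = 4 * n}"

lemma abs_le_square: "\<bar>k :: int\<bar> \<le> k\<^sup>2"
proof (cases "k = 0")
  case False
  then have "\<bar>k\<bar> * 1 \<le> \<bar>k\<bar> * \<bar>k\<bar>" by (intro mult_left_mono) auto
  then show ?thesis by (simp add: power2_eq_square)
qed simp

lemma finite_difference_quads [simp]: "finite (difference_quads n)"
proof (rule finite_subset)
  show "difference_quads n \<subseteq> {0..8*n} \<times> {0..8*n} \<times> {0..8*n} \<times> {0..8*n}"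
  proof (intro subrelI, unfold split_paired_all)
    fix a b m v assume A: "(a, b, m, v) \<in> difference_quads n"
    then have p: "0 < a" "0 < b" "0 \<le> m" "0 \<le> v" "0 < m + v"
      and eq: "(b - a)\<^sup>2 + 2 * (a * m) + 2 * (b * v) = 4 * n" by (auto simp: difference_quads_def)
    have 1: "0 \<le> a * m" "0 \<le> b * v" using p by auto
    have 2: "m \<le> a * m" "v \<le> b * v" using p by (auto intro!: le_mult_pos)
    have 3: "\<bar>b - a\<bar> \<le> (b - a)\<^sup>2" by (rule abs_le_square)
    \<comment> \<open>One of \<open>m\<close>, \<open>v\<close> is positive and bounds its cofactor;
      \<open>(b - a)^2\<close> carries the bound over to the other one.\<close>
    have 4: "a \<le> 2 * n \<or> b \<le> 2 * n"
    proof (cases "m = 0")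
      case False
      then have "a * 1 \<le> a * m" using p by (intro mult_left_mono) auto
      then show ?thesis using eq 1 using zero_le_power2[of "b - a"] by linarith
    next
      case True
      then have "b * 1 \<le> b * v" using p by (intro mult_left_mono) auto
      then show ?thesis using eq 1 using zero_le_power2[of "b - a"] by linarith
    qed
    show "(a, b, m, v) \<in> {0..8*n} \<times> {0..8*n} \<times> {0..8*n} \<times> {0..8*n}"
      unfolding atLeastAtMost_iff mem_Sigma_iff using 1 2 3 4 p eq by (intro conjI; linarith)
  qed
qed auto

lemma finite_sum_quads [simp]: "finite (sum_quads n)"
proof (rule finite_subset)
  show "sum_quads n \<subseteq> {0..8*n} \<times> {0..8*n} \<times> {0..8*n} \<times> {0..8*n}"
  proof (intro subrelI, unfold split_paired_all)
    fix a b m v assume A: "(a, b, m, v) \<in> sum_quads n"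
    then have p: "0 < a" "0 < b" "0 \<le> m" "0 \<le> v"
      and eq: "(a + b)\<^sup>2 + 2 * (a * m) + 2 * (b * v) = 4 * n" by (auto simp: sum_quads_def)
    have 1: "0 \<le> a * m" "0 \<le> b * v" using p by auto
    have 2: "m \<le> a * m" "v \<le> b * v" using p by (auto intro!: le_mult_pos)
    have 3: "\<bar>a + b\<bar> \<le> (a + b)\<^sup>2" by (rule abs_le_square)
    show "(a, b, m, v) \<in> {0..8*n} \<times> {0..8*n} \<times> {0..8*n} \<times> {0..8*n}"
      unfolding atLeastAtMost_iff mem_Sigma_iff using 1 2 3 p eq by (intro conjI; linarith)
  qed
qed auto

lemma selling_triples_bound:
  assumes "(l, m, v) \<in> selling_triples N" "0 < N"
  shows "l \<le> N" "m \<le> N" "v \<le> N"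
proof -
  have p: "0 \<le> l" "0 \<le> m" "0 \<le> v" and e: "l * m + m * v + v * l = N"
    using assms by (auto simp: selling_triples_def)
  have b: "l \<le> N" if "0 \<le> l" "0 \<le> m" "0 \<le> v" "l * m + m * v + v * l = N" for l m v :: int
  proof (cases "m + v = 0")
    case True
    then show ?thesis using that assms(2) by (auto simp: add_nonneg_eq_0_iff)
  next
    case False
    then have "0 < m + v" using that by linarith
    then have "l \<le> l * (m + v)" "0 \<le> m * v" using that by (auto intro: le_mult_pos)
    then show ?thesis using that unfolding distrib_left mult.commute[of v l] by linarith
  qed
  show "l \<le> N" using b p e by blast
  show "m \<le> N" using b[of m v l] p e by (simp add: algebra_simps)
  show "v \<le> N" using b[of v l m] p e by (simp add: algebra_simps)
qed

lemma finite_selling_triples: "0 < N \<Longrightarrow> finite (selling_triples N)"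
proof (rule finite_subset)
  assume "0 < N"
  show "selling_triples N \<subseteq> {0..N} \<times> {0..N} \<times> {0..N}"
  proof
    fix q assume q: "q \<in> selling_triples N"
    obtain l m v where [simp]: "q = (l, m, v)" by (cases q)
    have "l \<le> N" "m \<le> N" "v \<le> N" using selling_triples_bound q \<open>0 < N\<close> by simp_all
    then show "q \<in> {0..N} \<times> {0..N} \<times> {0..N}" using q by (simp add: selling_triples_def)
  qed
qed auto

lemma finite_square_le: "finite {t :: int. t\<^sup>2 \<le> N}"
proof (rule finite_subset)
  show "{t. t\<^sup>2 \<le> N} \<subseteq> {-N..N}"
  proof clarify
    fix t :: int assume "t\<^sup>2 \<le> N"
    then show "t \<in> {-N..N}" using abs_le_square[of t] by simp linarith
  qed
qed auto

lemma finite_square_less: "finite {t :: int. t\<^sup>2 < N}"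
  by (rule finite_subset[OF _ finite_square_le[of N]]) auto

lemma trace_selling_Sigma:
  "trace_selling n = Sigma {t. t\<^sup>2 < 4 * n} (\<lambda>t. selling_triples (4 * n - t\<^sup>2))"
  by (auto simp: trace_selling_def)

lemma finite_trace_selling [simp]: "finite (trace_selling n)"
  unfolding trace_selling_Sigma
  by (intro finite_SigmaI finite_square_less finite_selling_triples) auto

text \<open>The entries of a triple share their parity, so \<open>l * m + m * v + v * l\<close> has
  the parity of \<open>l\<close>. In the coordinates of \<open>difference_quads\<close> this is the
  condition \<open>even (a - b)\<close>, because a - b = v - t.\<close>

lemma even_square_diff:
  fixes l m v t n :: int
  assumes "even (l - m)" "even (m - v)" "t\<^sup>2 + (l * m + m * v + v * l) = 4 * n"
  shows "even (t - l)"
proof -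
  have "even (t\<^sup>2 + (l * m + m * v + v * l))" using assms(3) by simp
  then show ?thesis using assms(1,2)
    by (cases "even l"; cases "even m"; cases "even v"; cases "even t"; simp)
qed

section \<open>Substitutions into quadruples with \<open>x * z + a * e = n\<close>\<close>

lemma sum_reindex_onto:
  assumes "\<And>b. b \<in> B \<Longrightarrow> h b \<in> A" "\<And>a. a \<in> A \<Longrightarrow> \<exists>b\<in>B. h b = a" "inj_on h B"
    "\<And>b. b \<in> B \<Longrightarrow> g (h b) = k b"
  shows "sum g A = sum k B"
proof -
  have "A = h ` B" using assms(1,2) by blast
  then show ?thesis by (simp add: sum.reindex assms(3,4))
qed

lemma sum_reindex_involution:
  assumes "\<And>a. a \<in> A \<Longrightarrow> h (h a) = a \<and> h a \<in> B" "\<And>b. b \<in> B \<Longrightarrow> h (h b) = b \<and> h b \<in> A"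
    "\<And>a. a \<in> A \<Longrightarrow> k (h a) = g a"
  shows "sum g A = sum k B"
  using assms by (intro sum.reindex_bij_witness[where i = h and j = h]) auto

lemma evenE_diff:
  fixes a b :: int
  assumes "even (a - b)"
  obtains k where "b = a + 2 * k"
proof -
  from assms obtain c where "a - b = 2 * c" ..
  then show ?thesis using that[of "- c"] by simp
qed

text \<open>With b = a + 2x and m + v = 2e the quadratic condition becomes x(x + v) + ae = n, so z =
  x + v. The truncation \<open>z - x \<le> 2 * e\<close> is what is left of m \<ge> 0. The case b <
  a exchanges the roles of \<open>m\<close> and \<open>v\<close>, and a = b is the case x =
  0.\<close>

lemma difference_quads_less:
  "(\<Sum>(a, b, m, v) \<in> {(a, b, m, v) \<in> difference_quads n. a < b}. half_weight m * half_weight v * f (v + b - a)) =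
   (\<Sum>(x, z, a, e) \<in> {(x, z, a, e) \<in> upper_quads n. z - x \<le> 2 * e}.
      half_weight (z - x) * half_weight (2 * e - z + x) * f (x + z))"
proof (rule sum_reindex_onto[where h = "\<lambda>(x, z, a, e). (a, a + 2 * x, 2 * e - z + x, z - x)"], goal_cases)
  case (2 q)
  obtain a b m v where q: "q = (a, b, m, v)" by (cases q)
  with 2 have D: "0 < a" "0 < b" "0 \<le> m" "0 \<le> v" "0 < m + v" "even (a - b)" "even (b - a)" "even (m - v)" "even (v - m)"
     "(b - a)\<^sup>2 + 2 * a * m + 2 * b * v = 4 * n" "a < b" by (auto simp: difference_quads_def upper_quads_def quads_def)
  obtain x where b: "b = a + 2 * x" using D(6) by (rule evenE_diff)
  obtain k where v: "v = m + 2 * k" using D(8) by (rule evenE_diff)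
  have "(x, x + v, a, m + k) \<in> {(x, z, a, e) \<in> upper_quads n. z - x \<le> 2 * e}"
    using D by (auto simp: b v difference_quads_def upper_quads_def quads_def power2_eq_square algebra_simps)
  then show ?case using D unfolding q by (intro bexI[of _ "(x, x + v, a, m + k)"]) (auto simp: b v)
qed (auto simp: difference_quads_def upper_quads_def quads_def inj_on_def half_weight_def power2_eq_square algebra_simps)

lemma difference_quads_greater:
  "(\<Sum>(a, b, m, v) \<in> {(a, b, m, v) \<in> difference_quads n. b < a}. half_weight m * half_weight v * f (v + b - a)) =
   (\<Sum>(x, z, a, e) \<in> {(x, z, a, e) \<in> upper_quads n. z - x \<le> 2 * e}.
      half_weight (z - x) * half_weight (2 * e - z + x) * f (2 * e - x - z))"
proof (rule sum_reindex_onto[where h = "\<lambda>(x, z, a, e). (a + 2 * x, a, z - x, 2 * e - z + x)"], goal_cases)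
  case (2 q)
  obtain a b m v where q: "q = (a, b, m, v)" by (cases q)
  with 2 have D: "0 < a" "0 < b" "0 \<le> m" "0 \<le> v" "0 < m + v" "even (a - b)" "even (b - a)" "even (m - v)" "even (v - m)"
     "(b - a)\<^sup>2 + 2 * a * m + 2 * b * v = 4 * n" "b < a" by (auto simp: difference_quads_def upper_quads_def quads_def)
  obtain x where a: "a = b + 2 * x" using D(7) by (rule evenE_diff)
  obtain k where v: "v = m + 2 * k" using D(8) by (rule evenE_diff)
  have "(x, x + m, b, m + k) \<in> {(x, z, a, e) \<in> upper_quads n. z - x \<le> 2 * e}"
    using D by (auto simp: a v difference_quads_def upper_quads_def quads_def power2_eq_square algebra_simps)
  then show ?case using D unfolding q by (intro bexI[of _ "(x, x + m, b, m + k)"]) (auto simp: a v)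
qed (auto simp: difference_quads_def upper_quads_def quads_def inj_on_def half_weight_def power2_eq_square algebra_simps)

lemma difference_quads_equal:
  "(\<Sum>(a, b, m, v) \<in> {(a, b, m, v) \<in> difference_quads n. a = b}. half_weight m * half_weight v * f (v + b - a)) =
   (\<Sum>(a, e, v) \<in> {(a, e, v). 0 < a \<and> 0 < e \<and> a * e = n \<and> 0 \<le> v \<and> v \<le> 2 * e}.
      half_weight (2 * e - v) * half_weight v * f v)"
proof (rule sum_reindex_onto[where h = "\<lambda>(a, e, v). (a, a, 2 * e - v, v)"], goal_cases)
  case (2 q)
  obtain a b m v where q: "q = (a, b, m, v)" by (cases q)
  with 2 have D: "0 < a" "0 < b" "0 \<le> m" "0 \<le> v" "0 < m + v" "even (a - b)" "even (b - a)" "even (m - v)" "even (v - m)"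
     "(b - a)\<^sup>2 + 2 * a * m + 2 * b * v = 4 * n" "a = b" by (auto simp: difference_quads_def upper_quads_def quads_def)
  obtain k where v: "v = m + 2 * k" using D(8) by (rule evenE_diff)
  have "(a, m + k, v) \<in> {(a, e, v). 0 < a \<and> 0 < e \<and> a * e = n \<and> 0 \<le> v \<and> v \<le> 2 * e}"
    using D by (auto simp: v difference_quads_def upper_quads_def quads_def power2_eq_square algebra_simps)
  then show ?case using D unfolding q by (intro bexI[of _ "(a, m + k, v)"]) (auto simp: v)
qed (auto simp: difference_quads_def upper_quads_def quads_def inj_on_def half_weight_def power2_eq_square algebra_simps)

text \<open>Here a + b = 2x and m - v = 2e turn the condition into x(x + v) + ae = n, and b = 2x - a
  > 0 becomes \<open>a < 2 * x\<close>. For m < v the roles of \<open>a\<close> and \<open>b\<close>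
  are exchanged, which adds 2e to the argument of \<open>f\<close>.\<close>

lemma sum_quads_greater:
  "(\<Sum>(a, b, m, v) \<in> {(a, b, m, v) \<in> sum_quads n. v < m}. half_weight m * half_weight v * f (v + a + b)) =
   (\<Sum>(x, z, a, e) \<in> {(x, z, a, e) \<in> upper_quads n. a < 2 * x}. half_weight (z - x) * f (x + z))"
proof (rule sum_reindex_onto[where h = "\<lambda>(x, z, a, e). (a, 2 * x - a, z - x + 2 * e, z - x)"], goal_cases)
  case (2 q)
  obtain a b m v where q: "q = (a, b, m, v)" by (cases q)
  with 2 have D: "0 < a" "0 < b" "0 \<le> m" "0 \<le> v" "even (a - b)" "even (m - v)" "even (v - m)"
     "(a + b)\<^sup>2 + 2 * a * m + 2 * b * v = 4 * n" "v < m" by (auto simp: sum_quads_def upper_quads_def quads_def)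
  obtain k where b: "b = a + 2 * k" using D(5) by (rule evenE_diff)
  obtain e where m: "m = v + 2 * e" using D(7) by (rule evenE_diff)
  have "(a + k, a + k + v, a, e) \<in> {(x, z, a, e) \<in> upper_quads n. a < 2 * x}"
    using D by (auto simp: b m sum_quads_def upper_quads_def quads_def power2_eq_square algebra_simps)
  then show ?case using D unfolding q by (intro bexI[of _ "(a + k, a + k + v, a, e)"]) (auto simp: b m)
qed (auto simp: sum_quads_def upper_quads_def quads_def inj_on_def half_weight_def power2_eq_square algebra_simps)

lemma sum_quads_less:
  "(\<Sum>(a, b, m, v) \<in> {(a, b, m, v) \<in> sum_quads n. m < v}. half_weight m * half_weight v * f (v + a + b)) =
   (\<Sum>(x, z, a, e) \<in> {(x, z, a, e) \<in> upper_quads n. a < 2 * x}. half_weight (z - x) * f (x + z + 2 * e))"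
proof (rule sum_reindex_onto[where h = "\<lambda>(x, z, a, e). (2 * x - a, a, z - x, z - x + 2 * e)"], goal_cases)
  case (2 q)
  obtain a b m v where q: "q = (a, b, m, v)" by (cases q)
  with 2 have D: "0 < a" "0 < b" "0 \<le> m" "0 \<le> v" "even (a - b)" "even (m - v)" "even (v - m)"
     "(a + b)\<^sup>2 + 2 * a * m + 2 * b * v = 4 * n" "m < v" by (auto simp: sum_quads_def upper_quads_def quads_def)
  obtain k where b: "b = a + 2 * k" using D(5) by (rule evenE_diff)
  obtain e where v: "v = m + 2 * e" using D(6) by (rule evenE_diff)
  have "(a + k, a + k + m, b, e) \<in> {(x, z, a, e) \<in> upper_quads n. a < 2 * x}"
    using D by (auto simp: b v sum_quads_def upper_quads_def quads_def power2_eq_square algebra_simps)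
  then show ?case using D unfolding q by (intro bexI[of _ "(a + k, a + k + m, b, e)"]) (auto simp: b v)
qed (auto simp: sum_quads_def upper_quads_def quads_def inj_on_def half_weight_def power2_eq_square algebra_simps)

lemma sum_quads_equal:
  "(\<Sum>(a, b, m, v) \<in> {(a, b, m, v) \<in> sum_quads n. m = v \<and> 0 < v}. half_weight m * half_weight v * f (v + a + b)) =
   (\<Sum>(x, z, a) \<in> {(x, z, a). 0 < x \<and> x < z \<and> x * z = n \<and> 0 < a \<and> a < 2 * x}. f (x + z))"
proof (rule sum_reindex_onto[where h = "\<lambda>(x, z, a). (a, 2 * x - a, z - x, z - x)"], goal_cases)
  case (2 q)
  obtain a b m v where q: "q = (a, b, m, v)" by (cases q)
  with 2 have D: "0 < a" "0 < b" "0 \<le> m" "0 \<le> v" "even (a - b)" "even (m - v)" "even (v - m)"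
     "(a + b)\<^sup>2 + 2 * a * m + 2 * b * v = 4 * n" "m = v" "0 < v" by (auto simp: sum_quads_def upper_quads_def quads_def)
  obtain k where b: "b = a + 2 * k" using D(5) by (rule evenE_diff)
  have "(a + k, a + k + v, a) \<in> {(x, z, a). 0 < x \<and> x < z \<and> x * z = n \<and> 0 < a \<and> a < 2 * x}"
    using D by (auto simp: b sum_quads_def upper_quads_def quads_def power2_eq_square algebra_simps)
  then show ?case using D unfolding q by (intro bexI[of _ "(a + k, a + k + v, a)"]) (auto simp: b)
qed (auto simp: sum_quads_def upper_quads_def quads_def inj_on_def half_weight_def power2_eq_square algebra_simps)

text \<open>By xz + ae = x(z - 2e) + (a + 2x)e a condition on z - x becomes one comparing
  \<open>a\<close> with 2x. That is the kind of condition that \<open>sum_quads\<close> produces, so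
  the pieces can be added up.\<close>

lemma upper_quads_shift:
  "(\<Sum>(x, z, a, e) \<in> {(x, z, a, e) \<in> upper_quads n. 2 * e \<le> z - x}. half_weight (z - x - 2 * e) * g x z e) =
   (\<Sum>(x, z, a, e) \<in> {(x, z, a, e) \<in> upper_quads n. 2 * x < a}. half_weight (z - x) * g x (z + 2 * e) e)"
proof (rule sum_reindex_onto[where h = "\<lambda>(x, z, a, e). (x, z + 2 * e, a - 2 * x, e)"], goal_cases)
  case (1 q)
  then show ?case by (auto simp: upper_quads_def quads_def algebra_simps)
next
  case (2 q)
  obtain x z a e where q: "q = (x, z, a, e)" by (cases q)
  with 2 have D: "0 < x" "0 < z" "0 < a" "0 < e" "x \<le> z" "x * z + a * e = n" "2 * e \<le> z - x"
    by (auto simp: upper_quads_def quads_def)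
  have "(x, z - 2 * e, a + 2 * x, e) \<in> {(x, z, a, e) \<in> upper_quads n. 2 * x < a}"
    using D by (auto simp: upper_quads_def quads_def algebra_simps)
  then show ?case unfolding q by (intro bexI[of _ "(x, z - 2 * e, a + 2 * x, e)"]) auto
next
  case 3
  then show ?case by (auto simp: inj_on_def)
next
  case (4 q)
  then show ?case by (auto simp: algebra_simps)
qed

text \<open>2t + l - v is 2b in the coordinates of \<open>difference_quads\<close>; the reflection
  changes its sign, so only b > 0 has to be transformed.\<close>

lemma trace_selling_reflect:
  assumes "\<And>t. f (- t) = f t"
  shows "(\<Sum>(t, l, m, v) \<in> {(t, l, m, v) \<in> trace_selling n. 2 * t + l < v}.
            half_weight l * half_weight m * half_weight v * f t) =
         (\<Sum>(t, l, m, v) \<in> {(t, l, m, v) \<in> trace_selling n. v < 2 * t + l}.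
            half_weight l * half_weight m * half_weight v * f t)"
  by (rule sum_reindex_involution[where h = "\<lambda>(t, l, m, v). (- t, v, m, l)"])
     (auto simp: trace_selling_def selling_triples_def assms algebra_simps)

text \<open>The excluded case m = 0, v = 2a would be l = m = 0, a degenerate form of discriminant
  0.\<close>

lemma trace_selling_difference_quads:
  "(\<Sum>(t, l, m, v) \<in> {(t, l, m, v) \<in> trace_selling n. v < 2 * t + l}.
      half_weight l * half_weight m * half_weight v * f t) =
   (\<Sum>(a, b, m, v) \<in> {(a, b, m, v) \<in> difference_quads n. v \<le> 2 * a \<and> \<not> (m = 0 \<and> v = 2 * a)}.
      half_weight (2 * a - v) * half_weight m * half_weight v * f (v + b - a))"
proof (rule sum_reindex_onto[where h = "\<lambda>(a, b, m, v). (v + b - a, 2 * a - v, m, v)"], goal_cases)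
  case (1 q)
  obtain a b m v where q: "q = (a, b, m, v)" by (cases q)
  with 1 have D: "0 < a" "0 < b" "0 \<le> m" "0 \<le> v" "0 < m + v" "even (a - b)" "even (m - v)"
    "(b - a)\<^sup>2 + 2 * a * m + 2 * b * v = 4 * n" "v \<le> 2 * a" "\<not> (m = 0 \<and> v = 2 * a)"
    by (auto simp: difference_quads_def)
  have e: "(2 * a - v) * m + m * v + v * (2 * a - v) = 4 * n - (v + b - a)\<^sup>2"
    using D(8) by (simp add: power2_eq_square algebra_simps)
  have "0 < (2 * a - v) * m + m * v + v * (2 * a - v)"
  proof (cases "m = 0")
    case True
    then show ?thesis using D by simp
  next
    case False
    then have "0 < 2 * (a * m)" "0 \<le> v * (2 * a - v)" using D by simp_all
    then show ?thesis by (simp add: algebra_simps)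
  qed
  with e have "(v + b - a)\<^sup>2 < 4 * n" by linarith
  moreover have "even (2 * a - v - m)" using D(7) by simp
  ultimately show ?case using D e unfolding q
    by (simp add: trace_selling_def selling_triples_def)
next
  case (2 q)
  obtain t l m v where q: "q = (t, l, m, v)" by (cases q)
  with 2 have D: "t\<^sup>2 < 4 * n" "0 \<le> l" "0 \<le> m" "0 \<le> v" "even (l - m)" "even (m - v)"
    "l * m + m * v + v * l = 4 * n - t\<^sup>2" "v < 2 * t + l"
    by (auto simp: trace_selling_def selling_triples_def)
  have "even (t - l)" using D by (intro even_square_diff[of l m v t n]) auto
  have "even (v - l)" using D by simp
  then obtain k where k: "l = v + 2 * k" by (rule evenE_diff)
  have pos: "0 < l * m + m * v + v * l" using D by linarith
  have "0 < m + v" "0 < l + v" using pos D by (auto simp: add_nonneg_eq_0_iff order_less_le)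
  have "\<not> (m = 0 \<and> l = 0)" using pos by auto
  have "(v + k, t + k, m, v) \<in> difference_quads n"
    using D \<open>even (t - l)\<close> \<open>0 < m + v\<close> \<open>0 < l + v\<close>
    by (simp add: difference_quads_def k power2_eq_square algebra_simps)
  then show ?case using \<open>\<not> (m = 0 \<and> l = 0)\<close> D unfolding q
    by (intro bexI[of _ "(v + k, t + k, m, v)"]) (auto simp: k)
next
  case 3
  then show ?case by (auto simp: inj_on_def)
next
  case (4 q)
  then show ?case by auto
qed

text \<open>The left side needs no factor \<open>half_weight v\<close>:
  \<open>v \<ge> 2 * a > 0\<close> makes it 1. The factor on the boundary v = 2a turns into the one
  for v = 0.\<close>

lemma difference_quads_sum_quads:
  "(\<Sum>(a, b, m, v) \<in> {(a, b, m, v) \<in> difference_quads n. 2 * a \<le> v}.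
      half_weight (v - 2 * a) * half_weight m * f (v + b - a)) =
   (\<Sum>(a, b, m, v) \<in> sum_quads n. half_weight m * half_weight v * f (v + a + b))"
proof (rule sum_reindex_onto[where h = "\<lambda>(a, b, m, v). (a, b, m, v + 2 * a)"], goal_cases)
  case (1 q)
  then show ?case
    by (auto simp: difference_quads_def sum_quads_def power2_eq_square algebra_simps)
next
  case (2 q)
  obtain a b m v where q: "q = (a, b, m, v)" by (cases q)
  with 2 have "(a, b, m, v - 2 * a) \<in> sum_quads n"
    by (auto simp: difference_quads_def sum_quads_def power2_eq_square algebra_simps)
  then show ?case unfolding q by (intro bexI[of _ "(a, b, m, v - 2 * a)"]) auto
next
  case 3
  then show ?case by (auto simp: inj_on_def)
next
  case (4 q)
  then show ?case by (cases q) (simp add: algebra_simps)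
qed

section \<open>Telescoping of the substituted sums\<close>

lemma sum_filter4:
  assumes "finite A"
  shows "(\<Sum>(x, z, a, e) \<in> {(x, z, a, e) \<in> A. P x z a e}. g x z a e) =
         (\<Sum>(x, z, a, e) \<in> A. if P x z a e then g x z a e else (0 :: real))"
proof -
  have "{(x, z, a, e) \<in> A. P x z a e} = {q \<in> A. case q of (x, z, a, e) \<Rightarrow> P x z a e}" by auto
  then show ?thesis
    by (simp add: sum.inter_filter assms) (rule sum.cong, auto)
qed

text \<open>The full sum minus the complementary range, which is then shifted; the common boundary z
  - x = 2e counts one half on each side.\<close>

lemma upper_quads_truncated:
  "(\<Sum>(x, z, a, e) \<in> {(x, z, a, e) \<in> upper_quads n. z - x \<le> 2 * e}.
      half_weight (z - x) * half_weight (2 * e - z + x) * g x z e) =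
   (\<Sum>(x, z, a, e) \<in> upper_quads n. half_weight (z - x) * g x z e) -
   (\<Sum>(x, z, a, e) \<in> {(x, z, a, e) \<in> upper_quads n. 2 * x < a}. half_weight (z - x) * g x (z + 2 * e) e)"
  unfolding upper_quads_shift[symmetric] sum_filter4[OF finite_upper_quads] sum_subtractf[symmetric]
  by (rule sum.cong) (auto simp: half_weight_def upper_quads_def quads_def)

lemma difference_quads_split:
  "(\<Sum>(a, b, m, v) \<in> difference_quads n. g a b m v) =
   (\<Sum>(a, b, m, v) \<in> {(a, b, m, v) \<in> difference_quads n. a < b}. g a b m v) +
   (\<Sum>(a, b, m, v) \<in> {(a, b, m, v) \<in> difference_quads n. b < a}. g a b m v) +
   (\<Sum>(a, b, m, v) \<in> {(a, b, m, v) \<in> difference_quads n. a = b}. g a b m v :: real)"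
  unfolding sum_filter4[OF finite_difference_quads] sum.distrib[symmetric]
  by (rule sum.cong) auto

lemma sum_quads_split:
  assumes "\<And>a b m v. (a, b, m, v) \<in> sum_quads n \<Longrightarrow> m = 0 \<Longrightarrow> v = 0 \<Longrightarrow> g a b m v = 0"
  shows
  "(\<Sum>(a, b, m, v) \<in> sum_quads n. g a b m v) =
   (\<Sum>(a, b, m, v) \<in> {(a, b, m, v) \<in> sum_quads n. v < m}. g a b m v) +
   (\<Sum>(a, b, m, v) \<in> {(a, b, m, v) \<in> sum_quads n. m < v}. g a b m v) +
   (\<Sum>(a, b, m, v) \<in> {(a, b, m, v) \<in> sum_quads n. m = v \<and> 0 < v}. g a b m v :: real)"
  unfolding sum_filter4[OF finite_sum_quads] sum.distrib[symmetric]
proof (rule sum.cong, goal_cases)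
  case (2 q)
  then show ?case using assms by (cases q) (auto simp: sum_quads_def)
qed simp

lemma trace_selling_split:
  "(\<Sum>(t, l, m, v) \<in> trace_selling n. g t l m v) =
   (\<Sum>(t, l, m, v) \<in> {(t, l, m, v) \<in> trace_selling n. 2 * t + l < v}. g t l m v) +
   (\<Sum>(t, l, m, v) \<in> {(t, l, m, v) \<in> trace_selling n. v < 2 * t + l}. g t l m v) +
   (\<Sum>(t, l, m, v) \<in> {(t, l, m, v) \<in> trace_selling n. 2 * t + l = v}. g t l m v :: real)"
  unfolding sum_filter4[OF finite_trace_selling] sum.distrib[symmetric]
  by (rule sum.cong) auto

lemma upper_quads_symmetric:
  assumes "\<And>x z e. g x z e = g z x e"
  shows "2 * (\<Sum>(x, z, a, e) \<in> upper_quads n. half_weight (z - x) * g x z e) = (\<Sum>(x, z, a, e) \<in> quads n. g x z e)"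
proof -
  have U: "upper_quads n = {(x, z, a, e) \<in> quads n. x \<le> z}" by (simp add: upper_quads_def)
  have "(\<Sum>(x, z, a, e) \<in> upper_quads n. half_weight (z - x) * g x z e) =
        (\<Sum>(x, z, a, e) \<in> {(x, z, a, e) \<in> quads n. z \<le> x}. half_weight (z - x) * g x z e)"
    by (rule sum_reindex_involution[where h = "\<lambda>(x, z, a, e). (z, x, a, e)"])
       (auto simp: upper_quads_def quads_def half_weight_def assms algebra_simps)
  then have "2 * (\<Sum>(x, z, a, e) \<in> upper_quads n. half_weight (z - x) * g x z e) =
      (\<Sum>(x, z, a, e) \<in> {(x, z, a, e) \<in> quads n. x \<le> z}. half_weight (z - x) * g x z e) +
      (\<Sum>(x, z, a, e) \<in> {(x, z, a, e) \<in> quads n. z \<le> x}. half_weight (z - x) * g x z e)"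
    unfolding U by simp
  also have "\<dots> = (\<Sum>(x, z, a, e) \<in> quads n. g x z e)"
    unfolding sum_filter4[OF finite_quads] sum.distrib[symmetric]
    by (rule sum.cong) (auto simp: half_weight_def)
  finally show ?thesis .
qed

text \<open>Twice the part b > 0 plus the part b = 0. In the notation of the proof the former is S1
  - S2, where up to divisor sums S1 = U f1 + U f3 - G f1 - G f2 and S2 = Ls f1 + Ls f2. As U = G +
  Ls + E, the f1 terms cancel down to E f1, and U f3 - U f2 + E f1 + E f2 remains.\<close>

theorem trace_selling_sum:
  fixes f :: "int \<Rightarrow> real"
  assumes even: "\<And>t. f (- t) = f t" and zero: "\<And>t. t\<^sup>2 = 4 * n \<Longrightarrow> f t = 0"
  shows "(\<Sum>(t, l, m, v) \<in> trace_selling n. half_weight l * half_weight m * half_weight v * f t) =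
    (\<Sum>(x, z, a, e) \<in> quads n. f (x + z - 2 * e) - f (x + z + 2 * e)) +
    (\<Sum>(t, l, m, v) \<in> {(t, l, m, v) \<in> trace_selling n. 2 * t + l = v}.
       half_weight l * half_weight m * half_weight v * f t) +
    2 * ((\<Sum>(x, z, a, e) \<in> {(x, z, a, e) \<in> upper_quads n. a = 2 * x}.
            half_weight (z - x) * (f (x + z) + f (x + z + 2 * e))) +
         (\<Sum>(a, e, v) \<in> {(a, e, v). 0 < a \<and> 0 < e \<and> a * e = n \<and> 0 \<le> v \<and> v \<le> 2 * e}.
            half_weight (2 * e - v) * half_weight v * f v) -
         (\<Sum>(x, z, a) \<in> {(x, z, a). 0 < x \<and> x < z \<and> x * z = n \<and> 0 < a \<and> a < 2 * x}. f (x + z)))"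
proof -
  define S1 where "S1 = (\<Sum>(a, b, m, v) \<in> difference_quads n. half_weight m * half_weight v * f (v + b - a))"
  define S2 where "S2 = (\<Sum>(a, b, m, v) \<in> sum_quads n. half_weight m * half_weight v * f (v + a + b))"
  define U where "U g = (\<Sum>(x, z, a, e) \<in> upper_quads n. half_weight (z - x) * g x z e)" for g :: "int \<Rightarrow> int \<Rightarrow> int \<Rightarrow> real"
  define G where "G g = (\<Sum>(x, z, a, e) \<in> {(x, z, a, e) \<in> upper_quads n. 2 * x < a}. half_weight (z - x) * g x z e)" for g :: "int \<Rightarrow> int \<Rightarrow> int \<Rightarrow> real"
  define Ls where "Ls g = (\<Sum>(x, z, a, e) \<in> {(x, z, a, e) \<in> upper_quads n. a < 2 * x}. half_weight (z - x) * g x z e)" for g :: "int \<Rightarrow> int \<Rightarrow> int \<Rightarrow> real"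
  define E where "E g = (\<Sum>(x, z, a, e) \<in> {(x, z, a, e) \<in> upper_quads n. a = 2 * x}. half_weight (z - x) * g x z e)" for g :: "int \<Rightarrow> int \<Rightarrow> int \<Rightarrow> real"
  define f1 f2 f3 where "f1 x z e = f (x + z)" and "f2 x z e = f (x + z + 2 * e)"
    and "f3 x z e = f (x + z - 2 * e)" for x z e :: int
  have split: "U g = G g + Ls g + E g" for g
    unfolding U_def G_def Ls_def E_def sum_filter4[OF finite_upper_quads] sum.distrib[symmetric]
    by (rule sum.cong) auto
  have E_add: "E (\<lambda>x z e. g x z e + h x z e) = E g + E h" for g h
    unfolding E_def sum_filter4[OF finite_upper_quads] sum.distrib[symmetric]
    by (rule sum.cong) (auto simp: algebra_simps)
  have U_diff: "U (\<lambda>x z e. g x z e - h x z e) = U g - U h" for g h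
    unfolding U_def sum_subtractf[symmetric] by (rule sum.cong) (auto simp: algebra_simps)
  have pos: "(\<Sum>(t, l, m, v) \<in> {(t, l, m, v) \<in> trace_selling n. v < 2 * t + l}.
            half_weight l * half_weight m * half_weight v * f t) = S1 - S2"
    unfolding trace_selling_difference_quads S1_def S2_def difference_quads_sum_quads[symmetric]
      sum_filter4[OF finite_difference_quads] sum_subtractf[symmetric]
  proof (rule sum.cong, goal_cases)
    case (2 q)
    obtain a b m v where q: "q = (a, b, m, v)" by (cases q)
    \<comment> \<open>In this case (b - a)^2 + 2bv = (a + b)^2, so the argument a + b satisfies t^2
      = 4n.\<close>
    have "f (v + b - a) = 0" if "m = 0" "v = 2 * a"
      using 2 that by (intro zero) (auto simp: q difference_quads_def power2_eq_square algebra_simps)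
    then show ?case using 2 by (auto simp: q difference_quads_def half_weight_def)
  qed simp
  have "S1 = (U f1 - G f2) + (U f3 - G f1) +
         (\<Sum>(a, e, v) \<in> {(a, e, v). 0 < a \<and> 0 < e \<and> a * e = n \<and> 0 \<le> v \<and> v \<le> 2 * e}.
            half_weight (2 * e - v) * half_weight v * f v)"
  proof -
    have 1: "f (2 * e - x - z) = f3 x z e" for x z e
      using even[of "2 * e - x - z"] by (simp add: f3_def algebra_simps)
    have 2: "f (x + z) = f1 x z e" for x z e by (simp add: f1_def)
    show ?thesis
      unfolding S1_def difference_quads_split difference_quads_less difference_quads_greater
        difference_quads_equal 1
      by (subst 2) (simp only: upper_quads_truncated U_def G_def f1_def f2_def f3_def
           add_diff_eq diff_add_cancel add_diff_cancel_right' add.assoc[symmetric] ring_distribs)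
  qed
  moreover have "S2 = Ls f1 + Ls f2 +
     (\<Sum>(x, z, a) \<in> {(x, z, a). 0 < x \<and> x < z \<and> x * z = n \<and> 0 < a \<and> a < 2 * x}. f (x + z))"
    unfolding S2_def Ls_def f1_def f2_def sum_quads_greater[symmetric] sum_quads_less[symmetric] sum_quads_equal[symmetric]
  proof (rule sum_quads_split)
    fix a b m v assume "(a, b, m, v) \<in> sum_quads n" "m = 0" "v = 0"
    then have "f (v + a + b) = 0" by (intro zero) (auto simp: sum_quads_def)
    then show "half_weight m * half_weight v * f (v + a + b) = 0" by simp
  qed
  moreover have "2 * U (\<lambda>x z e. f3 x z e - f2 x z e) = (\<Sum>(x, z, a, e) \<in> quads n. f3 x z e - f2 x z e)"
    unfolding U_def by (rule upper_quads_symmetric) (simp add: f2_def f3_def algebra_simps)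
  ultimately show ?thesis
    using split[of f1] split[of f2] E_add[of f1 f2] U_diff[of f3 f2]
    unfolding trace_selling_split[where g = "\<lambda>t l m v. half_weight l * half_weight m * half_weight v * f t"]
      trace_selling_reflect[of f, OF even] pos
    by (simp add: E_def f1_def f2_def f3_def)
qed

section \<open>Hurwitz class numbers and Selling triples\<close>

lemma bqf_pos_def_iff:
  assumes "b\<^sup>2 - 4 * a * c < 0"
  shows "bqf_pos_def (a, b, c) \<longleftrightarrow> 0 < a"
proof
  assume "bqf_pos_def (a, b, c)"
  then have "\<And>x y :: real. (x, y) \<noteq> (0, 0) \<Longrightarrow> bqf_eval (a, b, c) x y > 0"
    unfolding bqf_pos_def_def by blast
  from this[of 1 0] show "0 < a" by simp
next
  assume a: "0 < a"
  have d: "0 < 4 * real_of_int a * c - (real_of_int b)\<^sup>2"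
    using assms by (metis (mono_tags) diff_gt_0_iff_gt diff_less_0_iff_less of_int_less_iff of_int_mult of_int_numeral of_int_power)
  have "0 < bqf_eval (a, b, c) x y" if "(x, y) \<noteq> (0, 0)" for x y :: real
  proof -
    have "4 * real_of_int a * bqf_eval (a, b, c) x y = (2 * a * x + b * y)\<^sup>2 + (4 * real_of_int a * c - (real_of_int b)\<^sup>2) * y\<^sup>2"
      by (simp add: power2_eq_square algebra_simps)
    also have "\<dots> > 0"
    proof (cases "y = 0")
      case True
      then show ?thesis using that a by simp
    next
      case False
      then have "0 < (4 * real_of_int a * c - (real_of_int b)\<^sup>2) * y\<^sup>2" using d by simp
      then show ?thesis by (smt (verit) zero_le_power2)
    qed
    finally show ?thesis using a by (simp add: zero_less_mult_iff)
  qed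
  then show "bqf_pos_def (a, b, c)" by (simp add: bqf_pos_def_def)
qed

lemma pos_def_forms_iff:
  assumes "0 < N"
  shows "(a, b, c) \<in> pos_def_forms N \<longleftrightarrow> 0 < a \<and> b\<^sup>2 - 4 * a * c = - N"
  using bqf_pos_def_iff[of b a c] assms by (auto simp: pos_def_forms_def)

lemma bqf_equivI:
  assumes "i * h - j * k = (1 :: int)"
    and "\<And>x y :: int. bqf_eval R x y = bqf_eval Q (i * x + j * y) (k * x + h * y)"
  shows "bqf_equiv Q R"
  using assms unfolding bqf_equiv_def by blast

lemma pos_def_forms_equiv:
  assumes N: "0 < N" and Q: "Q \<in> pos_def_forms N" and QR: "bqf_equiv Q R"
  shows "R \<in> pos_def_forms N"
proof -
  obtain a b c where q: "Q = (a, b, c)" by (cases Q)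
  obtain a' b' c' where r: "R = (a', b', c')" by (cases R)
  obtain i j k h :: int where d: "i * h - j * k = 1"
    and e: "\<And>x y :: int. bqf_eval R x y = bqf_eval Q (i * x + j * y) (k * x + h * y)"
    using QR unfolding bqf_equiv_def by blast
  have a': "a' = a * i\<^sup>2 + b * i * k + c * k\<^sup>2" using e[of 1 0] by (simp add: q r)
  have c': "c' = a * j\<^sup>2 + b * j * h + c * h\<^sup>2" using e[of 0 1] by (simp add: q r)
  have "a' + b' + c' = a * (i + j)\<^sup>2 + b * (i + j) * (k + h) + c * (k + h)\<^sup>2"
    using e[of 1 1] by (simp add: q r)
  then have b': "b' = 2 * a * i * j + b * (i * h + j * k) + 2 * c * k * h"
    unfolding a' c' by (simp add: power2_eq_square algebra_simps)
  have D: "0 < a" "b\<^sup>2 - 4 * a * c = - N" using Q N by (simp_all add: q pos_def_forms_iff)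
  have "b'\<^sup>2 - 4 * a' * c' = (b\<^sup>2 - 4 * a * c) * (i * h - j * k)\<^sup>2"
    unfolding a' b' c' by (simp add: power2_eq_square algebra_simps)
  then have disc: "b'\<^sup>2 - 4 * a' * c' = - N" using d D by simp
  have "4 * a * a' = (2 * a * i + b * k)\<^sup>2 + N * k\<^sup>2"
  proof -
    have "N = 4 * a * c - b\<^sup>2" using D by simp
    moreover have "4 * a * a' = (2 * a * i + b * k)\<^sup>2 + (4 * a * c - b\<^sup>2) * k\<^sup>2"
      unfolding a' by (simp add: power2_eq_square algebra_simps)
    ultimately show ?thesis by simp
  qed
  also have "\<dots> > 0"
  proof (cases "k = 0")
    case True
    then show ?thesis using d D by auto
  next
    case False
    then have "0 < N * k\<^sup>2" using N by simp
    then show ?thesis using zero_le_power2[of "2 * a * i + b * k"] by linarith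
  qed
  finally have "0 < a'" using D by (simp add: zero_less_mult_iff)
  then show ?thesis using disc N by (simp add: r pos_def_forms_iff)
qed

fun selling_form :: "int \<times> int \<times> int \<Rightarrow> bqf" where
  "selling_form (l, m, v) = ((l + v) div 2, - v, (m + v) div 2)"

lemma bqf_eval_selling_form:
  assumes "even (l - m)" "even (m - v)"
  shows "2 * bqf_eval (selling_form (l, m, v)) x y = l * x\<^sup>2 + m * y\<^sup>2 + v * (x - y)\<^sup>2"
proof -
  have "2 * ((l + v) div 2) = l + v" "2 * ((m + v) div 2) = m + v" using assms by auto
  moreover have "2 * bqf_eval (selling_form (l, m, v)) x y =
    (2 * ((l + v) div 2)) * x\<^sup>2 - 2 * v * x * y + (2 * ((m + v) div 2)) * y\<^sup>2"
    by (simp add: algebra_simps)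
  ultimately show ?thesis by (simp add: power2_eq_square algebra_simps)
qed

lemma selling_form_in:
  assumes "0 < N" "T \<in> selling_triples N"
  shows "selling_form T \<in> pos_def_forms N"
proof -
  obtain l m v where T: "T = (l, m, v)" by (cases T)
  have D: "0 \<le> l" "0 \<le> m" "0 \<le> v" "even (l - m)" "even (m - v)" "l * m + m * v + v * l = N"
    using assms by (auto simp: T selling_triples_def)
  have "even (- v - l)" "even (- v - m)" using D(4,5) by auto
  obtain a where a: "l = - v + 2 * a" using \<open>even (- v - l)\<close> by (rule evenE_diff)
  obtain c where c: "m = - v + 2 * c" using \<open>even (- v - m)\<close> by (rule evenE_diff)
  have "v\<^sup>2 - 4 * a * c = - N" using D(6) unfolding a c by (simp add: power2_eq_square algebra_simps)
  moreover have "0 < a"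
  proof (rule ccontr)
    assume "\<not> 0 < a"
    then have "l = 0" "v = 0" using D a by auto
    then show False using D assms by simp
  qed
  ultimately show ?thesis using assms by (simp add: T a c pos_def_forms_iff)
qed

lemma selling_form_equiv_iff:
  assumes "even (l - m)" "even (m - v)" "even (l' - m')" "even (m' - v')"
  shows "bqf_equiv (selling_form (l, m, v)) (selling_form (l', m', v')) \<longleftrightarrow>
    (\<exists>i j k h :: int. i * h - j * k = 1 \<and> (\<forall>x y. l' * x\<^sup>2 + m' * y\<^sup>2 + v' * (x - y)\<^sup>2 =
       l * (i * x + j * y)\<^sup>2 + m * (k * x + h * y)\<^sup>2 + v * (i * x + j * y - (k * x + h * y))\<^sup>2))"
  unfolding bqf_equiv_def bqf_eval_selling_form[OF assms(1,2), symmetric]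
    bqf_eval_selling_form[OF assms(3,4), symmetric] by (simp del: bqf_eval.simps selling_form.simps)

section \<open>Equivalences between Selling triples\<close>

lemma hexagonal_norm:
  fixes r s :: int
  assumes "(r, s) \<noteq> (0, 0)"
  shows "2 \<le> r\<^sup>2 + s\<^sup>2 + (r + s)\<^sup>2"
    and "r\<^sup>2 + s\<^sup>2 + (r + s)\<^sup>2 = 2 \<Longrightarrow>
      (r, s) \<in> {(1, 0), (- 1, 0), (0, 1), (0, - 1), (1, - 1), (- 1, 1)}"
proof -
  have "0 < r\<^sup>2 + s\<^sup>2" using assms by (simp add: sum_power2_gt_zero_iff)
  then have "0 < r\<^sup>2 + s\<^sup>2 + (r + s)\<^sup>2" using zero_le_power2[of "r + s"] by linarith
  moreover have "even (r\<^sup>2 + s\<^sup>2 + (r + s)\<^sup>2)" by auto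
  moreover have "2 \<le> k" if "0 < k" "even k" for k :: int using that by presburger
  ultimately show "2 \<le> r\<^sup>2 + s\<^sup>2 + (r + s)\<^sup>2" by blast
  assume 2: "r\<^sup>2 + s\<^sup>2 + (r + s)\<^sup>2 = 2"
  have small: "\<bar>t\<bar> \<le> 1" if "t\<^sup>2 \<le> 2" for t :: int
  proof (rule ccontr)
    assume "\<not> \<bar>t\<bar> \<le> 1"
    then have "2 * 2 \<le> \<bar>t\<bar> * \<bar>t\<bar>" by (intro mult_mono) auto
    then show False using that by (simp add: power2_eq_square)
  qed
  have "r\<^sup>2 \<le> 2" "s\<^sup>2 \<le> 2"
    using 2 zero_le_power2[of r] zero_le_power2[of s] zero_le_power2[of "r + s"] by linarith+
  then have "\<bar>r\<bar> \<le> 1" "\<bar>s\<bar> \<le> 1" by (auto intro!: small)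
  then have "r \<in> {-1, 0, 1}" "s \<in> {-1, 0, 1}" by auto
  then show "(r, s) \<in> {(1, 0), (- 1, 0), (0, 1), (0, - 1), (1, - 1), (- 1, 1)}" using 2 by auto
qed

text \<open>The values at (1, 0), (0, 1) and (1, 1) are l' + v', m' + v' and l' + m', and these
  three sums determine the triple.\<close>

lemma selling_transform:
  fixes l m v l' m' v' i j k h :: int
  assumes e: "\<And>x y. l' * x\<^sup>2 + m' * y\<^sup>2 + v' * (x - y)\<^sup>2 =
       l * (i * x + j * y)\<^sup>2 + m * (k * x + h * y)\<^sup>2 + v * (i * x + j * y - (k * x + h * y))\<^sup>2"
  shows "l' = l * (i * (i + j)) + m * (k * (k + h)) + v * ((i - k) * (i - k + (j - h)))"
    and "m' = l * (j * (i + j)) + m * (h * (k + h)) + v * ((j - h) * (i - k + (j - h)))"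
    and "v' = l * (- i * j) + m * (- k * h) + v * (- (i - k) * (j - h))"
proof -
  have 1: "l' + v' = l * i\<^sup>2 + m * k\<^sup>2 + v * (i - k)\<^sup>2" using e[of 1 0] by simp
  have 2: "m' + v' = l * j\<^sup>2 + m * h\<^sup>2 + v * (j - h)\<^sup>2" using e[of 0 1] by simp
  have 3: "l' + m' = l * (i + j)\<^sup>2 + m * (k + h)\<^sup>2 + v * (i + j - (k + h))\<^sup>2" using e[of 1 1] by simp
  have "2 * l' = (l' + v') + (l' + m') - (m' + v')" by simp
  also have "\<dots> = 2 * (l * (i * (i + j)) + m * (k * (k + h)) + v * ((i - k) * (i - k + (j - h))))"
    unfolding 1 2 3 by (simp add: power2_eq_square algebra_simps)
  finally show "l' = l * (i * (i + j)) + m * (k * (k + h)) + v * ((i - k) * (i - k + (j - h)))"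
    by simp
  have "2 * m' = (m' + v') + (l' + m') - (l' + v')" by simp
  also have "\<dots> = 2 * (l * (j * (i + j)) + m * (h * (k + h)) + v * ((j - h) * (i - k + (j - h))))"
    unfolding 1 2 3 by (simp add: power2_eq_square algebra_simps)
  finally show "m' = l * (j * (i + j)) + m * (h * (k + h)) + v * ((j - h) * (i - k + (j - h)))"
    by simp
  have "2 * v' = (l' + v') + (m' + v') - (l' + m')" by simp
  also have "\<dots> = 2 * (l * (- i * j) + m * (- k * h) + v * (- (i - k) * (j - h)))"
    unfolding 1 2 3 by (simp add: power2_eq_square algebra_simps)
  finally show "v' = l * (- i * j) + m * (- k * h) + v * (- (i - k) * (j - h))"
    by simp
qed

text \<open>2(l + m + v) is the sum of the values at (1, 0), (0, 1) and (1, 1). On these three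
  points the square of the linear form rx + sy adds up to r^2 + s^2 + (r + s)^2, the norm of the A2
  lattice; hence \<open>hexagonal_norm\<close> with its six minimal vectors.\<close>

lemma selling_transform_sum:
  fixes l m v l' m' v' i j k h :: int
  assumes e: "\<And>x y. l' * x\<^sup>2 + m' * y\<^sup>2 + v' * (x - y)\<^sup>2 =
       l * (i * x + j * y)\<^sup>2 + m * (k * x + h * y)\<^sup>2 + v * (i * x + j * y - (k * x + h * y))\<^sup>2"
  shows "2 * (l' + m' + v') - 2 * (l + m + v) =
    l * (i\<^sup>2 + j\<^sup>2 + (i + j)\<^sup>2 - 2) + m * (k\<^sup>2 + h\<^sup>2 + (k + h)\<^sup>2 - 2) +
    v * ((i - k)\<^sup>2 + (j - h)\<^sup>2 + (i - k + (j - h))\<^sup>2 - 2)"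
  unfolding selling_transform[of l' m' v' l i j m k h v, OF e] by (simp add: power2_eq_square algebra_simps)

lemma unimodular_rows:
  fixes i j k h :: int
  assumes "i * h - j * k = 1"
  shows "(i, j) \<noteq> (0, 0) \<and> (k, h) \<noteq> (0, 0) \<and> (i - k, j - h) \<noteq> (0, 0)"
  using assms by auto

lemma selling_equiv_sum_le:
  assumes T: "(l, m, v) \<in> selling_triples N" "(l', m', v') \<in> selling_triples N"
    and eq: "bqf_equiv (selling_form (l, m, v)) (selling_form (l', m', v'))"
  shows "l + m + v \<le> l' + m' + v'"
proof -
  have D: "0 \<le> l" "0 \<le> m" "0 \<le> v" "even (l - m)" "even (m - v)" "even (l' - m')" "even (m' - v')"
    using T by (auto simp: selling_triples_def)
  obtain i j k h :: int where d: "i * h - j * k = 1"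
    and e: "\<And>x y. l' * x\<^sup>2 + m' * y\<^sup>2 + v' * (x - y)\<^sup>2 =
     l * (i * x + j * y)\<^sup>2 + m * (k * x + h * y)\<^sup>2 + v * (i * x + j * y - (k * x + h * y))\<^sup>2"
    using eq unfolding selling_form_equiv_iff[OF D(4-7)] by blast
  have "0 \<le> 2 * (l' + m' + v') - 2 * (l + m + v)"
    unfolding selling_transform_sum[OF e]
    using unimodular_rows[OF d] hexagonal_norm(1) D by (intro add_nonneg_nonneg mult_nonneg_nonneg) simp_all
  then show ?thesis by simp
qed

text \<open>
  A base change never decreases \<open>l + m + v\<close>: in \<open>selling_transform_sum\<close> every row of the matrix has hexagonal norm at
  least 2. Between two Selling triples it therefore preserves this sum, and its rows are short.
\<close>

lemma selling_equiv_rows: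
  assumes T: "(l, m, v) \<in> selling_triples N" "(l', m', v') \<in> selling_triples N"
    and eq: "bqf_equiv (selling_form (l, m, v)) (selling_form (l', m', v'))"
  defines "R \<equiv> {(1, 0), (- 1, 0), (0, 1), (0, - 1), (1, - 1), (- 1, 1)}"
  obtains i j k h where "i * h - j * k = 1"
    "l' = l * (i * (i + j)) + m * (k * (k + h)) + v * ((i - k) * (i - k + (j - h)))"
    "m' = l * (j * (i + j)) + m * (h * (k + h)) + v * ((j - h) * (i - k + (j - h)))"
    "v' = l * (- i * j) + m * (- k * h) + v * (- (i - k) * (j - h))"
    "l \<noteq> 0 \<Longrightarrow> (i, j) \<in> R" "m \<noteq> 0 \<Longrightarrow> (k, h) \<in> R" "v \<noteq> 0 \<Longrightarrow> (i - k, j - h) \<in> R"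
proof -
  have D: "0 \<le> l" "0 \<le> m" "0 \<le> v" "even (l - m)" "even (m - v)" "even (l' - m')" "even (m' - v')"
    using T by (auto simp: selling_triples_def)
  obtain i j k h :: int where d: "i * h - j * k = 1"
    and e: "\<And>x y. l' * x\<^sup>2 + m' * y\<^sup>2 + v' * (x - y)\<^sup>2 =
     l * (i * x + j * y)\<^sup>2 + m * (k * x + h * y)\<^sup>2 + v * (i * x + j * y - (k * x + h * y))\<^sup>2"
    using eq unfolding selling_form_equiv_iff[OF D(4-7)] by blast
  have sum: "l + m + v = l' + m' + v'"
    using selling_equiv_sum_le[OF T eq] selling_equiv_sum_le[OF T(2) T(1) bqf_equiv_sym[OF eq]] by linarith
  have nn: "0 \<le> l * (i\<^sup>2 + j\<^sup>2 + (i + j)\<^sup>2 - 2)" "0 \<le> m * (k\<^sup>2 + h\<^sup>2 + (k + h)\<^sup>2 - 2)"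
    "0 \<le> v * ((i - k)\<^sup>2 + (j - h)\<^sup>2 + (i - k + (j - h))\<^sup>2 - 2)"
    using unimodular_rows[OF d] hexagonal_norm(1) D by (simp_all add: mult_nonneg_nonneg)
  have "l * (i\<^sup>2 + j\<^sup>2 + (i + j)\<^sup>2 - 2) + m * (k\<^sup>2 + h\<^sup>2 + (k + h)\<^sup>2 - 2) +
    v * ((i - k)\<^sup>2 + (j - h)\<^sup>2 + (i - k + (j - h))\<^sup>2 - 2) = 0"
    unfolding selling_transform_sum[OF e, symmetric] using sum by simp
  with nn have z: "l * (i\<^sup>2 + j\<^sup>2 + (i + j)\<^sup>2 - 2) = 0" "m * (k\<^sup>2 + h\<^sup>2 + (k + h)\<^sup>2 - 2) = 0"
    "v * ((i - k)\<^sup>2 + (j - h)\<^sup>2 + (i - k + (j - h))\<^sup>2 - 2) = 0"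
    by (metis add_nonneg_eq_0_iff add_nonneg_nonneg)+
  show ?thesis
  proof (rule that[OF d selling_transform[OF e]])
    show "l \<noteq> 0 \<Longrightarrow> (i, j) \<in> R" using z(1) unimodular_rows[OF d] hexagonal_norm(2)[of i j] by (simp add: R_def)
    show "m \<noteq> 0 \<Longrightarrow> (k, h) \<in> R" using z(2) unimodular_rows[OF d] hexagonal_norm(2)[of k h] by (simp add: R_def)
    show "v \<noteq> 0 \<Longrightarrow> (i - k, j - h) \<in> R"
      using z(3) unimodular_rows[OF d] hexagonal_norm(2)[of "i - k" "j - h"] by (simp add: R_def)
  qed
qed

text \<open>All three rows are minimal vectors and the third is the difference of the first two.
  Determinant 1 leaves the three rotations, each up to a common sign.\<close>

lemma selling_equiv_positive:
  assumes "(l, m, v) \<in> selling_triples N" "(l', m', v') \<in> selling_triples N"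
    and "bqf_equiv (selling_form (l, m, v)) (selling_form (l', m', v'))"
    and "l \<noteq> 0" "m \<noteq> 0" "v \<noteq> 0"
  shows "(l', m', v') \<in> {(l, m, v), (m, v, l), (v, l, m)}"
proof (rule selling_equiv_rows[OF assms(1-3)])
  fix i j k h :: int
  assume d: "i * h - j * k = 1"
    and e: "l' = l * (i * (i + j)) + m * (k * (k + h)) + v * ((i - k) * (i - k + (j - h)))"
    "m' = l * (j * (i + j)) + m * (h * (k + h)) + v * ((j - h) * (i - k + (j - h)))"
    "v' = l * (- i * j) + m * (- k * h) + v * (- (i - k) * (j - h))"
    and r: "l \<noteq> 0 \<Longrightarrow> (i, j) \<in> {(1, 0), (- 1, 0), (0, 1), (0, - 1), (1, - 1), (- 1, 1)}"
     "m \<noteq> 0 \<Longrightarrow> (k, h) \<in> {(1, 0), (- 1, 0), (0, 1), (0, - 1), (1, - 1), (- 1, 1)}"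
     "v \<noteq> 0 \<Longrightarrow> (i - k, j - h) \<in> {(1, 0), (- 1, 0), (0, 1), (0, - 1), (1, - 1), (- 1, 1)}"
  have r3: "(i - k)\<^sup>2 + (j - h)\<^sup>2 + (i - k + (j - h))\<^sup>2 = 2"
    using r(3)[OF assms(6)] unfolding insert_iff empty_iff prod.inject by (elim disjE conjE FalseE; simp only:; simp)
  have "i = 1 \<and> j = 0 \<or> i = - 1 \<and> j = 0 \<or> i = 0 \<and> j = 1 \<or> i = 0 \<and> j = - 1 \<or>
      i = 1 \<and> j = - 1 \<or> i = - 1 \<and> j = 1"
    "k = 1 \<and> h = 0 \<or> k = - 1 \<and> h = 0 \<or> k = 0 \<and> h = 1 \<or> k = 0 \<and> h = - 1 \<or>
      k = 1 \<and> h = - 1 \<or> k = - 1 \<and> h = 1"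
    using r(1)[OF assms(4)] r(2)[OF assms(5)] by simp_all
  then show ?thesis
    using d r3 unfolding e by (elim disjE conjE; hypsubst; simp)
qed

text \<open>For v = 0 the third row is unconstrained: x -> -x, of determinant -1, is an automorphism
  of the form, so odd permutations of the triple are also properly equivalent.\<close>

lemma selling_equiv_rectangular:
  assumes "(l, m, 0) \<in> selling_triples N" "(l', m', v') \<in> selling_triples N"
    and "bqf_equiv (selling_form (l, m, 0)) (selling_form (l', m', v'))"
    and "l \<noteq> 0" "m \<noteq> 0"
  shows "(l', m', v') \<in> {(l, m, 0), (m, 0, l), (0, l, m), (m, l, 0), (l, 0, m), (0, m, l)}"
proof (rule selling_equiv_rows[OF assms(1-3)])
  fix i j k h :: int
  assume d: "i * h - j * k = 1"
    and e: "l' = l * (i * (i + j)) + m * (k * (k + h)) + 0 * ((i - k) * (i - k + (j - h)))"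
    "m' = l * (j * (i + j)) + m * (h * (k + h)) + 0 * ((j - h) * (i - k + (j - h)))"
    "v' = l * (- i * j) + m * (- k * h) + 0 * (- (i - k) * (j - h))"
    and r: "l \<noteq> 0 \<Longrightarrow> (i, j) \<in> {(1, 0), (- 1, 0), (0, 1), (0, - 1), (1, - 1), (- 1, 1)}"
     "m \<noteq> 0 \<Longrightarrow> (k, h) \<in> {(1, 0), (- 1, 0), (0, 1), (0, - 1), (1, - 1), (- 1, 1)}"
    "(0 :: int) \<noteq> 0 \<Longrightarrow> (i - k, j - h) \<in> {(1, 0), (- 1, 0), (0, 1), (0, - 1), (1, - 1), (- 1, 1)}"
  have "i = 1 \<and> j = 0 \<or> i = - 1 \<and> j = 0 \<or> i = 0 \<and> j = 1 \<or> i = 0 \<and> j = - 1 \<or>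
      i = 1 \<and> j = - 1 \<or> i = - 1 \<and> j = 1"
    "k = 1 \<and> h = 0 \<or> k = - 1 \<and> h = 0 \<or> k = 0 \<and> h = 1 \<or> k = 0 \<and> h = - 1 \<or>
      k = 1 \<and> h = - 1 \<or> k = - 1 \<and> h = 1"
    using r(1)[OF assms(4)] r(2)[OF assms(5)] by simp_all
  then show ?thesis
    using d unfolding e by (elim disjE conjE; hypsubst; simp)
qed

lemma selling_rotate:
  assumes "(l, m, v) \<in> selling_triples N"
  shows "(m, v, l) \<in> selling_triples N"
    and "bqf_equiv (selling_form (l, m, v)) (selling_form (m, v, l))"
proof -
  have D: "even (l - m)" "even (m - v)" using assms by (auto simp: selling_triples_def)
  show "(m, v, l) \<in> selling_triples N" using assms by (auto simp: selling_triples_def algebra_simps)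
  have "even (v - l)" using D by auto
  show "bqf_equiv (selling_form (l, m, v)) (selling_form (m, v, l))"
    unfolding selling_form_equiv_iff[OF D D(2) \<open>even (v - l)\<close>]
    by (intro exI[of _ 1] exI[of _ "- 1"] exI[of _ 1] exI[of _ 0]) (auto simp: power2_eq_square algebra_simps)
qed

lemma selling_swap:
  assumes "(l, m, 0) \<in> selling_triples N"
  shows "(m, l, 0) \<in> selling_triples N"
    and "bqf_equiv (selling_form (l, m, 0)) (selling_form (m, l, 0))"
proof -
  have D: "even (l - m)" "even (m - 0)" "even (m - l)" "even (l - 0)" using assms by (auto simp: selling_triples_def)
  show "(m, l, 0) \<in> selling_triples N" using assms by (auto simp: selling_triples_def algebra_simps)
  show "bqf_equiv (selling_form (l, m, 0)) (selling_form (m, l, 0))"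
    unfolding selling_form_equiv_iff[OF D]
    by (intro exI[of _ 0] exI[of _ "- 1"] exI[of _ 1] exI[of _ 0]) (auto simp: power2_eq_square algebra_simps)
qed

text \<open>Descent on a + c: if \<bar>b\<bar> exceeds \<open>a\<close> or \<open>c\<close>, a shear
  replaces the other outer coefficient by a + c - \<bar>b\<bar>. Otherwise a form with b \<le> 0
  already belongs to a triple with nonnegative entries, and for b > 0 one final shear makes the
  middle coefficient negative.\<close>

lemma bqf_reduction:
  assumes N: "0 < N"
  shows "(a, b, c) \<in> pos_def_forms N \<Longrightarrow> \<exists>T \<in> selling_triples N. bqf_equiv (a, b, c) (selling_form T)"
proof (induction "nat (a + c)" arbitrary: a b c rule: less_induct)
  case less
  have D: "0 < a" "b\<^sup>2 - 4 * a * c = - N" using less.prems N by (simp_all add: pos_def_forms_iff)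
  have "0 < 4 * (a * c)" using D N zero_le_power2[of b] by linarith
  then have c: "0 < c" using D by (simp add: zero_less_mult_iff)
  have step: "\<exists>T \<in> selling_triples N. bqf_equiv (a, b, c) (selling_form T)"
    if "bqf_equiv (a, b, c) (a', b', c')" "a' + c' < a + c" for a' b' c'
  proof -
    have P: "(a', b', c') \<in> pos_def_forms N" using pos_def_forms_equiv[OF N less.prems that(1)] .
    have "nat (a' + c') < nat (a + c)" using that D c by simp
    then show ?thesis using less.hyps[OF _ P] that(1) bqf_equiv_trans by blast
  qed
  define s where "s = (if b \<le> 0 then 1 else - 1 :: int)"
  have s: "s * s = 1" "s * b = - \<bar>b\<bar>" by (auto simp: s_def)
  consider "a < \<bar>b\<bar>" | "c < \<bar>b\<bar>" | "\<bar>b\<bar> \<le> a" "\<bar>b\<bar> \<le> c" by linarith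
  then show ?case
  proof cases
    case 1
    have "bqf_equiv (a, b, c) (a, b + 2 * a * s, a + b * s + c)"
      by (rule bqf_equivI[where i = 1 and j = s and k = 0 and h = 1])
         (use s(1) in \<open>auto simp: power2_eq_square algebra_simps\<close>)
    then show ?thesis using 1 s by (intro step) (auto simp: mult.commute)
  next
    case 2
    have "bqf_equiv (a, b, c) (a + b * s + c, b + 2 * c * s, c)"
      by (rule bqf_equivI[where i = 1 and j = 0 and k = s and h = 1])
         (use s(1) in \<open>auto simp: power2_eq_square algebra_simps\<close>)
    then show ?thesis using 2 s by (intro step) (auto simp: mult.commute)
  next
    case 3
    show ?thesis
    proof (cases "b \<le> 0")
      case True
      have "(2 * a + b, 2 * c + b, - b) \<in> selling_triples N"
        using 3 True D by (auto simp: selling_triples_def power2_eq_square algebra_simps)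
      moreover have "selling_form (2 * a + b, 2 * c + b, - b) = (a, b, c)" by simp
      ultimately show ?thesis using bqf_equiv_refl by metis
    next
      case False
      have "(b, 2 * c - b, 2 * a - b) \<in> selling_triples N"
        using 3 False D by (auto simp: selling_triples_def power2_eq_square algebra_simps)
      moreover have "(2 * c - b + (2 * a - b)) div 2 = a - b + c" by simp
      then have "selling_form (b, 2 * c - b, 2 * a - b) = (a, b - 2 * a, a - b + c)" by simp
      moreover have "bqf_equiv (a, b, c) (a, b - 2 * a, a - b + c)"
        by (rule bqf_equivI[where i = 1 and j = "- 1" and k = 0 and h = 1])
           (auto simp: power2_eq_square algebra_simps)
      ultimately show ?thesis by metis
    qed
  qed
qed

text \<open>a(x^2 + y^2) is itself a Selling form, whereas a(x^2 + xy + y^2) first needs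
  \<open>hexagonal_forms_equiv\<close>, because Selling forms have middle coefficient -v \<le>
  0.\<close>

lemma selling_square:
  assumes "0 < N" "T \<in> selling_triples N" "bqf_equiv (selling_form T) (a, 0, a)"
  shows "0 < a" "(2 * a, 2 * a, 0) \<in> selling_triples N"
    "bqf_equiv (selling_form T) (selling_form (2 * a, 2 * a, 0))"
proof -
  have "(a, 0, a) \<in> pos_def_forms N"
    using pos_def_forms_equiv[OF assms(1) selling_form_in[OF assms(1,2)] assms(3)] .
  then show "0 < a" "(2 * a, 2 * a, 0) \<in> selling_triples N"
    using assms(1) by (auto simp: pos_def_forms_iff selling_triples_def)
  show "bqf_equiv (selling_form T) (selling_form (2 * a, 2 * a, 0))" using assms(3) by simp
qed

lemma hexagonal_forms_equiv: "bqf_equiv (a, - a, a) (a, a, a)"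
  by (rule bqf_equivI[where i = 1 and j = 1 and k = 0 and h = 1])
     (auto simp: power2_eq_square algebra_simps)

lemma selling_hexagonal:
  assumes "0 < N" "T \<in> selling_triples N" "bqf_equiv (selling_form T) (a, a, a)"
  shows "0 < a" "(a, a, a) \<in> selling_triples N"
    "bqf_equiv (selling_form T) (selling_form (a, a, a))"
proof -
  have "(a, a, a) \<in> pos_def_forms N"
    using pos_def_forms_equiv[OF assms(1) selling_form_in[OF assms(1,2)] assms(3)] .
  then show "0 < a" "(a, a, a) \<in> selling_triples N"
    using assms(1) by (auto simp: pos_def_forms_iff selling_triples_def power2_eq_square)
  show "bqf_equiv (selling_form T) (selling_form (a, a, a))"
    using bqf_equiv_trans[OF assms(3) bqf_equiv_sym[OF hexagonal_forms_equiv]] by simp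
qed

section \<open>Weighted size of an equivalence class\<close>

definition selling_class :: "int \<Rightarrow> int \<times> int \<times> int \<Rightarrow> (int \<times> int \<times> int) set" where
  "selling_class N T = {T' \<in> selling_triples N. bqf_equiv (selling_form T) (selling_form T')}"

definition selling_weight :: "int \<times> int \<times> int \<Rightarrow> real" where
  "selling_weight T = (case T of (l, m, v) \<Rightarrow> half_weight l * half_weight m * half_weight v)"

lemma selling_class_cong:
  assumes "bqf_equiv (selling_form T) (selling_form T')"
  shows "selling_class N T = selling_class N T'"
  using assms bqf_equiv_sym bqf_equiv_trans unfolding selling_class_def by blast

text \<open>Three rotations of weight 1. They collapse to a single triple exactly for l = m = v, the
  hexagonal class with \<omega> = 3.\<close>

lemma selling_class_sum_positive:
  assumes N: "0 < N" and T: "(l, m, v) \<in> selling_triples N" and pos: "0 < l" "0 < m" "0 < v"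
  shows "sum selling_weight (selling_class N (l, m, v)) = 3 / real (bqf_weight (selling_form (l, m, v)))"
proof -
  note nz = pos[THEN less_imp_neq, THEN not_sym]
  have cls: "selling_class N (l, m, v) = {(l, m, v), (m, v, l), (v, l, m)}"
  proof (intro equalityI subsetI)
    fix T' assume "T' \<in> selling_class N (l, m, v)"
    then show "T' \<in> {(l, m, v), (m, v, l), (v, l, m)}"
      using selling_equiv_positive[OF T _ _ nz] unfolding selling_class_def
      by (cases T') blast
  next
    note r1 = selling_rotate[OF T] and r2 = selling_rotate[OF selling_rotate(1)[OF T]]
    fix T' assume "T' \<in> {(l, m, v), (m, v, l), (v, l, m)}"
    then show "T' \<in> selling_class N (l, m, v)"
      using T r1 r2 bqf_equiv_trans[OF r1(2) r2(2)] bqf_equiv_refl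
      unfolding selling_class_def by blast
  qed
  have no_square: "\<not> (\<exists>a. bqf_equiv (selling_form (l, m, v)) (a, 0, a))"
  proof
    assume "\<exists>a. bqf_equiv (selling_form (l, m, v)) (a, 0, a)"
    then obtain a where "bqf_equiv (selling_form (l, m, v)) (a, 0, a)" by blast
    note a = selling_square[OF N T this]
    have "(2 * a, 2 * a, 0) \<in> {(l, m, v), (m, v, l), (v, l, m)}"
      using selling_equiv_positive[OF T a(2,3) nz] .
    then show False using pos by auto
  qed
  have hex: "(\<exists>a. bqf_equiv (selling_form (l, m, v)) (a, a, a)) \<longleftrightarrow> l = m \<and> m = v"
  proof
    assume "\<exists>a. bqf_equiv (selling_form (l, m, v)) (a, a, a)"
    then obtain a where "bqf_equiv (selling_form (l, m, v)) (a, a, a)" by blast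
    note a = selling_hexagonal[OF N T this]
    have "(a, a, a) \<in> {(l, m, v), (m, v, l), (v, l, m)}"
      using selling_equiv_positive[OF T a(2,3) nz] .
    then show "l = m \<and> m = v" by auto
  next
    assume "l = m \<and> m = v"
    then have "selling_form (l, m, v) = (l, - l, l)" by simp
    then show "\<exists>a. bqf_equiv (selling_form (l, m, v)) (a, a, a)" using hexagonal_forms_equiv by metis
  qed
  have w: "bqf_weight (selling_form (l, m, v)) = (if l = m \<and> m = v then 3 else 1)"
    unfolding bqf_weight_def using no_square hex by simp
  show ?thesis
    unfolding cls w using pos by (cases "l = m"; cases "m = v") (auto simp: selling_weight_def half_weight_def)
qed

text \<open>Six permutations of weight 1/2, hence total 3. For l = m, where \<omega> = 2, only three
  of them are distinct.\<close>

lemma selling_class_sum_rectangular: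
  assumes N: "0 < N" and T: "(l, m, 0) \<in> selling_triples N" and pos: "0 < l" "0 < m"
  shows "sum selling_weight (selling_class N (l, m, 0)) = 3 / real (bqf_weight (selling_form (l, m, 0)))"
proof -
  note nz = pos[THEN less_imp_neq, THEN not_sym]
  have rot: "{(l, m, 0), (m, 0, l), (0, l, m)} \<subseteq> selling_class N (l, m, 0)"
    if T: "(l, m, 0) \<in> selling_triples N" for l m
  proof -
    note r1 = selling_rotate[OF T] and r2 = selling_rotate[OF selling_rotate(1)[OF T]]
    show ?thesis
      using T r1 r2 bqf_equiv_trans[OF r1(2) r2(2)] bqf_equiv_refl
      unfolding selling_class_def by blast
  qed
  have cls: "selling_class N (l, m, 0) = {(l, m, 0), (m, 0, l), (0, l, m), (m, l, 0), (l, 0, m), (0, m, l)}"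
  proof (intro equalityI subsetI)
    fix T' assume "T' \<in> selling_class N (l, m, 0)"
    then show "T' \<in> {(l, m, 0), (m, 0, l), (0, l, m), (m, l, 0), (l, 0, m), (0, m, l)}"
      using selling_equiv_rectangular[OF T _ _ nz] unfolding selling_class_def
      by (cases T') blast
  next
    fix T' assume "T' \<in> {(l, m, 0), (m, 0, l), (0, l, m), (m, l, 0), (l, 0, m), (0, m, l)}"
    then show "T' \<in> selling_class N (l, m, 0)"
      using rot[OF T] rot[OF selling_swap(1)[OF T]] selling_class_cong[OF selling_swap(2)[OF T]] by blast
  qed
  have square: "(\<exists>a. bqf_equiv (selling_form (l, m, 0)) (a, 0, a)) \<longleftrightarrow> l = m"
  proof
    assume "\<exists>a. bqf_equiv (selling_form (l, m, 0)) (a, 0, a)"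
    then obtain a where "bqf_equiv (selling_form (l, m, 0)) (a, 0, a)" by blast
    note a = selling_square[OF N T this]
    have "(2 * a, 2 * a, 0) \<in> {(l, m, 0), (m, 0, l), (0, l, m), (m, l, 0), (l, 0, m), (0, m, l)}"
      using selling_equiv_rectangular[OF T a(2,3) nz] .
    then show "l = m" using pos a(1) by auto
  next
    assume "l = m"
    then have "selling_form (l, m, 0) = (l div 2, 0, l div 2)" by simp
    then show "\<exists>a. bqf_equiv (selling_form (l, m, 0)) (a, 0, a)" using bqf_equiv_refl by metis
  qed
  have no_hex: "\<not> (\<exists>a. bqf_equiv (selling_form (l, m, 0)) (a, a, a))"
  proof
    assume "\<exists>a. bqf_equiv (selling_form (l, m, 0)) (a, a, a)"
    then obtain a where "bqf_equiv (selling_form (l, m, 0)) (a, a, a)" by blast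
    note a = selling_hexagonal[OF N T this]
    have "(a, a, a) \<in> {(l, m, 0), (m, 0, l), (0, l, m), (m, l, 0), (l, 0, m), (0, m, l)}"
      using selling_equiv_rectangular[OF T a(2,3) nz] .
    then show False using pos by auto
  qed
  have w: "bqf_weight (selling_form (l, m, 0)) = (if l = m then 2 else 1)"
    unfolding bqf_weight_def using square no_hex by simp
  show ?thesis
  proof (cases "l = m")
    case True
    then have "selling_class N (l, m, 0) = {(m, m, 0), (m, 0, m), (0, m, m)}" unfolding cls by auto
    then show ?thesis unfolding w using pos True by (simp add: selling_weight_def half_weight_def)
  next
    case False
    then show ?thesis unfolding cls w using pos by (auto simp: selling_weight_def half_weight_def)
  qed
qed

lemma selling_class_sum:
  assumes N: "0 < N" and T: "T \<in> selling_triples N"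
  shows "sum selling_weight (selling_class N T) = 3 / real (bqf_weight (selling_form T))"
proof -
  have rot: "sum selling_weight (selling_class N (l, m, v)) = 3 / real (bqf_weight (selling_form (l, m, v)))"
    if "(l, m, v) \<in> selling_triples N"
      "sum selling_weight (selling_class N (m, v, l)) = 3 / real (bqf_weight (selling_form (m, v, l)))" for l m v
    using that selling_class_cong[OF selling_rotate(2)[OF that(1)]] bqf_weight_cong[OF selling_rotate(2)[OF that(1)]]
    by simp
  obtain l m v where q: "T = (l, m, v)" by (cases T)
  note T1 = T[unfolded q] and T2 = selling_rotate(1)[OF T[unfolded q]]
  note T3 = selling_rotate(1)[OF T2]
  have D: "0 \<le> l" "0 \<le> m" "0 \<le> v" "l * m + m * v + v * l = N"
    using T by (auto simp: q selling_triples_def)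
  have "\<not> (l = 0 \<and> m = 0)" "\<not> (m = 0 \<and> v = 0)" "\<not> (l = 0 \<and> v = 0)" using D N by auto
  moreover have "l = 0 \<or> 0 < l" "m = 0 \<or> 0 < m" "v = 0 \<or> 0 < v" using D(1-3) by auto
  ultimately consider "0 < l" "0 < m" "0 < v" | "v = 0" "0 < l" "0 < m" | "l = 0" "0 < m" "0 < v" | "m = 0" "0 < v" "0 < l"
    by blast
  then show ?thesis
  proof cases
    case 1
    then show ?thesis unfolding q by (intro selling_class_sum_positive[OF N T1])
  next
    case 2
    show ?thesis unfolding q 2(1) by (rule selling_class_sum_rectangular[OF N T1[unfolded 2(1)] 2(2,3)])
  next
    case 3
    show ?thesis unfolding q
      using selling_class_sum_rectangular[OF N T2[unfolded 3(1)] 3(2,3)] 3(1) by (intro rot[OF T1]) simp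
  next
    case 4
    show ?thesis unfolding q
      using selling_class_sum_rectangular[OF N T3[unfolded 4(1)] 4(2,3)] 4(1)
      by (intro rot[OF T1] rot[OF T2]) simp
  qed
qed

lemma selling_triples_mod4:
  assumes "(l, m, v) \<in> selling_triples N"
  shows "N mod 4 = 0 \<or> N mod 4 = 3"
proof -
  have D: "even (l - m)" "even (m - v)" "l * m + m * v + v * l = N" using assms by (auto simp: selling_triples_def)
  have "even (v - m)" "even (v - l)" using D by auto
  obtain i where i: "l = v + 2 * i" using \<open>even (v - l)\<close> by (rule evenE_diff)
  obtain j where j: "m = v + 2 * j" using \<open>even (v - m)\<close> by (rule evenE_diff)
  have N: "N = 3 * (v * v) + 4 * (v * i + v * j + i * j)"
    unfolding D(3)[symmetric] i j by (simp add: algebra_simps)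
  show ?thesis
  proof (cases "even v")
    case True
    then obtain w where "v = 2 * w" ..
    then have "N = 4 * (3 * (w * w) + (v * i + v * j + i * j))" unfolding N by (simp add: algebra_simps)
    then show ?thesis by simp
  next
    case False
    then obtain w where "v = 2 * w + 1" ..
    then have "N = 3 + 4 * (3 * (w * w) + 3 * w + (v * i + v * j + i * j))" unfolding N by (simp add: algebra_simps)
    then obtain K where "N = 3 + 4 * K" by blast
    then show ?thesis by simp
  qed
qed

theorem sum_selling_weight:
  assumes N: "0 < N"
  shows "sum selling_weight (selling_triples N) = 3 * hurwitz_class_number N"
proof (cases "N mod 4 = 1 \<or> N mod 4 = 2")
  case True
  then have "selling_triples N = {}" using selling_triples_mod4 by fastforce
  then show ?thesis using True N by (auto simp: hurwitz_class_number_def)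
next
  case False
  let ?E = "bqf_equiv_rel N" and ?P = "pos_def_forms N"
  define g where "g T = ?E `` {selling_form T}" for T
  have rel: "(Q, R) \<in> ?E \<longleftrightarrow> Q \<in> ?P \<and> R \<in> ?P \<and> bqf_equiv Q R" for Q R
    by (simp add: bqf_equiv_rel_def)
  have quot: "?P // ?E = g ` selling_triples N"
  proof (intro equalityI subsetI)
    fix C assume "C \<in> ?P // ?E"
    then obtain Q where Q: "Q \<in> ?P" "C = ?E `` {Q}" by (rule quotientE)
    obtain T where T: "T \<in> selling_triples N" "bqf_equiv Q (selling_form T)"
      using bqf_reduction[OF N] Q(1) by (cases Q) blast
    have "(Q, selling_form T) \<in> ?E" using T Q selling_form_in[OF N T(1)] by (simp add: rel)
    then have "C = g T" unfolding g_def Q(2) by (rule equiv_class_eq[OF equiv_bqf_equiv_rel])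
    then show "C \<in> g ` selling_triples N" using T by blast
  next
    fix C assume "C \<in> g ` selling_triples N"
    then show "C \<in> ?P // ?E" using selling_form_in[OF N] by (auto simp: g_def intro: quotientI)
  qed
  have fin: "finite (selling_triples N)" using N by (rule finite_selling_triples)
  \<comment> \<open>Grouped by the class of its form, each fibre is a \<open>selling_class\<close>
    and contributes 3 / \<omega>.\<close>
  have "sum selling_weight (selling_triples N) = (\<Sum>C \<in> ?P // ?E. sum selling_weight {T \<in> selling_triples N. g T = C})"
    using fin by (intro sum.group[symmetric]) (auto simp: quot)
  also have "\<dots> = (\<Sum>C \<in> ?P // ?E. 3 * (1 / real (bqf_weight (SOME Q. Q \<in> C))))"
  proof (rule sum.cong)
    fix C assume "C \<in> ?P // ?E"
    then obtain T where T: "T \<in> selling_triples N" "C = g T" unfolding quot by blast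
    have TP: "selling_form T \<in> ?P" using selling_form_in[OF N T(1)] .
    have "{T' \<in> selling_triples N. g T' = C} = selling_class N T"
    proof -
      have "g T' = g T \<longleftrightarrow> bqf_equiv (selling_form T) (selling_form T')" if "T' \<in> selling_triples N" for T'
      proof -
        have "g T = g T' \<longleftrightarrow> (selling_form T, selling_form T') \<in> ?E"
          unfolding g_def using TP selling_form_in[OF N that] by (rule eq_equiv_class_iff[OF equiv_bqf_equiv_rel])
        then show ?thesis using TP selling_form_in[OF N that] unfolding rel by metis
      qed
      then show ?thesis unfolding T(2) selling_class_def by blast
    qed
    moreover have "(SOME Q. Q \<in> C) \<in> C"
      by (rule someI[of _ "selling_form T"]) (use TP in \<open>simp add: T(2) g_def rel bqf_equiv_refl\<close>)
    then have "(selling_form T, SOME Q. Q \<in> C) \<in> ?E"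
      unfolding T(2) g_def by (simp only: Image_singleton_iff)
    then have "bqf_weight (SOME Q. Q \<in> C) = bqf_weight (selling_form T)"
      using bqf_weight_cong unfolding rel by metis
    ultimately show "sum selling_weight {T \<in> selling_triples N. g T = C} = 3 * (1 / real (bqf_weight (SOME Q. Q \<in> C)))"
      using selling_class_sum[OF N T(1)] by simp
  qed simp
  also have "\<dots> = 3 * hurwitz_class_number N"
    using False N by (simp add: hurwitz_class_number_def sum_distrib_left)
  finally show ?thesis .
qed

section \<open>Liouville's identity\<close>

lemma quads_swap_left:
  "(\<Sum>(x, z, a, e) \<in> quads n. K z x a e) = (\<Sum>(x, z, a, e) \<in> quads n. K x z a e)"
  by (rule sum_reindex_involution[where h = "\<lambda>(x, z, a, e). (z, x, a, e)"]) (auto simp: quads_def algebra_simps)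

lemma quads_swap_right:
  "(\<Sum>(x, z, a, e) \<in> quads n. K x z e a) = (\<Sum>(x, z, a, e) \<in> quads n. K x z a e)"
  by (rule sum_reindex_involution[where h = "\<lambda>(x, z, a, e). (x, z, e, a)"]) (auto simp: quads_def algebra_simps)

lemma quads_swap_pairs:
  "(\<Sum>(x, z, a, e) \<in> quads n. K a e x z) = (\<Sum>(x, z, a, e) \<in> quads n. K x z a e)"
  by (rule sum_reindex_involution[where h = "\<lambda>(x, z, a, e). (a, e, x, z)"]) (auto simp: quads_def algebra_simps)

lemma quads_swap_outer_filter:
  assumes "\<And>x z a e. P x z a e \<longleftrightarrow> P' e a z x"
  shows "(\<Sum>(x, z, a, e) \<in> {(x, z, a, e) \<in> quads n. P' x z a e}. K e a z x) =
         (\<Sum>(x, z, a, e) \<in> {(x, z, a, e) \<in> quads n. P x z a e}. K x z a e)"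
  by (rule sum_reindex_involution[where h = "\<lambda>(x, z, a, e). (e, a, z, x)"]) (auto simp: quads_def assms algebra_simps)

lemma quads_shift_difference:
  "(\<Sum>(x, z, a, e) \<in> {(x, z, a, e) \<in> quads n. e < x}. K (x - e) z (a + z) e) =
   (\<Sum>(x, z, a, e) \<in> {(x, z, a, e) \<in> quads n. z < a}. K x z a e)"
  by (rule sum.reindex_bij_witness[where i = "\<lambda>(x, z, a, e). (x + e, z, a - z, e)"
        and j = "\<lambda>(x, z, a, e). (x - e, z, a + z, e)"]) (auto simp: quads_def algebra_simps)

lemma quads_shift_sum:
  "(\<Sum>(x, z, a, e) \<in> {(x, z, a, e) \<in> quads n. a < z}. K (x + e) a (z - a) x) =
   (\<Sum>(x, z, a, e) \<in> {(x, z, a, e) \<in> quads n. e < x}. K x z a e)"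
  by (rule sum.reindex_bij_witness[where i = "\<lambda>(x, z, a, e). (e, a + z, z, x - e)"
        and j = "\<lambda>(x, z, a, e). (x + e, a, z - a, x)"]) (auto simp: quads_def algebra_simps)

lemma quads_shift_fixed:
  "(\<Sum>(x, z, a, e) \<in> {(x, z, a, e) \<in> quads n. a < z}. K x (z - a) a (e + x)) =
   (\<Sum>(x, z, a, e) \<in> {(x, z, a, e) \<in> quads n. x < e}. K x z a e)"
  by (rule sum.reindex_bij_witness[where i = "\<lambda>(x, z, a, e). (x, z + a, a, e - x)"
        and j = "\<lambda>(x, z, a, e). (x, z - a, a, e + x)"]) (auto simp: quads_def algebra_simps)

text \<open>By xz + ae = (x - e)z + (a + z)e the terms F(x - e) with e < x become terms F(x) with z
  < a. By xz + ae = (x + e)a + (z - a)x the terms F(x + e) with a < z become terms F(x) with e < x.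
  The outer swap accounts for the opposite halves. A third shift, keeping x, identifies a < z with x
  < e; comparing the two decompositions of the same sum of F(x), by x against e and by z against a,
  then leaves only diagonals. \<open>w'\<close> is the weight transported by these maps, and the
  hypotheses say that it arrives the same on each way.\<close>

lemma liouville_identity:
  fixes F :: "int \<Rightarrow> real" and w :: "int \<Rightarrow> int \<Rightarrow> int \<Rightarrow> int \<Rightarrow> real"
  assumes even: "\<And>u. F (- u) = F u"
    and swap: "\<And>x z a e. w e a z x = w x z a e"
    and shift: "\<And>x z a e. (x, z, a, e) \<in> quads n \<Longrightarrow> w (x + e) z (a - z) e = w e (a + z) z (x - e)"
    and sign: "\<And>x z a e. w e (a + z) (- z) (e - x) = w e (a + z) z (x - e)"
  defines "w' x z a e \<equiv> w e (a + z) z (x - e)"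
  shows "(\<Sum>(x, z, a, e) \<in> quads n. w x z a e * (F (x - e) - F (x + e))) =
    F 0 * (\<Sum>(x, z, a, e) \<in> {(x, z, a, e) \<in> quads n. x = e}. w x z a e) -
    (\<Sum>(x, z, a, e) \<in> {(x, z, a, e) \<in> quads n. z = a}. w x z a e * F (x + e)) +
    2 * (\<Sum>(x, z, a, e) \<in> {(x, z, a, e) \<in> quads n. x = e}. w' x z a e * F x) -
    2 * (\<Sum>(x, z, a, e) \<in> {(x, z, a, e) \<in> quads n. z = a}. w' x z a e * F x)"
proof -
  define S where "S P K = (\<Sum>(x, z, a, e) \<in> {(x, z, a, e) \<in> quads n. P x z a e}. K x z a e)"
    for P :: "int \<Rightarrow> int \<Rightarrow> int \<Rightarrow> int \<Rightarrow> bool" and K :: "int \<Rightarrow> int \<Rightarrow> int \<Rightarrow> int \<Rightarrow> real"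
  define T where "T K = (\<Sum>(x, z, a, e) \<in> quads n. K x z a e)"
    for K :: "int \<Rightarrow> int \<Rightarrow> int \<Rightarrow> int \<Rightarrow> real"
  define K where "K x z a e = w' x z a e * F x" for x z a e
  have xe: "T K = S (\<lambda>x z a e. e < x) K + S (\<lambda>x z a e. x < e) K + S (\<lambda>x z a e. x = e) K" for K
    unfolding T_def S_def sum_filter4[OF finite_quads] sum.distrib[symmetric]
    by (rule sum.cong) auto
  have za: "T K = S (\<lambda>x z a e. a < z) K + S (\<lambda>x z a e. z < a) K + S (\<lambda>x z a e. z = a) K" for K
    unfolding T_def S_def sum_filter4[OF finite_quads] sum.distrib[symmetric]
    by (rule sum.cong) auto
  have minus: "T (\<lambda>x z a e. w x z a e * F (x - e)) =
      2 * S (\<lambda>x z a e. z < a) K + S (\<lambda>x z a e. x = e) (\<lambda>x z a e. w x z a e * F 0)"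
  proof -
    have "S (\<lambda>x z a e. x < e) (\<lambda>x z a e. w x z a e * F (x - e)) =
          S (\<lambda>x z a e. e < x) (\<lambda>x z a e. w x z a e * F (x - e))"
      unfolding S_def
      by (subst quads_swap_outer_filter[where P' = "\<lambda>x z a e. e < x", symmetric])
         (auto simp: swap even[of "_ - _", simplified])
    moreover have "S (\<lambda>x z a e. e < x) (\<lambda>x z a e. w x z a e * F (x - e)) = S (\<lambda>x z a e. z < a) K"
    proof -
      have "S (\<lambda>x z a e. z < a) K = S (\<lambda>x z a e. z < a) (\<lambda>x z a e. w (x + e) z (a - z) e * F x)"
        unfolding S_def K_def w'_def by (rule sum.cong) (auto simp: shift)
      then show ?thesis
        using quads_shift_difference[of "\<lambda>x z a e. w (x + e) z (a - z) e * F x" n]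
        by (simp add: S_def)
    qed
    moreover have "S (\<lambda>x z a e. x = e) (\<lambda>x z a e. w x z a e * F (x - e)) =
        S (\<lambda>x z a e. x = e) (\<lambda>x z a e. w x z a e * F 0)"
      unfolding S_def by (rule sum.cong) auto
    ultimately show ?thesis by (simp add: xe)
  qed
  have plus: "T (\<lambda>x z a e. w x z a e * F (x + e)) =
      2 * S (\<lambda>x z a e. e < x) K + S (\<lambda>x z a e. z = a) (\<lambda>x z a e. w x z a e * F (x + e))"
  proof -
    have "S (\<lambda>x z a e. z < a) (\<lambda>x z a e. w x z a e * F (x + e)) =
          S (\<lambda>x z a e. a < z) (\<lambda>x z a e. w x z a e * F (x + e))"
      unfolding S_def
      by (subst quads_swap_outer_filter[where P' = "\<lambda>x z a e. a < z", symmetric])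
         (auto simp: swap add.commute)
    moreover have "S (\<lambda>x z a e. a < z) (\<lambda>x z a e. w x z a e * F (x + e)) = S (\<lambda>x z a e. e < x) K"
      using quads_shift_sum[of K n] by (simp add: S_def K_def w'_def)
    ultimately show ?thesis by (simp add: za)
  qed
  have fixed: "S (\<lambda>x z a e. a < z) K = S (\<lambda>x z a e. x < e) K"
  proof -
    have "S (\<lambda>x z a e. a < z) K = S (\<lambda>x z a e. a < z) (\<lambda>x z a e. w (x + e) z (a - z) e * F x)"
      unfolding S_def K_def w'_def by (rule sum.cong) (auto simp: shift)
    also have "\<dots> = S (\<lambda>x z a e. x < e) (\<lambda>x z a e. w e (a + z) (- z) (e - x) * F x)"
      using quads_shift_fixed[of "\<lambda>x z a e. w e (a + z) (- z) (e - x) * F x" n] by (simp add: S_def add.commute)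
    also have "\<dots> = S (\<lambda>x z a e. x < e) K"
      by (rule arg_cong[where f = "S _"]) (intro ext, simp only: K_def w'_def sign)
    finally show ?thesis .
  qed
  have "T (\<lambda>x z a e. w x z a e * (F (x - e) - F (x + e))) =
        T (\<lambda>x z a e. w x z a e * F (x - e)) - T (\<lambda>x z a e. w x z a e * F (x + e))"
    unfolding T_def sum_subtractf[symmetric] by (rule sum.cong) (auto simp: algebra_simps)
  also have "\<dots> = S (\<lambda>x z a e. x = e) (\<lambda>x z a e. w x z a e * F 0)
      - S (\<lambda>x z a e. z = a) (\<lambda>x z a e. w x z a e * F (x + e))
      + 2 * S (\<lambda>x z a e. x = e) K - 2 * S (\<lambda>x z a e. z = a) K"
    using minus plus fixed xe[of K] za[of K] by simp
  also have "S (\<lambda>x z a e. x = e) (\<lambda>x z a e. w x z a e * F 0) =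
      F 0 * S (\<lambda>x z a e. x = e) w"
    unfolding S_def sum_distrib_left by (rule sum.cong) auto
  finally show ?thesis unfolding T_def S_def K_def .
qed

lemma finite_pos_divisors: "0 < n \<Longrightarrow> finite {d :: int. 0 < d \<and> d dvd n}"
  by (rule finite_subset[of _ "{0..n}"]) (auto dest: zdvd_imp_le)

text \<open>On \<open>z = a\<close> the equation is (x + e)z = n, so the summation runs over the
  divisor d = x + e and its splittings.\<close>

lemma quads_diagonal_middle:
  assumes "0 < n"
  shows "(\<Sum>(x, z, a, e) \<in> {(x, z, a, e) \<in> quads n. z = a}. K x z a e) =
    (\<Sum>d \<in> {d. 0 < d \<and> d dvd n}. \<Sum>x \<in> {0<..<d}. K x (n div d) (n div d) (d - x))"
proof -
  have "(\<Sum>(x, z, a, e) \<in> {(x, z, a, e) \<in> quads n. z = a}. K x z a e) =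
    (\<Sum>(d, x) \<in> Sigma {d. 0 < d \<and> d dvd n} (\<lambda>d. {0<..<d}). K x (n div d) (n div d) (d - x))"
  proof (rule sum_reindex_onto[where h = "\<lambda>(d, x). (x, n div d, n div d, d - x)"], goal_cases)
    case (1 q)
    then obtain d x where q: "q = (d, x)" "0 < d" "d dvd n" "0 < x" "x < d" by auto
    then have "0 < n div d" using assms by (simp add: pos_imp_zdiv_pos_iff zdvd_imp_le)
    then show ?case using q by (auto simp: quads_def algebra_simps)
  next
    case (2 q)
    then obtain x z e where q: "q = (x, z, z, e)" "0 < x" "0 < z" "0 < e" "x * z + z * e = n"
      by (auto simp: quads_def)
    have n: "n = (x + e) * z" using q by (simp add: algebra_simps)
    then have "n div (x + e) = z" using q by simp
    then show ?case using q n by (intro bexI[of _ "(x + e, x)"]) auto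
  next
    case 3
    then show ?case by (auto simp: inj_on_def)
  next
    case (4 q)
    then show ?case by auto
  qed
  then show ?thesis by (simp add: sum.Sigma[symmetric] finite_pos_divisors assms)
qed

lemma quads_diagonal_outer:
  assumes "0 < n"
  shows "(\<Sum>(x, z, a, e) \<in> {(x, z, a, e) \<in> quads n. x = e}. K x z a e) =
    (\<Sum>d \<in> {d. 0 < d \<and> d dvd n}. \<Sum>z \<in> {0<..<d}. K (n div d) z (d - z) (n div d))"
proof -
  have "(\<Sum>(x, z, a, e) \<in> {(x, z, a, e) \<in> quads n. x = e}. K x z a e) =
        (\<Sum>(x, z, a, e) \<in> {(x, z, a, e) \<in> quads n. z = a}. K z x e a)"
    by (rule sum_reindex_involution[where h = "\<lambda>(x, z, a, e). (z, x, e, a)"]) (auto simp: quads_def algebra_simps)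
  also have "\<dots> = (\<Sum>d \<in> {d. 0 < d \<and> d dvd n}. \<Sum>z \<in> {0<..<d}. K (n div d) z (d - z) (n div d))"
    by (rule quads_diagonal_middle[OF assms])
  finally show ?thesis .
qed

section \<open>Odd traces\<close>

lemma sum_even_square_below:
  "(\<Sum>x \<in> {0<..<2 * int k + 1}. if even x then real_of_int (x\<^sup>2) else 0) =
    2 * real k * (real k + 1) * (2 * real k + 1) / 3"
proof (induction k)
  case (Suc k)
  have "{0<..<2 * int (Suc k) + 1} = insert (2 * int k + 1) (insert (2 * int k + 2) {0<..<2 * int k + 1})"
    by auto
  then show ?case using Suc by (simp add: field_simps power2_eq_square)
qed (auto intro!: sum.neutral)

lemma sum_odd_below:
  "(\<Sum>x \<in> {0<..<2 * int k + 1}. if odd x then 1 else 0) = real k"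
proof (induction k)
  case (Suc k)
  have "{0<..<2 * int (Suc k) + 1} = insert (2 * int k + 1) (insert (2 * int k + 2) {0<..<2 * int k + 1})"
    by auto
  then show ?case using Suc by simp
qed (auto intro!: sum.neutral)

lemma sum_odd_atMost:
  "(\<Sum>v \<in> {0..2 * int k}. if odd v then 1 else 0) = real k"
  "(\<Sum>v \<in> {0..2 * int k}. if odd v then real_of_int (v\<^sup>2) else 0) = real k * (4 * (real k)\<^sup>2 - 1) / 3"
proof (induction k)
  case (Suc k)
  have "{0..2 * int (Suc k)} = insert (2 * int k + 1) (insert (2 * int k + 2) {0..2 * int k})"
    by auto
  then show "(\<Sum>v \<in> {0..2 * int (Suc k)}. if odd v then 1 else 0) = real (Suc k)"
    "(\<Sum>v \<in> {0..2 * int (Suc k)}. if odd v then real_of_int (v\<^sup>2) else 0) =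
      real (Suc k) * (4 * (real (Suc k))\<^sup>2 - 1) / 3"
    using Suc by (simp_all add: field_simps power2_eq_square)
qed auto

lemma sum_pos_divisors_reflect:
  fixes n :: int
  assumes "0 < n"
  shows "(\<Sum>d \<in> {d. 0 < d \<and> d dvd n}. g (n div d)) = (\<Sum>d \<in> {d. 0 < d \<and> d dvd n}. g d)"
proof -
  have "n div d dvd n \<and> 0 < n div d \<and> n div (n div d) = d" if "0 < d" "d dvd n" for d
    using that assms by (auto elim!: dvdE simp: zero_less_mult_iff)
  then show ?thesis
    by (intro sum_reindex_involution[where h = "\<lambda>d. n div d"]) auto
qed

text \<open>For F(u) = u^2 the Liouville difference is -4xe. The weight must be invariant under the
  outer swap, so it admits x + z odd as well as a + e odd; for odd n these exclude each other and
  contribute equally, which gives -8Y.\<close>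

lemma sum_quads_odd_moment:
  assumes n: "0 < n" "odd n"
  shows "4 * (\<Sum>(x, z, a, e) \<in> quads n. if odd (x + z) then real_of_int (e * (x + z)) else 0) =
    (\<Sum>d \<in> {d. 0 < d \<and> d dvd n}. (4 * real_of_int d ^ 3 - real_of_int d) / 3 - real_of_int (n * d))"
proof -
  define D where "D = {d. 0 < d \<and> d dvd n}"
  define w :: "int \<Rightarrow> int \<Rightarrow> int \<Rightarrow> int \<Rightarrow> real"
    where "w x z a e = (if odd (x + z) \<or> odd (a + e) then 1 else 0)" for x z a e
  define F where "F u = real_of_int (u\<^sup>2)" for u
  define Y where "Y = (\<Sum>(x, z, a, e) \<in> quads n. if odd (x + z) then real_of_int (x * e) else 0)"
  have odd_div: "odd d \<and> odd (n div d)" if "d \<in> D" for d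
    using that n by (auto simp: D_def elim!: dvdE)
  have halves: "\<exists>k. d = 2 * int k + 1" if "d \<in> D" for d
  proof -
    from odd_div[OF that] obtain j where "d = 2 * j + 1" by (auto elim: oddE)
    then show ?thesis using that by (intro exI[of _ "nat j"]) (auto simp: D_def)
  qed
  have "(\<Sum>(x, z, a, e) \<in> quads n. w x z a e * (F (x - e) - F (x + e))) =
    F 0 * (\<Sum>(x, z, a, e) \<in> {(x, z, a, e) \<in> quads n. x = e}. w x z a e) -
    (\<Sum>(x, z, a, e) \<in> {(x, z, a, e) \<in> quads n. z = a}. w x z a e * F (x + e)) +
    2 * (\<Sum>(x, z, a, e) \<in> {(x, z, a, e) \<in> quads n. x = e}. w e (a + z) z (x - e) * F x) -
    2 * (\<Sum>(x, z, a, e) \<in> {(x, z, a, e) \<in> quads n. z = a}. w e (a + z) z (x - e) * F x)"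
  proof (rule liouville_identity)
    fix x z a e :: int
    have "odd (x + e + z) \<longleftrightarrow> odd (z + (x - e))" "odd (a - z + e) \<longleftrightarrow> odd (e + (a + z))"
      "odd (- z + (e - x)) \<longleftrightarrow> odd (z + (x - e))" by presburger+
    then show "w (x + e) z (a - z) e = w e (a + z) z (x - e)"
      "w e (a + z) (- z) (e - x) = w e (a + z) z (x - e)"
      unfolding w_def by metis+
    show "w e a z x = w x z a e" unfolding w_def by (simp add: add.commute disj_commute)
  qed (simp add: F_def)
  also have "(\<Sum>(x, z, a, e) \<in> {(x, z, a, e) \<in> quads n. z = a}. w x z a e * F (x + e)) =
      (\<Sum>d \<in> D. (real_of_int d - 1) * real_of_int (d\<^sup>2))"
    unfolding quads_diagonal_middle[OF n(1)] D_def[symmetric]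
  proof (rule sum.cong)
    fix d assume d: "d \<in> D"
    \<comment> \<open>\<open>x + (d - x)\<close> is odd, so one of its summands differs in parity
      from \<open>n div d\<close> and the weight is always 1.\<close>
    have "(\<Sum>x \<in> {0<..<d}. w x (n div d) (n div d) (d - x) * F (x + (d - x))) =
          (\<Sum>x \<in> {0<..<d}. real_of_int (d\<^sup>2))"
      using odd_div[OF d] by (intro sum.cong) (auto simp: w_def F_def)
    then show "(\<Sum>x \<in> {0<..<d}. w x (n div d) (n div d) (d - x) * F (x + (d - x))) =
          (real_of_int d - 1) * real_of_int (d\<^sup>2)"
      using d by (simp add: D_def)
  qed simp
  also have "(\<Sum>(x, z, a, e) \<in> {(x, z, a, e) \<in> quads n. x = e}. w e (a + z) z (x - e) * F x) =
      (\<Sum>d \<in> D. (real_of_int d - 1) / 2 * real_of_int ((n div d)\<^sup>2))"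
    unfolding quads_diagonal_outer[OF n(1)] D_def[symmetric]
  proof (rule sum.cong)
    fix d assume d: "d \<in> D"
    obtain k where k: "d = 2 * int k + 1" using halves[OF d] by blast
    \<comment> \<open>\<open>n div d\<close> and \<open>d\<close> are both odd, so only the second
      alternative in \<open>w\<close> can hold, and it selects odd z.\<close>
    have "(\<Sum>z \<in> {0<..<d}. w (n div d) (d - z + z) z (n div d - n div d) * F (n div d)) =
          (\<Sum>z \<in> {0<..<d}. (if odd z then 1 else 0)) * real_of_int ((n div d)\<^sup>2)"
      unfolding sum_distrib_right
      using odd_div[OF d] by (intro sum.cong) (auto simp: w_def F_def)
    then show "(\<Sum>z \<in> {0<..<d}. w (n div d) (d - z + z) z (n div d - n div d) * F (n div d)) =
          (real_of_int d - 1) / 2 * real_of_int ((n div d)\<^sup>2)"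
      unfolding k sum_odd_below by simp
  qed simp
  also have "\<dots> = (\<Sum>d \<in> D. (real_of_int (n div d) - 1) / 2 * real_of_int (d\<^sup>2))"
  proof -
    have "n div (n div d) = d" if "d \<in> D" for d
      using that n by (auto simp: D_def elim!: dvdE)
    then have "(\<Sum>d \<in> D. (real_of_int (n div d) - 1) / 2 * real_of_int (d\<^sup>2)) =
       (\<Sum>d \<in> D. (real_of_int (n div d) - 1) / 2 * real_of_int ((n div (n div d))\<^sup>2))"
      by (intro sum.cong) auto
    also have "\<dots> = (\<Sum>d \<in> D. (real_of_int d - 1) / 2 * real_of_int ((n div d)\<^sup>2))"
      unfolding D_def
      by (rule sum_pos_divisors_reflect[OF n(1), where g = "\<lambda>d. (real_of_int d - 1) / 2 * real_of_int ((n div d)\<^sup>2)"])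
    finally show ?thesis by simp
  qed
  also have "\<dots> = (\<Sum>d \<in> D. (real_of_int (n * d) - real_of_int (d\<^sup>2)) / 2)"
    using n by (intro sum.cong) (auto simp: D_def power2_eq_square field_simps elim!: dvdE)
  also have "(\<Sum>(x, z, a, e) \<in> {(x, z, a, e) \<in> quads n. z = a}. w e (a + z) z (x - e) * F x) =
      (\<Sum>d \<in> D. (real_of_int d - 1) * real_of_int d * (real_of_int d + 1) / 6)"
    unfolding quads_diagonal_middle[OF n(1)] D_def[symmetric]
  proof (rule sum.cong)
    fix d assume d: "d \<in> D"
    obtain k where k: "d = 2 * int k + 1" using halves[OF d] by blast
    have "(\<Sum>x \<in> {0<..<d}. w (d - x) (n div d + n div d) (n div d) (x - (d - x)) * F x) =
          (\<Sum>x \<in> {0<..<d}. (if even x then real_of_int (x\<^sup>2) else 0))"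
      using odd_div[OF d] by (intro sum.cong) (auto simp: w_def F_def)
    then show "(\<Sum>x \<in> {0<..<d}. w (d - x) (n div d + n div d) (n div d) (x - (d - x)) * F x) =
          (real_of_int d - 1) * real_of_int d * (real_of_int d + 1) / 6"
      unfolding k sum_even_square_below by (simp add: field_simps)
  qed simp
  finally have "(\<Sum>(x, z, a, e) \<in> quads n. w x z a e * (F (x - e) - F (x + e))) =
     (\<Sum>d \<in> D. real_of_int (n * d) - (4 * real_of_int d ^ 3 - real_of_int d) / 3)"
    unfolding sum_distrib_left F_def
    by (simp add: sum.distrib[symmetric] sum_subtractf[symmetric] sum_negf[symmetric] del: sum_negf of_int_mult)
       (intro sum.cong; simp add: field_simps power2_eq_square power3_eq_cube)
  also have "(\<Sum>(x, z, a, e) \<in> quads n. w x z a e * (F (x - e) - F (x + e))) = - 8 * Y"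
  proof -
    have "(\<Sum>(x, z, a, e) \<in> quads n. w x z a e * (F (x - e) - F (x + e))) =
       (\<Sum>(x, z, a, e) \<in> quads n. - 4 * ((if odd (x + z) then real_of_int (x * e) else 0) +
          (if odd (a + e) then real_of_int (x * e) else 0)))"
    proof (rule sum.cong, goal_cases)
      case (2 q)
      obtain x z a e where q: "q = (x, z, a, e)" by (cases q)
      have "\<not> (odd (x + z) \<and> odd (a + e))" using n 2 by (auto simp: q quads_def)
      then show ?case unfolding q w_def F_def by (auto simp: power2_eq_square algebra_simps)
    qed simp
    also have "\<dots> = - 4 * (Y + (\<Sum>(x, z, a, e) \<in> quads n. if odd (a + e) then real_of_int (x * e) else 0))"
      unfolding Y_def sum.distrib[symmetric] sum_distrib_left by (rule sum.cong) auto
    also have "(\<Sum>(x, z, a, e) \<in> quads n. if odd (a + e) then real_of_int (x * e) else 0) = Y"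
      unfolding Y_def
      by (rule sum_reindex_involution[where h = "\<lambda>(x, z, a, e). (e, a, z, x)"]) (auto simp: quads_def algebra_simps)
    finally show ?thesis by simp
  qed
  also have "(\<Sum>d \<in> D. real_of_int (n * d) - (4 * real_of_int d ^ 3 - real_of_int d) / 3) =
     - (\<Sum>d \<in> D. (4 * real_of_int d ^ 3 - real_of_int d) / 3 - real_of_int (n * d))"
    by (simp add: sum_negf[symmetric] del: sum_negf)
  finally have "8 * Y = (\<Sum>d \<in> D. (4 * real_of_int d ^ 3 - real_of_int d) / 3 - real_of_int (n * d))"
    by simp
  moreover have "(\<Sum>(x, z, a, e) \<in> quads n. if odd (x + z) then real_of_int (e * (x + z)) else 0) = 2 * Y"
  proof -
    have "(\<Sum>(x, z, a, e) \<in> quads n. if odd (x + z) then real_of_int (e * (x + z)) else 0) =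
      Y + (\<Sum>(x, z, a, e) \<in> quads n. if odd (z + x) then real_of_int (z * e) else 0)"
      unfolding Y_def sum.distrib[symmetric] by (rule sum.cong) (auto simp: algebra_simps)
    also have "(\<Sum>(x, z, a, e) \<in> quads n. if odd (z + x) then real_of_int (z * e) else 0) = Y"
      unfolding Y_def by (rule quads_swap_left)
    finally show ?thesis by simp
  qed
  ultimately show ?thesis by (simp add: D_def)
qed

text \<open>In each boundary sum except the divisor sum, n is written as a product of two odd
  factors, which forces the arguments of \<open>f\<close> to be even. In the divisor sum v = 0 and v
  = 2e are even as well, so every half weight that matters is 1.\<close>

lemma trace_selling_sum_odd:
  fixes f :: "int \<Rightarrow> real"
  assumes n: "0 < n" "odd n" and f: "\<And>t. f (- t) = f t" "\<And>t. even t \<Longrightarrow> f t = 0"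
  shows "(\<Sum>(t, l, m, v) \<in> trace_selling n. half_weight l * half_weight m * half_weight v * f t) =
    (\<Sum>(x, z, a, e) \<in> quads n. f (x + z - 2 * e) - f (x + z + 2 * e)) +
    2 * (\<Sum>d \<in> {d. 0 < d \<and> d dvd n}. \<Sum>v \<in> {0..2 * d}. f v)"
proof -
  have zero: "f t = 0" if "t\<^sup>2 = 4 * n" for t
  proof -
    have "even (t\<^sup>2)" using that by simp
    then show ?thesis using f by simp
  qed
  have 1: "(\<Sum>(t, l, m, v) \<in> {(t, l, m, v) \<in> trace_selling n. 2 * t + l = v}.
       half_weight l * half_weight m * half_weight v * f t) = 0"
  proof (rule sum.neutral, clarify)
    fix t l m assume A: "(t, l, m, 2 * t + l) \<in> trace_selling n"
    then have ev: "even (l - m)" "even (m - (2 * t + l))"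
      and "l * m + m * (2 * t + l) + (2 * t + l) * l = 4 * n - t\<^sup>2"
      unfolding trace_selling_def selling_triples_def mem_Collect_eq prod.case by blast+
    then have eq: "t\<^sup>2 + (l * m + m * (2 * t + l) + (2 * t + l) * l) = 4 * n" by linarith
    have "even (t - l)" using even_square_diff[OF ev eq] .
    then obtain y where y: "l = t + 2 * y" by (rule evenE_diff)
    have "even t"
    proof (rule ccontr)
      assume t: "odd t"
      have "(t + y) * (t + y + m) = n" using eq unfolding y by (simp add: power2_eq_square algebra_simps)
      then have "odd (t + y)" "odd (t + y + m)" using n by auto
      then show False using t ev y by auto
    qed
    then show "half_weight l * half_weight m * half_weight (2 * t + l) * f t = 0" using f by simp
  qed
  have 2: "(\<Sum>(x, z, a, e) \<in> {(x, z, a, e) \<in> upper_quads n. a = 2 * x}.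
            half_weight (z - x) * (f (x + z) + f (x + z + 2 * e))) = 0"
  proof (rule sum.neutral, clarify)
    fix x z e assume "(x, z, 2 * x, e) \<in> upper_quads n"
    then have "x * (z + 2 * e) = n" by (simp add: upper_quads_def quads_def algebra_simps)
    then have "odd x" "odd z" using n by auto
    then show "half_weight (z - x) * (f (x + z) + f (x + z + 2 * e)) = 0" using f by simp
  qed
  have 3: "(\<Sum>(x, z, a) \<in> {(x, z, a). 0 < x \<and> x < z \<and> x * z = n \<and> 0 < a \<and> a < 2 * x}. f (x + z)) = 0"
  proof (rule sum.neutral, clarify)
    fix x z :: int assume "n = x * z"
    then have "odd x" "odd z" using n by auto
    then show "f (x + z) = 0" using f by simp
  qed
  have "(\<Sum>(a, e, v) \<in> {(a, e, v). 0 < a \<and> 0 < e \<and> a * e = n \<and> 0 \<le> v \<and> v \<le> 2 * e}.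
            half_weight (2 * e - v) * half_weight v * f v) =
     (\<Sum>(d, v) \<in> Sigma {d. 0 < d \<and> d dvd n} (\<lambda>d. {0..2 * d}). f v)" (is "?D = _")
  proof (rule sum_reindex_onto[where h = "\<lambda>(d, v). (n div d, d, v)"], goal_cases)
    case (1 q)
    then show ?case using n by (auto simp: pos_imp_zdiv_pos_iff zdvd_imp_le)
  next
    case (2 q)
    then obtain a e v where q: "q = (a, e, v)" "0 < a" "0 < e" "a * e = n" "0 \<le> v" "v \<le> 2 * e" by auto
    then have "n div e = a" "e dvd n" by auto
    then show ?case using q by (intro bexI[of _ "(e, v)"]) auto
  next
    case 3
    then show ?case by (auto simp: inj_on_def)
  next
    case (4 q)
    then show ?case using f by (auto simp: half_weight_def)
  qed
  also have "\<dots> = (\<Sum>d \<in> {d. 0 < d \<and> d dvd n}. \<Sum>v \<in> {0..2 * d}. f v)"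
    by (simp add: sum.Sigma[symmetric] finite_pos_divisors n)
  finally have 4: "?D =
     (\<Sum>d \<in> {d. 0 < d \<and> d dvd n}. \<Sum>v \<in> {0..2 * d}. f v)" .
  show ?thesis
    using trace_selling_sum[of f n, OF f(1) zero] unfolding 1 2 3 4 by simp
qed

lemma trace_selling_sum_odd_count:
  assumes n: "0 < n" "odd n"
  shows "(\<Sum>(t, l, m, v) \<in> trace_selling n. half_weight l * half_weight m * half_weight v * (if odd t then 1 else 0)) =
    2 * (\<Sum>d \<in> {d. 0 < d \<and> d dvd n}. real_of_int d)"
proof -
  have "(\<Sum>v \<in> {0..2 * d}. if odd v then 1 else 0) = real_of_int d" if "0 < d" for d :: int
    using sum_odd_atMost(1)[of "nat d"] that by simp
  then show ?thesis
    by (subst trace_selling_sum_odd[OF n]) (auto intro!: sum.neutral sum.cong)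
qed

text \<open>The difference in the main term is 8e(x + z), and its sum cancels the divisor term. The
  choice n - t^2 is made for 4(n - t^2) = M - 4t^2 with M = 4n, the coefficient in
  \<open>cube_coeff_recursion\<close>.\<close>

lemma trace_selling_sum_odd_moment:
  assumes n: "0 < n" "odd n"
  shows "(\<Sum>(t, l, m, v) \<in> trace_selling n. half_weight l * half_weight m * half_weight v *
    (if odd t then real_of_int (n - t\<^sup>2) else 0)) = 0"
proof -
  define f where "f t = (if odd t then real_of_int (n - t\<^sup>2) else 0)" for t
  have inner: "(\<Sum>v \<in> {0..2 * d}. f v) = real_of_int (n * d) - (4 * real_of_int d ^ 3 - real_of_int d) / 3"
    if "0 < d" for d
  proof -
    have "(\<Sum>v \<in> {0..2 * d}. f v) = real_of_int n * (\<Sum>v \<in> {0..2 * int (nat d)}. if odd v then 1 else 0)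
       - (\<Sum>v \<in> {0..2 * int (nat d)}. if odd v then real_of_int (v\<^sup>2) else 0)"
      unfolding sum_distrib_left sum_subtractf[symmetric] using that
      by (intro sum.cong) (auto simp: f_def)
    then show ?thesis unfolding sum_odd_atMost using that
      by (simp add: power3_eq_cube power2_eq_square field_simps)
  qed
  have "(\<Sum>(x, z, a, e) \<in> quads n. f (x + z - 2 * e) - f (x + z + 2 * e)) =
     8 * (\<Sum>(x, z, a, e) \<in> quads n. if odd (x + z) then real_of_int (e * (x + z)) else 0)"
    unfolding sum_distrib_left
    by (rule sum.cong) (auto simp: f_def power2_eq_square algebra_simps)
  also have "\<dots> = 2 * (\<Sum>d \<in> {d. 0 < d \<and> d dvd n}. (4 * real_of_int d ^ 3 - real_of_int d) / 3 - real_of_int (n * d))"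
    using sum_quads_odd_moment[OF n] by simp
  also have "\<dots> = - 2 * (\<Sum>d \<in> {d. 0 < d \<and> d dvd n}. \<Sum>v \<in> {0..2 * d}. f v)"
  proof -
    have "(\<Sum>d \<in> {d. 0 < d \<and> d dvd n}. \<Sum>v \<in> {0..2 * d}. f v) =
      (\<Sum>d \<in> {d. 0 < d \<and> d dvd n}. - ((4 * real_of_int d ^ 3 - real_of_int d) / 3 - real_of_int (n * d)))"
      by (intro sum.cong) (simp_all add: inner)
    then show ?thesis unfolding sum_negf by simp
  qed
  finally have "(\<Sum>(t, l, m, v) \<in> trace_selling n. half_weight l * half_weight m * half_weight v * f t) = 0"
    by (subst trace_selling_sum_odd[OF n]) (auto simp: f_def)
  then show ?thesis by (simp add: f_def)
qed

section \<open>The trace sums for a prime\<close>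

lemma prime_mult_eq:
  fixes a b p :: int
  assumes "prime p" "0 < a" "0 < b" "a * b = p"
  shows "a = 1 \<and> b = p \<or> a = p \<and> b = 1"
proof -
  have "a dvd p" using assms(4) by auto
  then have "a = 1 \<or> a = p" using assms(1,2) by (auto simp: prime_int_iff)
  then show ?thesis using assms by auto
qed

lemma pos_divisors_prime:
  fixes p :: int
  assumes "prime p"
  shows "{d. 0 < d \<and> d dvd p} = {1, p}"
proof -
  have "0 < p" using assms by (simp add: prime_gt_0_int)
  moreover have "d = 1 \<or> d = p" if "0 < d" "d dvd p" for d
    using that assms by (auto simp: prime_int_iff)
  ultimately show ?thesis by auto
qed

text \<open>With t + l = 2y the equation factors as y(y + m) = p, so y = 1 and m = p - 1. Then l = 2
  - t and v = 2 + t are nonnegative and t is even.\<close>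

lemma trace_selling_prime_boundary:
  fixes p :: int
  assumes p: "prime p" "5 \<le> p" "odd p"
  shows "{(t, l, m, v) \<in> trace_selling p. 2 * t + l = v} =
    {(- 2, 4, p - 1, 0), (0, 2, p - 1, 2), (2, 0, p - 1, 4)}"
proof (intro equalityI subsetI)
  fix q :: "int \<times> int \<times> int \<times> int" assume "q \<in> {(t, l, m, v) \<in> trace_selling p. 2 * t + l = v}"
  then obtain t l m where q: "q = (t, l, m, 2 * t + l)" "(t, l, m, 2 * t + l) \<in> trace_selling p" by blast
  then have nonneg: "0 \<le> l" "0 \<le> m" "0 \<le> 2 * t + l"
      and ev: "even (l - m)" "even (m - (2 * t + l))"
      and "l * m + m * (2 * t + l) + (2 * t + l) * l = 4 * p - t\<^sup>2"
    unfolding trace_selling_def selling_triples_def mem_Collect_eq prod.case by blast+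
  then have eq: "t\<^sup>2 + (l * m + m * (2 * t + l) + (2 * t + l) * l) = 4 * p" by linarith
  have "even (t - l)" using even_square_diff[OF ev eq] .
  then obtain y where y: "t + l = 2 * y" by (metis evenE even_diff)
  have l: "l = 2 * y - t" using y by simp
  have e: "y * (y + m) = p" using eq unfolding l by (simp add: power2_eq_square algebra_simps)
  have "0 \<le> y" using nonneg y by linarith
  moreover have "y \<noteq> 0" using e p by auto
  ultimately have "0 < y" by simp
  moreover have "0 < y + m" using \<open>0 < y\<close> nonneg by simp
  ultimately have "y = 1 \<and> y + m = p \<or> y = p \<and> y + m = 1"
    using prime_mult_eq[OF p(1) _ _ e] by blast
  then have ym: "y = 1" "m = p - 1" using p nonneg by auto
  then have "even t" "- 2 \<le> t" "t \<le> 2" using ev l p nonneg by auto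
  then have "t = - 2 \<or> t = 0 \<or> t = 2" by presburger
  then show "q \<in> {(- 2, 4, p - 1, 0), (0, 2, p - 1, 2), (2, 0, p - 1, 4)}"
    using q ym l by auto
next
  fix q :: "int \<times> int \<times> int \<times> int" assume "q \<in> {(- 2, 4, p - 1, 0), (0, 2, p - 1, 2), (2, 0, p - 1, 4)}"
  then show "q \<in> {(t, l, m, v) \<in> trace_selling p. 2 * t + l = v}"
    using p by (auto simp: trace_selling_def selling_triples_def)
qed

lemma trace_selling_sum_prime:
  fixes p k :: int and f :: "int \<Rightarrow> real"
  assumes p: "prime p" "5 \<le> p" "p = 2 * k + 1" and even: "\<And>t. f (- t) = f t"
  shows "(\<Sum>(t, l, m, v) \<in> trace_selling p. half_weight l * half_weight m * half_weight v * f t) =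
    (\<Sum>(x, z, a, e) \<in> quads p. f (x + z - 2 * e) - f (x + z + 2 * e)) +
    2 * ((\<Sum>e \<in> {1..<k}. f (p + 1 - 2 * e) + f (p + 1)) + (\<Sum>v \<in> {0<..<2 * p}. f v)) +
    3 * f 0 + 2 * f 1 + 3 * f 2 - f (p + 1) + f (2 * p)"
proof -
  have zero: "f t = 0" if "t\<^sup>2 = 4 * p" for t
  proof -
    have "even (t\<^sup>2)" using that by simp
    then obtain s where "t = 2 * s" by auto
    then have "s * s = p" using that by (simp add: power2_eq_square)
    then have "\<bar>s\<bar> * \<bar>s\<bar> = p" by simp
    moreover have "0 < \<bar>s\<bar>" using \<open>s * s = p\<close> p by auto
    ultimately have "\<bar>s\<bar> = 1 \<and> \<bar>s\<bar> = p" using prime_mult_eq[OF p(1), of "\<bar>s\<bar>" "\<bar>s\<bar>"] by auto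
    then show ?thesis using p by auto
  qed
  have 1: "(\<Sum>(t, l, m, v) \<in> {(t, l, m, v) \<in> trace_selling p. 2 * t + l = v}.
       half_weight l * half_weight m * half_weight v * f t) = f 0 + f 2"
    using p even[of 2] by (subst trace_selling_prime_boundary) (auto simp: half_weight_def)
  have "(\<Sum>(x, z, a, e) \<in> {(x, z, a, e) \<in> upper_quads p. a = 2 * x}.
            half_weight (z - x) * (f (x + z) + f (x + z + 2 * e))) =
        (\<Sum>e \<in> {1..k}. half_weight (2 * k - 2 * e) * (f (p + 1 - 2 * e) + f (p + 1)))" (is "?E = _")
  proof (rule sum_reindex_onto[where h = "\<lambda>e. (1, p - 2 * e, 2, e)"], goal_cases)
    case (1 e)
    then show ?case using p by (auto simp: upper_quads_def quads_def)
  next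
    case (2 q)
    then obtain x z e where q: "q = (x, z, 2 * x, e)" "0 < x" "0 < z" "0 < e" "x \<le> z" "x * (z + 2 * e) = p"
      by (auto simp: upper_quads_def quads_def algebra_simps)
    then have "x = 1 \<and> z + 2 * e = p \<or> x = p \<and> z + 2 * e = 1"
      by (intro prime_mult_eq[OF p(1)]) auto
    then have "x = 1" "z = p - 2 * e" using q by auto
    then show ?case using q p by (intro bexI[of _ e]) auto
  next
    case 3
    then show ?case by (auto simp: inj_on_def)
  next
    case (4 e)
    then show ?case by (auto simp: p(3) algebra_simps)
  qed
  \<comment> \<open>e = k is the diagonal quadruple with x = z = 1, which counts one half.\<close>
  also have "{1..k} = insert k {1..<k}" using p by auto
  also have "(\<Sum>e \<in> insert k {1..<k}. half_weight (2 * k - 2 * e) * (f (p + 1 - 2 * e) + f (p + 1))) =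
      (f 2 + f (p + 1)) / 2 + (\<Sum>e \<in> {1..<k}. half_weight (2 * k - 2 * e) * (f (p + 1 - 2 * e) + f (p + 1)))"
    by (subst sum.insert) (auto simp: half_weight_def p(3))
  also have "(\<Sum>e \<in> {1..<k}. half_weight (2 * k - 2 * e) * (f (p + 1 - 2 * e) + f (p + 1))) =
      (\<Sum>e \<in> {1..<k}. f (p + 1 - 2 * e) + f (p + 1))"
    by (rule sum.cong) (auto simp: half_weight_def)
  finally have 2: "?E =
     (f 2 + f (p + 1)) / 2 + (\<Sum>e \<in> {1..<k}. f (p + 1 - 2 * e) + f (p + 1))" .
  have "{(x, z, a). 0 < x \<and> x < z \<and> x * z = p \<and> 0 < a \<and> a < 2 * x} = {(1, p, 1)}"
  proof -
    have "x = 1 \<and> z = p \<and> a = 1" if "0 < x" "x < z" "x * z = p" "0 < a" "a < 2 * x" for x z a :: int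
      using prime_mult_eq[OF p(1), of x z] that by auto
    moreover have "1 < p" using p by simp
    ultimately show ?thesis by (intro equalityI subsetI; clarsimp)
  qed
  then have 3: "(\<Sum>(x, z, a) \<in> {(x, z, a). 0 < x \<and> x < z \<and> x * z = p \<and> 0 < a \<and> a < 2 * x}. f (x + z)) = f (p + 1)"
    by (simp add: add.commute)
  have "{(a, e, v). 0 < a \<and> 0 < e \<and> a * e = p \<and> 0 \<le> v \<and> v \<le> 2 * e} =
     {(p, 1, 0), (p, 1, 1), (p, 1, 2)} \<union> ({1} \<times> {p} \<times> {0..2 * p})"
  proof -
    have v: "v = 0 \<or> v = 1 \<or> v = 2" if "0 \<le> v" "v \<le> 2" for v :: int using that by presburger
    have ae: "a = 1 \<and> e = p \<or> a = p \<and> e = 1" if "0 < a" "0 < e" "a * e = p" for a e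
      using prime_mult_eq[OF p(1)] that by blast
    have "0 < p" using p(2) by simp
    show ?thesis
    proof (intro equalityI subsetI)
      fix q assume "q \<in> {(a, e, v). 0 < a \<and> 0 < e \<and> a * e = p \<and> 0 \<le> v \<and> v \<le> 2 * e}"
      then obtain a e w where q: "q = (a, e, w)" "0 < a" "0 < e" "a * e = p" "0 \<le> w" "w \<le> 2 * e" by blast
      from ae[OF q(2-4)] show "q \<in> {(p, 1, 0), (p, 1, 1), (p, 1, 2)} \<union> ({1} \<times> {p} \<times> {0..2 * p})"
      proof
        assume "a = 1 \<and> e = p"
        then show ?thesis using q by simp
      next
        assume "a = p \<and> e = 1"
        then show ?thesis using q v[of w] by auto
      qed
    qed (use \<open>0 < p\<close> in auto)
  qed
  then have "(\<Sum>(a, e, v) \<in> {(a, e, v). 0 < a \<and> 0 < e \<and> a * e = p \<and> 0 \<le> v \<and> v \<le> 2 * e}.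
            half_weight (2 * e - v) * half_weight v * f v) =
     (\<Sum>(a, e, v) \<in> {(p, 1, 0), (p, 1, 1), (p, 1, 2)} \<union> ({1} \<times> {p} \<times> {0..2 * p}).
        half_weight (2 * e - v) * half_weight v * f v)" (is "?D = _")
    by (rule arg_cong)
  also have "\<dots> = (\<Sum>(a, e, v) \<in> {(p, 1, 0), (p, 1, 1), (p, 1, 2)}. half_weight (2 * e - v) * half_weight v * f v) +
     (\<Sum>(a, e, v) \<in> {1 :: int} \<times> {p} \<times> {0..2 * p}. half_weight (2 * e - v) * half_weight v * f v)"
    by (rule sum.union_disjoint) (use p(2) in auto)
  also have "(\<Sum>(a, e, v) \<in> {(p, 1, 0), (p, 1, 1), (p, 1, 2)}. half_weight (2 * e - v) * half_weight v * f v) =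
     f 0 / 2 + f 1 + f 2 / 2"
    by (simp add: half_weight_def)
  also have "(\<Sum>(a, e, v) \<in> {1 :: int} \<times> {p} \<times> {0..2 * p}. half_weight (2 * e - v) * half_weight v * f v) =
      (\<Sum>v \<in> {0..2 * p}. half_weight (2 * p - v) * half_weight v * f v)"
    by (rule sum_reindex_onto[where h = "\<lambda>v. (1, p, v)"]) (auto simp: inj_on_def)
  also have "{0..2 * p} = insert 0 (insert (2 * p) {0<..<2 * p})" using p by auto
  also have "(\<Sum>v \<in> insert 0 (insert (2 * p) {0<..<2 * p}). half_weight (2 * p - v) * half_weight v * f v) =
     f 0 / 2 + f (2 * p) / 2 + (\<Sum>v \<in> {0<..<2 * p}. half_weight (2 * p - v) * half_weight v * f v)"
    using p by (simp add: half_weight_def)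
  also have "(\<Sum>v \<in> {0<..<2 * p}. half_weight (2 * p - v) * half_weight v * f v) = (\<Sum>v \<in> {0<..<2 * p}. f v)"
    by (rule sum.cong) (auto simp: half_weight_def)
  finally have 4: "?D =
     (f 0 / 2 + f 1 + f 2 / 2) + (f 0 / 2 + f (2 * p) / 2 + (\<Sum>v \<in> {0<..<2 * p}. f v))" .
  show ?thesis
    using trace_selling_sum[of f p, OF even zero] unfolding 1 2 3 4 by (simp add: field_simps)
qed

text \<open>Three times the Kronecker-Hurwitz relation: the sum of H(4p - t^2) over all t is
  2p.\<close>

lemma trace_selling_sum_prime_count:
  fixes p :: int
  assumes p: "prime p" "5 \<le> p"
  shows "(\<Sum>(t, l, m, v) \<in> trace_selling p. half_weight l * half_weight m * half_weight v) = 6 * real_of_int p"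
proof -
  have "odd p" using p prime_odd_int by fastforce
  then obtain k where k: "p = 2 * k + 1" by (auto elim: oddE)
  show ?thesis
    using trace_selling_sum_prime[OF p k, of "\<lambda>_. 1"] p by (simp add: k)
qed

section \<open>Multiples of 3 and character sums\<close>

lemma chi_minus_3_mod: "chi_minus_3 (a mod 3) = chi_minus_3 a"
  by (simp add: chi_minus_3_def)

lemma mod3_cases: "(a :: int) mod 3 = 0 \<or> a mod 3 = 1 \<or> a mod 3 = 2"
  by presburger

lemma mod3_in: "(a :: int) mod 3 \<in> {0, 1, 2}"
  using mod3_cases[of a] by blast

lemma chi_minus_3_add: "chi_minus_3 (x + z) = chi_minus_3 (x mod 3 + z mod 3)"
  by (simp add: chi_minus_3_def mod_add_eq)

lemma quads_mod3:
  assumes "x * z + a * e = n"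
  shows "n mod 3 = ((x mod 3) * (z mod 3) + (a mod 3) * (e mod 3)) mod (3 :: int)"
  using assms by (metis mod_add_eq mod_mult_eq)

text \<open>The two character sums below are not proportional term by term. They become so after
  averaging over the swaps x <-> z, a <-> e and (x, z) <-> (a, e), which is a check of residues
  modulo 3.\<close>

lemma chi_minus_3_quads_mod3_eq_1:
  assumes "x * z + a * e = n" "n mod 3 = 1"
  defines "c \<equiv> chi_minus_3"
  shows "2 * ((c a + c e) * c (x + z) + (c x + c z) * c (a + e)) = (c x + c z) * (c a + c e)"
proof -
  have 1: "((x mod 3) * (z mod 3) + (a mod 3) * (e mod 3)) mod 3 = 1" using quads_mod3[OF assms(1)] assms(2) by simp
  have "\<forall>X \<in> {0, 1, 2}. \<forall>Z \<in> {0, 1, 2}. \<forall>A \<in> {0, 1, 2}. \<forall>E \<in> {0, 1, 2}.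
     (X * Z + A * E) mod 3 = 1 \<longrightarrow> 2 * ((chi_minus_3 A + chi_minus_3 E) * chi_minus_3 (X + Z) + (chi_minus_3 X + chi_minus_3 Z) * chi_minus_3 (A + E)) = (chi_minus_3 X + chi_minus_3 Z) * (chi_minus_3 A + chi_minus_3 E)"
    by (simp only: ball_simps) (simp add: chi_minus_3_def)
  from this[rule_format, OF mod3_in[of x] mod3_in[of z] mod3_in[of a] mod3_in[of e] 1]
  show ?thesis by (simp only: c_def chi_minus_3_mod chi_minus_3_add[symmetric])
qed

lemma chi_minus_3_quads_mod3_eq_2:
  assumes "x * z + a * e = n" "n mod 3 = 2"
  defines "c \<equiv> chi_minus_3"
  shows "(c a + c e) * c (x + z) + (c x + c z) * c (a + e) = - (c x + c z) * (c a + c e)"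
proof -
  have 1: "((x mod 3) * (z mod 3) + (a mod 3) * (e mod 3)) mod 3 = 2" using quads_mod3[OF assms(1)] assms(2) by simp
  have "\<forall>X \<in> {0, 1, 2}. \<forall>Z \<in> {0, 1, 2}. \<forall>A \<in> {0, 1, 2}. \<forall>E \<in> {0, 1, 2}.
     (X * Z + A * E) mod 3 = 2 \<longrightarrow> (chi_minus_3 A + chi_minus_3 E) * chi_minus_3 (X + Z) + (chi_minus_3 X + chi_minus_3 Z) * chi_minus_3 (A + E) = - (chi_minus_3 X + chi_minus_3 Z) * (chi_minus_3 A + chi_minus_3 E)"
    by (simp only: ball_simps) (simp add: chi_minus_3_def)
  from this[rule_format, OF mod3_in[of x] mod3_in[of z] mod3_in[of a] mod3_in[of e] 1]
  show ?thesis by (simp only: c_def chi_minus_3_mod chi_minus_3_add[symmetric])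
qed

text \<open>Accessible to Liouville's identity, since \<open>chi_minus_3 x * chi_minus_3 e\<close>
  is [3 | x - e] - [3 | x + e].\<close>

definition chi_pair_sum :: "int \<Rightarrow> int" where
  "chi_pair_sum n = (\<Sum>(x, z, a, e) \<in> quads n. chi_minus_3 x * chi_minus_3 e)"

text \<open>Up to sign the main term of the trace formula for the indicator of 3 | t; here -2e is
  congruent to e modulo 3.\<close>

definition chi_trace_sum :: "int \<Rightarrow> int" where
  "chi_trace_sum n = (\<Sum>(x, z, a, e) \<in> quads n. chi_minus_3 e * chi_minus_3 (x + z))"

lemma chi_pair_sum_symmetrized:
  "4 * chi_pair_sum n = (\<Sum>(x, z, a, e) \<in> quads n. (chi_minus_3 x + chi_minus_3 z) * (chi_minus_3 a + chi_minus_3 e))"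
proof -
  let ?c = chi_minus_3
  have 1: "(\<Sum>(x, z, a, e) \<in> quads n. ?c z * ?c e) = chi_pair_sum n"
    unfolding chi_pair_sum_def by (rule quads_swap_left)
  have 2: "(\<Sum>(x, z, a, e) \<in> quads n. ?c x * ?c a) = chi_pair_sum n"
    unfolding chi_pair_sum_def by (rule quads_swap_right)
  have 3: "(\<Sum>(x, z, a, e) \<in> quads n. ?c z * ?c a) = chi_pair_sum n"
    unfolding 1[symmetric] by (rule quads_swap_right)
  have "(\<Sum>(x, z, a, e) \<in> quads n. (?c x + ?c z) * (?c a + ?c e)) =
     chi_pair_sum n + (\<Sum>(x, z, a, e) \<in> quads n. ?c z * ?c e) + (\<Sum>(x, z, a, e) \<in> quads n. ?c x * ?c a) +
     (\<Sum>(x, z, a, e) \<in> quads n. ?c z * ?c a)"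
    unfolding chi_pair_sum_def sum.distrib[symmetric] by (rule sum.cong) (auto simp: algebra_simps)
  then show ?thesis using 1 2 3 by simp
qed

lemma chi_trace_sum_symmetrized:
  "4 * chi_trace_sum n = (\<Sum>(x, z, a, e) \<in> quads n.
     (chi_minus_3 a + chi_minus_3 e) * chi_minus_3 (x + z) + (chi_minus_3 x + chi_minus_3 z) * chi_minus_3 (a + e))"
proof -
  let ?c = chi_minus_3
  have 1: "(\<Sum>(x, z, a, e) \<in> quads n. ?c a * ?c (x + z)) = chi_trace_sum n"
    unfolding chi_trace_sum_def by (rule quads_swap_right)
  have 2: "(\<Sum>(x, z, a, e) \<in> quads n. ?c z * ?c (a + e)) = chi_trace_sum n"
    unfolding chi_trace_sum_def by (rule quads_swap_pairs)
  have 3: "(\<Sum>(x, z, a, e) \<in> quads n. ?c x * ?c (a + e)) = chi_trace_sum n"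
    unfolding 2[symmetric] by (rule quads_swap_left)
  have "(\<Sum>(x, z, a, e) \<in> quads n. (?c a + ?c e) * ?c (x + z) + (?c x + ?c z) * ?c (a + e)) =
     chi_trace_sum n + (\<Sum>(x, z, a, e) \<in> quads n. ?c a * ?c (x + z)) + (\<Sum>(x, z, a, e) \<in> quads n. ?c z * ?c (a + e)) +
     (\<Sum>(x, z, a, e) \<in> quads n. ?c x * ?c (a + e))"
    unfolding chi_trace_sum_def sum.distrib[symmetric] by (rule sum.cong) (auto simp: algebra_simps)
  then show ?thesis using 1 2 3 by simp
qed

lemma chi_trace_sum_mod3_eq_1:
  assumes "n mod 3 = 1"
  shows "2 * chi_trace_sum n = chi_pair_sum n"
proof -
  have "2 * (4 * chi_trace_sum n) = 4 * chi_pair_sum n"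
    unfolding chi_trace_sum_symmetrized chi_pair_sum_symmetrized sum_distrib_left
  proof (rule sum.cong, goal_cases)
    case (2 q)
    obtain x z a e where q: "q = (x, z, a, e)" by (cases q)
    have "x * z + a * e = n" using 2 by (auto simp: q quads_def)
    then show ?case using chi_minus_3_quads_mod3_eq_1[of x z a e n] assms unfolding q by simp
  qed simp
  then show ?thesis by simp
qed

lemma chi_trace_sum_mod3_eq_2:
  assumes "n mod 3 = 2"
  shows "chi_trace_sum n = - chi_pair_sum n"
proof -
  have "4 * chi_trace_sum n = - (4 * chi_pair_sum n)"
    unfolding chi_trace_sum_symmetrized chi_pair_sum_symmetrized sum_negf[symmetric]
  proof (rule sum.cong, goal_cases)
    case (2 q)
    obtain x z a e where q: "q = (x, z, a, e)" by (cases q)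
    have "x * z + a * e = n" using 2 by (auto simp: q quads_def)
    then show ?case using chi_minus_3_quads_mod3_eq_2[of x z a e n] assms unfolding q by (simp add: algebra_simps)
  qed simp
  then show ?thesis by simp
qed

lemma sum_mod3_count:
  "(\<Sum>e \<in> {0<..<int N + 1}. if 3 dvd e then 1 else 0 :: real) = real (N div 3)"
  "(\<Sum>e \<in> {0<..<int N + 1}. if 3 dvd e - 1 then 1 else 0 :: real) = real ((N + 2) div 3)"
proof (induction N)
  case (Suc N)
  have i: "{0<..<int (Suc N) + 1} = insert (int N + 1) {0<..<int N + 1}" by auto
  have "int N + 1 = int (Suc N)" by simp
  then have 3: "3 dvd int N + 1 \<longleftrightarrow> 3 dvd Suc N" by (metis of_nat_numeral of_nat_dvd_iff)
  have 4: "3 dvd int N \<longleftrightarrow> 3 dvd N" by (metis of_nat_numeral of_nat_dvd_iff)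
  have 5: "Suc N div 3 = N div 3 + (if 3 dvd Suc N then 1 else 0)" by (simp add: div_Suc dvd_eq_mod_eq_0)
  have 6: "(Suc N + 2) div 3 = (N + 2) div 3 + (if 3 dvd N then 1 else 0)"
    by (simp add: div_Suc dvd_eq_mod_eq_0)
  show "(\<Sum>e \<in> {0<..<int (Suc N) + 1}. if 3 dvd e then 1 else 0 :: real) = real (Suc N div 3)"
    unfolding i 5 using Suc 3 by simp
  show "(\<Sum>e \<in> {0<..<int (Suc N) + 1}. if 3 dvd e - 1 then 1 else 0 :: real) = real ((Suc N + 2) div 3)"
    unfolding i 6 using Suc 4 by simp
qed (auto intro!: sum.neutral)

lemma chi_pair_sum_prime:
  fixes p :: int
  assumes p: "prime p" "5 \<le> p"
  shows "real_of_int (chi_pair_sum p) = real_of_int p - 1 - 2 * real (nat (p - 1) div 3)"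
proof -
  define F :: "int \<Rightarrow> real" where "F u = (if 3 dvd u then 1 else 0)" for u
  have D: "{d. 0 < d \<and> d dvd p} = {1, p}" by (rule pos_divisors_prime[OF p(1)])
  have "real_of_int (chi_minus_3 x * chi_minus_3 e) = F (x - e) - F (x + e)" for x e
  proof -
    have *: "3 dvd x - e \<longleftrightarrow> (x mod 3 - e mod 3) mod 3 = 0" "3 dvd x + e \<longleftrightarrow> (x mod 3 + e mod 3) mod 3 = 0"
      by (simp_all add: dvd_eq_mod_eq_0 mod_diff_eq mod_add_eq)
    show ?thesis unfolding F_def * chi_minus_3_def
      using mod3_cases[of x] mod3_cases[of e] by (elim disjE; simp)
  qed
  then have "real_of_int (chi_pair_sum p) = (\<Sum>(x, z, a, e) \<in> quads p. 1 * (F (x - e) - F (x + e)))"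
    unfolding chi_pair_sum_def of_int_sum by (intro sum.cong) auto
  also have "\<dots> = F 0 * (\<Sum>(x, z, a, e) \<in> {(x, z, a, e) \<in> quads p. x = e}. 1) -
    (\<Sum>(x, z, a, e) \<in> {(x, z, a, e) \<in> quads p. z = a}. 1 * F (x + e)) +
    2 * (\<Sum>(x, z, a, e) \<in> {(x, z, a, e) \<in> quads p. x = e}. 1 * F x) -
    2 * (\<Sum>(x, z, a, e) \<in> {(x, z, a, e) \<in> quads p. z = a}. 1 * F x)"
    by (rule liouville_identity) (auto simp: F_def)
  also have "\<dots> = real_of_int p - 1 - 2 * (\<Sum>x \<in> {0<..<p}. F x)"
  proof -
    have "\<not> 3 dvd p"
    proof
      assume "3 dvd p"
      then have "3 \<in> {d. 0 < d \<and> d dvd p}" by simp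
      then show False using p unfolding D by simp
    qed
    moreover have "0 < p" "{0<..<1 :: int} = {}" using p(2) by auto
    ultimately show ?thesis
      unfolding quads_diagonal_outer[OF \<open>0 < p\<close>] quads_diagonal_middle[OF \<open>0 < p\<close>] D
      using p(2) by (simp add: F_def)
  qed
  also have "(\<Sum>x \<in> {0<..<p}. F x) = real (nat (p - 1) div 3)"
    using sum_mod3_count(1)[of "nat (p - 1)"] p by (simp add: F_def)
  finally show ?thesis .
qed

lemma trace_selling_sum_prime_mod3:
  fixes p :: int
  assumes p: "prime p" "5 \<le> p"
  shows "p mod 3 = 1 \<Longrightarrow> (\<Sum>(t, l, m, v) \<in> trace_selling p. half_weight l * half_weight m * half_weight v *
      (if 3 dvd t then 1 else 0)) = 3 * (real_of_int p + 1) / 2"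
    and "p mod 3 = 2 \<Longrightarrow> (\<Sum>(t, l, m, v) \<in> trace_selling p. half_weight l * half_weight m * half_weight v *
      (if 3 dvd t then 1 else 0)) = 3 * (real_of_int p - 1)"
proof -
  define f :: "int \<Rightarrow> real" where "f t = (if 3 dvd t then 1 else 0)" for t
  have "odd p" using p prime_odd_int by fastforce
  then obtain k where k: "p = 2 * k + 1" by (auto elim: oddE)
  have "f (x + z - 2 * e) - f (x + z + 2 * e) = - real_of_int (chi_minus_3 e * chi_minus_3 (x + z))" for x z e
  proof -
    have *: "3 dvd y - 2 * e \<longleftrightarrow> (y mod 3 - 2 * (e mod 3)) mod 3 = 0"
       "3 dvd y + 2 * e \<longleftrightarrow> (y mod 3 + 2 * (e mod 3)) mod 3 = 0" for y by presburger+
    show ?thesis unfolding f_def * chi_minus_3_def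
      using mod3_cases[of "x + z"] mod3_cases[of e] by (elim disjE; simp)
  qed
  then have "(\<Sum>(x, z, a, e) \<in> quads p. f (x + z - 2 * e) - f (x + z + 2 * e)) = - real_of_int (chi_trace_sum p)"
    unfolding chi_trace_sum_def of_int_sum sum_negf[symmetric] by (intro sum.cong) auto
  moreover have "(\<Sum>v \<in> {0<..<2 * p}. f v) = real (nat (2 * p - 1) div 3)"
    using sum_mod3_count(1)[of "nat (2 * p - 1)"] p by (simp add: f_def)
  moreover have "(\<Sum>(t, l, m, v) \<in> trace_selling p. half_weight l * half_weight m * half_weight v * f t) =
    (\<Sum>(x, z, a, e) \<in> quads p. f (x + z - 2 * e) - f (x + z + 2 * e)) +
    2 * ((\<Sum>e \<in> {1..<k}. f (p + 1 - 2 * e) + f (p + 1)) + (\<Sum>v \<in> {0<..<2 * p}. f v)) +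
    3 * f 0 + 2 * f 1 + 3 * f 2 - f (p + 1) + f (2 * p)"
    by (rule trace_selling_sum_prime[OF p k]) (simp add: f_def)
  moreover have "f 0 = 1" "f 1 = 0" "f 2 = 0" by (simp_all add: f_def)
  moreover have ivl: "{1..<k} = {0<..<k}" by auto
  ultimately have main: "(\<Sum>(t, l, m, v) \<in> trace_selling p. half_weight l * half_weight m * half_weight v * f t) =
    - real_of_int (chi_trace_sum p) +
    2 * ((\<Sum>e \<in> {0<..<k}. f (p + 1 - 2 * e) + f (p + 1)) + real (nat (2 * p - 1) div 3)) +
    3 - f (p + 1) + f (2 * p)"
    unfolding ivl by simp
  show "(\<Sum>(t, l, m, v) \<in> trace_selling p. half_weight l * half_weight m * half_weight v *
      (if 3 dvd t then 1 else 0)) = 3 * (real_of_int p + 1) / 2" if "p mod 3 = 1"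
  proof -
    have "p mod 6 = 1" using that \<open>odd p\<close> by presburger
    then have "p = 6 * int (nat (p div 6)) + 1"
      using mult_div_mod_eq[of 6 p] p(2) by (simp add: pos_imp_zdiv_nonneg_iff)
    then obtain q where q: "p = 6 * int q + 1" by blast
    have "chi_pair_sum p = 2 * int q"
    proof -
      have "nat (p - 1) div 3 = 2 * q" using q by simp
      then have "real_of_int (chi_pair_sum p) = real_of_int (2 * int q)"
        using chi_pair_sum_prime[OF p] q by simp
      then show ?thesis by (simp only: of_int_eq_iff)
    qed
    then have "chi_trace_sum p = int q" using chi_trace_sum_mod3_eq_1[OF that] by simp
    moreover have "nat (2 * p - 1) div 3 = 4 * q"
      using q by (auto simp: nat_add_distrib nat_mult_distrib)
    moreover have "\<not> 3 dvd p + 1 \<and> \<not> 3 dvd 2 * p" unfolding q by presburger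
    then have "f (p + 1) = 0" "f (2 * p) = 0" by (simp_all add: f_def)
    moreover have "(\<Sum>e \<in> {0<..<k}. f (p + 1 - 2 * e)) = real q"
    proof -
      have "0 < q" using p q by linarith
      then have k3: "k = int (3 * q - 1) + 1" "(3 * q - 1 + 2) div 3 = q" using q k by linarith+
      have "3 dvd 6 * int q + 1 + 1 - 2 * e \<longleftrightarrow> 3 dvd e - 1" for e by presburger
      then have "f (p + 1 - 2 * e) = (if 3 dvd e - 1 then 1 else 0)" for e
        unfolding f_def q by simp
      then show ?thesis using sum_mod3_count(2)[of "3 * q - 1"] by (simp only: k3)
    qed
    ultimately show ?thesis using main q by (simp add: f_def sum.distrib field_simps)
  qed
  show "(\<Sum>(t, l, m, v) \<in> trace_selling p. half_weight l * half_weight m * half_weight v *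
      (if 3 dvd t then 1 else 0)) = 3 * (real_of_int p - 1)" if "p mod 3 = 2"
  proof -
    have "p mod 6 = 5" using that \<open>odd p\<close> by presburger
    then have "p = 6 * int (nat (p div 6)) + 5"
      using mult_div_mod_eq[of 6 p] p(2) by (simp add: pos_imp_zdiv_nonneg_iff)
    then obtain q where q: "p = 6 * int q + 5" by blast
    have "chi_pair_sum p = 2 * int q + 2"
    proof -
      have "nat (p - 1) div 3 = 2 * q + 1" using q by linarith
      then have "real_of_int (chi_pair_sum p) = real_of_int (2 * int q + 2)"
        using chi_pair_sum_prime[OF p] q by simp
      then show ?thesis by (simp only: of_int_eq_iff)
    qed
    then have "chi_trace_sum p = - 2 * int q - 2" using chi_trace_sum_mod3_eq_2[OF that] by simp
    moreover have "nat (2 * p - 1) div 3 = 4 * q + 3" using q by linarith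
    moreover have "3 dvd p + 1 \<and> \<not> 3 dvd 2 * p" unfolding q by presburger
    then have "f (p + 1) = 1" "f (2 * p) = 0" by (simp_all add: f_def)
    moreover have "(\<Sum>e \<in> {0<..<k}. f (p + 1 - 2 * e)) = real q"
    proof -
      have k3: "k = int (3 * q + 1) + 1" "(3 * q + 1) div 3 = q" using q k by linarith+
      have "3 dvd 6 * int q + 5 + 1 - 2 * e \<longleftrightarrow> 3 dvd e" for e by presburger
      then have "f (p + 1 - 2 * e) = (if 3 dvd e then 1 else 0)" for e
        unfolding f_def q by simp
      then show ?thesis using sum_mod3_count(1)[of "3 * q + 1"] by (simp only: k3)
    qed
    moreover have "real_of_int (k - 1) = 3 * real q + 1" using q k by simp
    ultimately show ?thesis using main q p k by (simp add: f_def sum.distrib field_simps)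
  qed
qed

section \<open>Cubes of theta series\<close>

definition chi_minus_4 :: "int \<Rightarrow> int" where
  "chi_minus_4 k = (if k mod 4 = 1 then 1 else if k mod 4 = 3 then - 1 else 0)"

text \<open>The Kronecker symbol (12/k), an even character as a product of two odd ones.\<close>

definition chi_12 :: "int \<Rightarrow> int" where
  "chi_12 k = chi_minus_3 k * chi_minus_4 k"

lemma odd_mod4: "odd k \<longleftrightarrow> k mod 4 = 1 \<or> k mod 4 = (3 :: int)"
  by presburger

lemma chi_minus_4_uminus [simp]: "chi_minus_4 (- k) = - chi_minus_4 k"
proof -
  have "(- k) mod 4 = 1 \<longleftrightarrow> k mod 4 = 3" "(- k) mod 4 = 3 \<longleftrightarrow> k mod 4 = 1" by presburger+
  then show ?thesis by (simp add: chi_minus_4_def)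
qed

lemma chi_minus_3_uminus [simp]: "chi_minus_3 (- k) = - chi_minus_3 k"
proof -
  have "(- k) mod 3 = 1 \<longleftrightarrow> k mod 3 = 2" "(- k) mod 3 = 2 \<longleftrightarrow> k mod 3 = 1" by presburger+
  then show ?thesis by (simp add: chi_minus_3_def)
qed

lemma chi_minus_4_mult_odd:
  assumes "odd a" "odd b"
  shows "chi_minus_4 a * chi_minus_4 b = (if 4 dvd a - b then 1 else - 1)"
proof -
  have "a mod 4 = 1 \<Longrightarrow> b mod 4 = 1 \<Longrightarrow> 4 dvd a - b" "a mod 4 = 3 \<Longrightarrow> b mod 4 = 3 \<Longrightarrow> 4 dvd a - b"
    "a mod 4 = 1 \<Longrightarrow> b mod 4 = 3 \<Longrightarrow> \<not> 4 dvd a - b" "a mod 4 = 3 \<Longrightarrow> b mod 4 = 1 \<Longrightarrow> \<not> 4 dvd a - b"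
    by presburger+
  then show ?thesis using assms unfolding odd_mod4 by (elim disjE) (simp_all add: chi_minus_4_def)
qed

lemma chi_minus_3_cong: "3 dvd a - b \<Longrightarrow> chi_minus_3 a = chi_minus_3 b"
proof -
  assume "3 dvd a - b"
  then have "a mod 3 = b mod 3" by presburger
  then show ?thesis by (simp add: chi_minus_3_def)
qed

lemma odd_square_mod8:
  fixes t :: int
  assumes "odd t"
  shows "t\<^sup>2 mod 8 = 1"
proof -
  from assms obtain k where k: "t = 2 * k + 1" by (rule oddE)
  have "even (k * (k + 1))" by simp
  then obtain j where "k * (k + 1) = 2 * j" ..
  then have "t\<^sup>2 = 8 * j + 1" unfolding k by (simp add: power2_eq_square algebra_simps)
  then show ?thesis by simp
qed

definition odd_le :: "int \<Rightarrow> int set" where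
  "odd_le M = {t. odd t \<and> t\<^sup>2 \<le> M}"

definition odd_squares3 :: "int \<Rightarrow> (int \<times> int \<times> int) set" where
  "odd_squares3 N = {(x, y, z). odd x \<and> odd y \<and> odd z \<and> x\<^sup>2 + y\<^sup>2 + z\<^sup>2 = N}"

definition odd_squares4 :: "int \<Rightarrow> (int \<times> int \<times> int \<times> int) set" where
  "odd_squares4 M = {(t, x, y, z). odd t \<and> odd x \<and> odd y \<and> odd z \<and> t\<^sup>2 + x\<^sup>2 + y\<^sup>2 + z\<^sup>2 = M}"

lemma finite_odd_le [simp]: "finite (odd_le M)"
  by (rule finite_subset[OF _ finite_square_le[of M]]) (auto simp: odd_le_def)

lemma finite_odd_squares3 [simp]: "finite (odd_squares3 N)"
proof (rule finite_subset)
  show "odd_squares3 N \<subseteq> {t. t\<^sup>2 \<le> N} \<times> {t. t\<^sup>2 \<le> N} \<times> {t. t\<^sup>2 \<le> N}"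
    by (auto simp: odd_squares3_def)
qed (simp add: finite_square_le)

lemma odd_squares4_Sigma: "odd_squares4 M = Sigma (odd_le M) (\<lambda>t. odd_squares3 (M - t\<^sup>2))"
proof -
  have "t\<^sup>2 \<le> t\<^sup>2 + x\<^sup>2 + y\<^sup>2 + z\<^sup>2" for t x y z :: int by simp
  then show ?thesis by (auto simp: odd_squares4_def odd_le_def odd_squares3_def)
qed

lemma finite_odd_squares4 [simp]: "finite (odd_squares4 M)"
  by (simp add: odd_squares4_Sigma)

text \<open>Coefficient of q^N in the cube of the series of w(t) q^(t^2) over odd t.\<close>

definition cube_coeff :: "(int \<Rightarrow> int) \<Rightarrow> int \<Rightarrow> int" where
  "cube_coeff w N = (\<Sum>(x, y, z) \<in> odd_squares3 N. w x * w y * w z)"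

lemma sum_odd_squares4:
  "(\<Sum>(t, x, y, z) \<in> odd_squares4 M. g t * (w x * w y * w z)) =
   (\<Sum>t \<in> odd_le M. g t * cube_coeff w (M - t\<^sup>2))"
  unfolding odd_squares4_Sigma cube_coeff_def sum_distrib_left
  by (subst sum.Sigma) (auto intro!: sum.cong)

lemma odd_squares4_permute:
  "(\<Sum>(t, x, y, z) \<in> odd_squares4 M. g x t y z) = (\<Sum>(t, x, y, z) \<in> odd_squares4 M. g t x y z)"
  "(\<Sum>(t, x, y, z) \<in> odd_squares4 M. g y x t z) = (\<Sum>(t, x, y, z) \<in> odd_squares4 M. g t x y z)"
  "(\<Sum>(t, x, y, z) \<in> odd_squares4 M. g z x y t) = (\<Sum>(t, x, y, z) \<in> odd_squares4 M. g t x y z)"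
proof -
  show "(\<Sum>(t, x, y, z) \<in> odd_squares4 M. g x t y z) = (\<Sum>(t, x, y, z) \<in> odd_squares4 M. g t x y z)"
    by (rule sum_reindex_involution[where h = "\<lambda>(t, x, y, z). (x, t, y, z)"]) (auto simp: odd_squares4_def)
  show "(\<Sum>(t, x, y, z) \<in> odd_squares4 M. g y x t z) = (\<Sum>(t, x, y, z) \<in> odd_squares4 M. g t x y z)"
    by (rule sum_reindex_involution[where h = "\<lambda>(t, x, y, z). (y, x, t, z)"]) (auto simp: odd_squares4_def)
  show "(\<Sum>(t, x, y, z) \<in> odd_squares4 M. g z x y t) = (\<Sum>(t, x, y, z) \<in> odd_squares4 M. g t x y z)"
    by (rule sum_reindex_involution[where h = "\<lambda>(t, x, y, z). (z, x, y, t)"]) (auto simp: odd_squares4_def)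
qed

lemma odd_squares4_symmetrize:
  fixes g :: "int \<Rightarrow> int" and W :: "int \<Rightarrow> int \<Rightarrow> int \<Rightarrow> int \<Rightarrow> int"
  assumes "\<And>t x y z. W x t y z = W t x y z" "\<And>t x y z. W y x t z = W t x y z" "\<And>t x y z. W z x y t = W t x y z"
  shows "(\<Sum>(t, x, y, z) \<in> odd_squares4 M. W t x y z * (g t + g x + g y + g z)) =
    4 * (\<Sum>(t, x, y, z) \<in> odd_squares4 M. W t x y z * g t)"
proof -
  let ?S = "\<Sum>(t, x, y, z) \<in> odd_squares4 M. W t x y z * g t"
  have "(\<Sum>(t, x, y, z) \<in> odd_squares4 M. W t x y z * (g t + g x + g y + g z)) =
    ?S + (\<Sum>(t, x, y, z) \<in> odd_squares4 M. W t x y z * g x) +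
    (\<Sum>(t, x, y, z) \<in> odd_squares4 M. W t x y z * g y) + (\<Sum>(t, x, y, z) \<in> odd_squares4 M. W t x y z * g z)"
    unfolding sum.distrib[symmetric] by (rule sum.cong) (auto simp: algebra_simps)
  moreover have "(\<Sum>(t, x, y, z) \<in> odd_squares4 M. W t x y z * g x) = ?S"
    using odd_squares4_permute(1)[of "\<lambda>t x y z. W t x y z * g t" M] by (simp add: assms(1))
  moreover have "(\<Sum>(t, x, y, z) \<in> odd_squares4 M. W t x y z * g y) = ?S"
    using odd_squares4_permute(2)[of "\<lambda>t x y z. W t x y z * g t" M] by (simp add: assms(2))
  moreover have "(\<Sum>(t, x, y, z) \<in> odd_squares4 M. W t x y z * g z) = ?S"
    using odd_squares4_permute(3)[of "\<lambda>t x y z. W t x y z * g t" M] by (simp add: assms(3))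
  ultimately show ?thesis by simp
qed

text \<open>Each factor M - 4t^2 may be averaged over the four coordinates, and their sum is 4M - 4M
  = 0.\<close>

lemma cube_coeff_recursion:
  "(\<Sum>t \<in> odd_le M. w t * (M - 4 * t\<^sup>2) * cube_coeff w (M - t\<^sup>2)) = 0"
proof -
  have "4 * (\<Sum>(t, x, y, z) \<in> odd_squares4 M. w t * w x * w y * w z * (M - 4 * t\<^sup>2)) =
    (\<Sum>(t, x, y, z) \<in> odd_squares4 M. w t * w x * w y * w z *
      ((M - 4 * t\<^sup>2) + (M - 4 * x\<^sup>2) + (M - 4 * y\<^sup>2) + (M - 4 * z\<^sup>2)))"
    by (rule odd_squares4_symmetrize[symmetric]) (simp_all add: mult_ac)
  also have "\<dots> = 0"
    by (rule sum.neutral) (auto simp: odd_squares4_def)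
  finally have "(\<Sum>(t, x, y, z) \<in> odd_squares4 M. w t * w x * w y * w z * (M - 4 * t\<^sup>2)) = 0" by simp
  moreover have "(\<Sum>(t, x, y, z) \<in> odd_squares4 M. w t * w x * w y * w z * (M - 4 * t\<^sup>2)) =
    (\<Sum>(t, x, y, z) \<in> odd_squares4 M. w t * (M - 4 * t\<^sup>2) * (w x * w y * w z))"
    by (rule sum.cong) (auto simp: mult_ac)
  ultimately show ?thesis by (simp only: sum_odd_squares4)
qed

text \<open>
  The recursion is \<open>\<Theta> U' = 3 \<Theta>' U\<close> for \<open>\<Theta> = \<Sum>\<^sub>t w(t) q\<^bsup>t\<^sup>2\<^esup>\<close> and \<open>U = \<Sum>\<^sub>N u(N) q\<^sup>N\<close>; it determines \<open>U\<close> up to a factor, and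
  \<open>\<Theta>\<^sup>3\<close> satisfies it.
\<close>

lemma cube_recursion_unique:
  fixes u v w :: "int \<Rightarrow> int"
  assumes w: "w 1 = 1" "w (- 1) = 1" and base: "u 3 = v 3"
    and u: "\<And>M. M mod 8 = 4 \<Longrightarrow> (\<Sum>t \<in> odd_le M. w t * (M - 4 * t\<^sup>2) * u (M - t\<^sup>2)) = 0"
    and v: "\<And>M. M mod 8 = 4 \<Longrightarrow> (\<Sum>t \<in> odd_le M. w t * (M - 4 * t\<^sup>2) * v (M - t\<^sup>2)) = 0"
  shows "0 \<le> N \<Longrightarrow> N mod 8 = 3 \<Longrightarrow> u N = v N"
proof (induction "nat N" arbitrary: N rule: less_induct)
  case less
  show ?case
  proof (cases "N = 3")
    case False
    define M where "M = N + 1"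
    have M: "M mod 8 = 4" using less.prems unfolding M_def by presburger
    have "3 < N" using False less.prems by presburger
    define d where "d t = w t * (M - 4 * t\<^sup>2) * (u (M - t\<^sup>2) - v (M - t\<^sup>2))" for t
    have "(\<Sum>t \<in> odd_le M. d t) = 0"
      using u[OF M] v[OF M] by (simp add: d_def right_diff_distrib sum_subtractf)
    moreover have "(\<Sum>t \<in> odd_le M. d t) = (\<Sum>t \<in> {1, - 1}. d t)"
    proof (rule sum.mono_neutral_right)
      show "{1, - 1} \<subseteq> odd_le M" using \<open>3 < N\<close> by (simp add: odd_le_def M_def)
      show "\<forall>t \<in> odd_le M - {1, - 1}. d t = 0"
      proof
        fix t assume "t \<in> odd_le M - {1, - 1}"
        then have t: "odd t" "t\<^sup>2 \<le> M" "t \<noteq> 1" "t \<noteq> - 1" by (auto simp: odd_le_def)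
        have "t\<^sup>2 mod 8 = 1" using t by (intro odd_square_mod8)
        then have "(M - t\<^sup>2) mod 8 = 3" using M by presburger
        moreover have "t\<^sup>2 \<noteq> 1" using t by (simp add: power2_eq_1_iff)
        moreover have "0 < t\<^sup>2" using t by auto
        ultimately have "1 < t\<^sup>2" by linarith
        with \<open>(M - t\<^sup>2) mod 8 = 3\<close> have "u (M - t\<^sup>2) = v (M - t\<^sup>2)"
          using t \<open>3 < N\<close> by (intro less.hyps) (auto simp: M_def)
        then show "d t = 0" by (simp add: d_def)
      qed
    qed simp
    \<comment> \<open>t = 1 and t = -1 are the only terms not covered by induction. Their
      coefficient M - 4 vanishes just for M = 4, that is N = 3, hence the separate base
      value.\<close>
    ultimately have "2 * (M - 4) * (u N - v N) = 0" using w by (simp add: d_def M_def)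
    then show ?thesis using \<open>3 < N\<close> by (simp add: M_def)
  qed (simp add: base)
qed

section \<open>Solutions of a^2 + 3b^2 = M and Jacobi's series\<close>

definition hex_pairs :: "int \<Rightarrow> (int \<times> int) set" where
  "hex_pairs M = {(a, b). odd a \<and> odd b \<and> a\<^sup>2 + 3 * b\<^sup>2 = M}"

text \<open>The coefficient expected in (2 \<eta>(24\<tau>))^3. Jacobi's series has one term for
  each positive odd b; here b and -b both occur and contribute equally, so the factor 8 becomes
  4.\<close>

definition cm_coeff :: "int \<Rightarrow> int" where
  "cm_coeff N = 4 * (\<Sum>b \<in> {b. odd b \<and> 3 * b\<^sup>2 = N}. chi_minus_4 b * b)"

lemma finite_triple_square [simp]: "finite {b :: int. odd b \<and> 3 * b\<^sup>2 = N}"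
  by (rule finite_subset[OF _ finite_square_le[of N]]) auto

lemma sum_hex_pairs:
  "4 * (\<Sum>(a, b) \<in> hex_pairs M. g a * (chi_minus_4 b * b)) = (\<Sum>t \<in> odd_le M. g t * cm_coeff (M - t\<^sup>2))"
proof -
  have "a\<^sup>2 \<le> a\<^sup>2 + 3 * b\<^sup>2" for a b :: int by simp
  then have H: "hex_pairs M = Sigma (odd_le M) (\<lambda>t. {b. odd b \<and> 3 * b\<^sup>2 = M - t\<^sup>2})"
    by (auto simp: hex_pairs_def odd_le_def)
  show ?thesis
    unfolding H cm_coeff_def sum_distrib_left
    by (subst sum.Sigma[OF finite_odd_le ballI[OF finite_triple_square]])
       (auto simp: mult_ac intro!: sum.cong)
qed

text \<open>Of the three products of \<open>a + b \<surd>-3\<close> with cube roots of unity exactly two have odd coordinates; up to sign, they are swapped.\<close>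

definition hex_rotate :: "int \<times> int \<Rightarrow> int \<times> int" where
  "hex_rotate = (\<lambda>(a, b). if 4 dvd a - b then ((3 * b - a) div 2, (a + b) div 2)
     else ((a + 3 * b) div 2, (a - b) div 2))"

lemma hex_rotate_cases:
  assumes "odd a" "odd b"
  obtains k where "a = b + 4 * k" "hex_rotate (a, b) = (b - 2 * k, b + 2 * k)"
  | j where "a = b + 2 * j" "odd j" "hex_rotate (a, b) = (2 * b + j, j)"
proof (cases "4 dvd a - b")
  case True
  then obtain k where "a - b = 4 * k" ..
  then have k: "a = b + 4 * k" by simp
  show ?thesis by (rule that(1)[OF k]) (simp add: hex_rotate_def k)
next
  case False
  have "even (a - b)" using assms by simp
  then obtain j where "a - b = 2 * j" ..
  then have j: "a = b + 2 * j" by simp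
  have "odd j" using False unfolding j by presburger
  show ?thesis by (rule that(2)[OF j \<open>odd j\<close>]) (use False in \<open>simp add: hex_rotate_def j\<close>)
qed

text \<open>b(b^2 - a^2) is -1/3 times the coefficient of sqrt(-3) in the cube of a + b sqrt(-3), so
  \<open>hex_rotate\<close> can only change its sign. If 4 | a - b, this sign changes and
  \<open>chi_minus_3\<close> is preserved; otherwise it is the other way round. The product of the
  two values of \<open>chi_minus_4\<close> is the same before and after.\<close>

lemma hex_rotate:
  assumes "q \<in> hex_pairs M"
  shows "hex_rotate q \<in> hex_pairs M" "hex_rotate (hex_rotate q) = q"
    "(case hex_rotate q of (a, b) \<Rightarrow> chi_12 a * (b\<^sup>2 - a\<^sup>2) * (chi_minus_4 b * b)) =
     - (case q of (a, b) \<Rightarrow> chi_12 a * (b\<^sup>2 - a\<^sup>2) * (chi_minus_4 b * b))"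
proof -
  obtain a b where q: "q = (a, b)" by (cases q)
  have o: "odd a" "odd b" and e: "a\<^sup>2 + 3 * b\<^sup>2 = M" using assms by (auto simp: q hex_pairs_def)
  have "hex_rotate q \<in> hex_pairs M \<and> hex_rotate (hex_rotate q) = q \<and>
    (case hex_rotate q of (a, b) \<Rightarrow> chi_12 a * (b\<^sup>2 - a\<^sup>2) * (chi_minus_4 b * b)) =
     - (case q of (a, b) \<Rightarrow> chi_12 a * (b\<^sup>2 - a\<^sup>2) * (chi_minus_4 b * b))"
    using o
  proof (cases rule: hex_rotate_cases)
    case (1 k)
    have c: "chi_minus_4 a * chi_minus_4 b = 1" "chi_minus_4 (b - 2 * k) * chi_minus_4 (b + 2 * k) = 1"
      using o chi_minus_4_mult_odd[of a b] chi_minus_4_mult_odd[of "b - 2 * k" "b + 2 * k"]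
      by (simp_all add: 1(1))
    have "3 dvd (b - 2 * k) - a" by (simp add: 1(1))
    then have x: "chi_minus_3 (b - 2 * k) = chi_minus_3 a" by (rule chi_minus_3_cong)
    have "hex_rotate (b - 2 * k, b + 2 * k) = (a, b)"
      by (simp add: hex_rotate_def 1(1))
    moreover have "chi_12 (b - 2 * k) * ((b + 2 * k)\<^sup>2 - (b - 2 * k)\<^sup>2) * (chi_minus_4 (b + 2 * k) * (b + 2 * k)) =
      chi_minus_3 a * (chi_minus_4 (b - 2 * k) * chi_minus_4 (b + 2 * k)) * (8 * b * k * (b + 2 * k))"
      unfolding chi_12_def x by (simp add: power2_eq_square algebra_simps)
    moreover have "chi_12 a * (b\<^sup>2 - a\<^sup>2) * (chi_minus_4 b * b) =
      - (chi_minus_3 a * (chi_minus_4 a * chi_minus_4 b) * (8 * b * k * (b + 2 * k)))"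
    proof -
      have "b\<^sup>2 - a\<^sup>2 = - (8 * k * (b + 2 * k))" by (simp add: 1(1) power2_eq_square algebra_simps)
      then show ?thesis unfolding chi_12_def by (simp add: mult_ac)
    qed
    ultimately show ?thesis
      using o e unfolding q 1(2) c by (auto simp: hex_pairs_def 1(1) power2_eq_square algebra_simps)
  next
    case (2 j)
    have c: "chi_minus_4 a * chi_minus_4 b = - 1" "chi_minus_4 (2 * b + j) * chi_minus_4 j = - 1"
    proof -
      have "\<not> 4 dvd a - b" "\<not> 4 dvd 2 * b + j - j" using 2(1,2) o by presburger+
      then show "chi_minus_4 a * chi_minus_4 b = - 1" "chi_minus_4 (2 * b + j) * chi_minus_4 j = - 1"
        using o 2(2) chi_minus_4_mult_odd[of a b] chi_minus_4_mult_odd[of "2 * b + j" j] by simp_all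
    qed
    have "3 dvd (2 * b + j) - (- a)" by (simp add: 2(1))
    then have "chi_minus_3 (2 * b + j) = chi_minus_3 (- a)" by (rule chi_minus_3_cong)
    then have x: "chi_minus_3 (2 * b + j) = - chi_minus_3 a" by simp
    have "\<not> 4 dvd 2 * b + j - j" using o by presburger
    then have "hex_rotate (2 * b + j, j) = (a, b)"
      by (simp add: hex_rotate_def 2(1))
    moreover have "chi_12 (2 * b + j) * (j\<^sup>2 - (2 * b + j)\<^sup>2) * (chi_minus_4 j * j) =
      chi_minus_3 a * (chi_minus_4 (2 * b + j) * chi_minus_4 j) * (4 * b * (b + j) * j)"
      unfolding chi_12_def x by (simp add: power2_eq_square algebra_simps)
    moreover have "chi_12 a * (b\<^sup>2 - a\<^sup>2) * (chi_minus_4 b * b) =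
      - (chi_minus_3 a * (chi_minus_4 a * chi_minus_4 b) * (4 * b * (b + j) * j))"
    proof -
      have "b\<^sup>2 - a\<^sup>2 = - (4 * (b + j) * j)" by (simp add: 2(1) power2_eq_square algebra_simps)
      then show ?thesis unfolding chi_12_def by (simp add: mult_ac)
    qed
    ultimately show ?thesis
      using o e 2(2) unfolding q 2(3) c by (auto simp: hex_pairs_def 2(1) power2_eq_square algebra_simps)
  qed
  then show "hex_rotate q \<in> hex_pairs M" "hex_rotate (hex_rotate q) = q"
    "(case hex_rotate q of (a, b) \<Rightarrow> chi_12 a * (b\<^sup>2 - a\<^sup>2) * (chi_minus_4 b * b)) =
     - (case q of (a, b) \<Rightarrow> chi_12 a * (b\<^sup>2 - a\<^sup>2) * (chi_minus_4 b * b))" by blast+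
qed

text \<open>On a^2 + 3b^2 = M the factor M - 4a^2 is 3(b^2 - a^2), and \<open>hex_rotate\<close> is
  a sign-reversing involution of the resulting sum.\<close>

lemma cm_coeff_recursion:
  "(\<Sum>t \<in> odd_le M. chi_12 t * (M - 4 * t\<^sup>2) * cm_coeff (M - t\<^sup>2)) = 0"
proof -
  define F where "F = (\<lambda>(a, b). chi_12 a * (b\<^sup>2 - a\<^sup>2) * (chi_minus_4 b * b))"
  have "sum F (hex_pairs M) = (\<Sum>q \<in> hex_pairs M. - F q)"
    by (rule sum.reindex_bij_witness[where i = hex_rotate and j = hex_rotate])
       (use hex_rotate in \<open>simp_all add: F_def\<close>)
  then have "sum F (hex_pairs M) = 0" by (simp add: sum_negf)
  moreover have "(\<Sum>(a, b) \<in> hex_pairs M. (chi_12 a * (M - 4 * a\<^sup>2)) * (chi_minus_4 b * b)) = 3 * sum F (hex_pairs M)"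
    unfolding sum_distrib_left F_def
    by (rule sum.cong) (auto simp: hex_pairs_def algebra_simps)
  ultimately show ?thesis using sum_hex_pairs[of "\<lambda>t. chi_12 t * (M - 4 * t\<^sup>2)" M] by simp
qed

lemma square_eq_3_minus:
  fixes x y z :: int
  assumes "odd x" "odd y" "odd z" "x\<^sup>2 + y\<^sup>2 + z\<^sup>2 = 3"
  shows "x \<in> {1, - 1} \<and> y \<in> {1, - 1} \<and> z \<in> {1, - 1}"
proof -
  have "0 < x\<^sup>2" "0 < y\<^sup>2" "0 < z\<^sup>2" using assms by auto
  then have "x\<^sup>2 = 1" "y\<^sup>2 = 1" "z\<^sup>2 = 1" using assms(4) by linarith+
  then show ?thesis by (simp add: power2_eq_1_iff)
qed

lemma odd_squares3_3: "odd_squares3 3 = {1, - 1} \<times> {1, - 1} \<times> {1, - 1}"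
proof (intro equalityI subsetI)
  fix q assume "q \<in> odd_squares3 3"
  moreover obtain x y z where "q = (x, y, z)" by (cases q)
  ultimately show "q \<in> {1, - 1} \<times> {1, - 1} \<times> {1, - 1}"
    using square_eq_3_minus[of x y z] unfolding odd_squares3_def by blast
qed (auto simp: odd_squares3_def)

lemma chi_12_units: "chi_12 1 = 1" "chi_12 (- 1) = 1"
  by (simp_all add: chi_12_def chi_minus_3_def chi_minus_4_def)

text \<open>Jacobi's formula for \<open>\<eta>\<^sup>3\<close>, since \<open>2 \<eta>(24\<tau>) = \<Sum>\<^sub>t chi_12(t) q\<^bsup>t\<^sup>2\<^esup>\<close>.\<close>

theorem cube_chi_12:
  assumes "0 \<le> N" "N mod 8 = 3"
  shows "cube_coeff chi_12 N = cm_coeff N"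
proof (rule cube_recursion_unique[OF chi_12_units _ cube_coeff_recursion cm_coeff_recursion assms])
  have "{b :: int. odd b \<and> 3 * b\<^sup>2 = 3} = {1, - 1}" by (auto simp: power2_eq_1_iff)
  then have "cm_coeff 3 = 8" by (simp add: cm_coeff_def chi_minus_4_def)
  moreover have "cube_coeff chi_12 3 = 8"
    unfolding cube_coeff_def odd_squares3_3 by (simp add: sum.cartesian_product[symmetric] chi_12_units)
  ultimately show "cube_coeff chi_12 3 = cm_coeff 3" by simp
qed

section \<open>Four odd squares\<close>

definition trace_3 :: "int \<Rightarrow> int" where
  "trace_3 k = (if 3 dvd k then 2 else - 1)"

definition sign_4 :: "int \<Rightarrow> int" where
  "sign_4 k = (if 4 dvd k then 1 else - 1)"

text \<open>
  \<open>trace_3\<close> and \<open>chi_minus_3\<close> are \<open>2 cos\<close> and \<open>2 / \<surd>3 sin\<close> of \<open>2 \<pi> k / 3\<close>.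
\<close>

lemma addition_formulas_mod3:
  "trace_3 (a + b) + trace_3 (a - b) = trace_3 a * trace_3 b"
  "trace_3 (a + b) - trace_3 (a - b) = - 3 * chi_minus_3 a * chi_minus_3 b"
  "chi_minus_3 (a + b) - chi_minus_3 (a - b) = trace_3 a * chi_minus_3 b"
proof -
  have m: "(a + b) mod 3 = (a mod 3 + b mod 3) mod 3" "(a - b) mod 3 = (a mod 3 - b mod 3) mod 3"
    by (simp_all add: mod_add_eq mod_diff_eq)
  have *: "trace_3 (a + b) + trace_3 (a - b) = trace_3 a * trace_3 b \<and>
    trace_3 (a + b) - trace_3 (a - b) = - 3 * chi_minus_3 a * chi_minus_3 b \<and>
    chi_minus_3 (a + b) - chi_minus_3 (a - b) = trace_3 a * chi_minus_3 b"
    unfolding trace_3_def chi_minus_3_def dvd_eq_mod_eq_0 m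
    using mod3_cases[of a] mod3_cases[of b] by (elim disjE; simp)
  show "trace_3 (a + b) + trace_3 (a - b) = trace_3 a * trace_3 b"
    "trace_3 (a + b) - trace_3 (a - b) = - 3 * chi_minus_3 a * chi_minus_3 b"
    "chi_minus_3 (a + b) - chi_minus_3 (a - b) = trace_3 a * chi_minus_3 b" using * by blast+
qed

text \<open>Makes the sign multiplicative in the coordinates, so that it flips with each of
  them.\<close>

lemma sign_4_sum:
  assumes "odd t" "odd x" "odd y" "odd z"
  shows "sign_4 (t + x + y + z) = chi_minus_4 t * chi_minus_4 x * chi_minus_4 y * chi_minus_4 z"
proof -
  have "chi_minus_4 t * chi_minus_4 x * (chi_minus_4 y * chi_minus_4 z) = sign_4 (t + x + y + z)"
  proof -
    have "4 dvd t - x \<and> 4 dvd y - z \<or> \<not> 4 dvd t - x \<and> \<not> 4 dvd y - z \<longleftrightarrow> 4 dvd t + x + y + z"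
      using assms by presburger
    then show ?thesis using assms by (auto simp: chi_minus_4_mult_odd sign_4_def)
  qed
  then show ?thesis by (simp add: mult.assoc)
qed

lemma odd_squares4_flip:
  "(\<Sum>(t, x, y, z) \<in> odd_squares4 M. g t (- x) y z) = (\<Sum>(t, x, y, z) \<in> odd_squares4 M. g t x y z)"
  "(\<Sum>(t, x, y, z) \<in> odd_squares4 M. g t x (- y) z) = (\<Sum>(t, x, y, z) \<in> odd_squares4 M. g t x y z)"
  "(\<Sum>(t, x, y, z) \<in> odd_squares4 M. g t x y (- z)) = (\<Sum>(t, x, y, z) \<in> odd_squares4 M. g t x y z)"
proof -
  show "(\<Sum>(t, x, y, z) \<in> odd_squares4 M. g t (- x) y z) = (\<Sum>(t, x, y, z) \<in> odd_squares4 M. g t x y z)"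
    by (rule sum_reindex_involution[where h = "\<lambda>(t, x, y, z). (t, - x, y, z)"]) (auto simp: odd_squares4_def)
  show "(\<Sum>(t, x, y, z) \<in> odd_squares4 M. g t x (- y) z) = (\<Sum>(t, x, y, z) \<in> odd_squares4 M. g t x y z)"
    by (rule sum_reindex_involution[where h = "\<lambda>(t, x, y, z). (t, x, - y, z)"]) (auto simp: odd_squares4_def)
  show "(\<Sum>(t, x, y, z) \<in> odd_squares4 M. g t x y (- z)) = (\<Sum>(t, x, y, z) \<in> odd_squares4 M. g t x y z)"
    by (rule sum_reindex_involution[where h = "\<lambda>(t, x, y, z). (t, x, y, - z)"]) (auto simp: odd_squares4_def)
qed

lemma odd_squares4_flip_average:
  fixes g :: "int \<Rightarrow> int \<Rightarrow> int \<Rightarrow> int \<Rightarrow> int"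
  shows "8 * (\<Sum>(t, x, y, z) \<in> odd_squares4 M. g t x y z) =
    (\<Sum>(t, x, y, z) \<in> odd_squares4 M.
       g t x y z + g t x y (- z) + (g t x (- y) z + g t x (- y) (- z)) +
       (g t (- x) y z + g t (- x) y (- z) + (g t (- x) (- y) z + g t (- x) (- y) (- z))))"
proof -
  define S where "S h = (\<Sum>(t, x, y, z) \<in> odd_squares4 M. h t x y z)" for h :: "int \<Rightarrow> int \<Rightarrow> int \<Rightarrow> int \<Rightarrow> int"
  have add: "S (\<lambda>t x y z. h t x y z + h' t x y z) = S h + S h'" for h h'
    unfolding S_def sum.distrib[symmetric] by (rule sum.cong) auto
  have f: "S (\<lambda>t x y z. h t (- x) y z) = S h" "S (\<lambda>t x y z. h t x (- y) z) = S h"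
    "S (\<lambda>t x y z. h t x y (- z)) = S h" for h
    unfolding S_def by (rule odd_squares4_flip)+
  have "S (\<lambda>t x y z. g t x (- y) (- z)) = S g"
    using f(2)[of "\<lambda>t x y z. g t x y (- z)"] f(3)[of g] by simp
  moreover have "S (\<lambda>t x y z. g t (- x) y (- z)) = S g"
    using f(1)[of "\<lambda>t x y z. g t x y (- z)"] f(3)[of g] by simp
  moreover have "S (\<lambda>t x y z. g t (- x) (- y) z) = S g"
    using f(1)[of "\<lambda>t x y z. g t x (- y) z"] f(2)[of g] by simp
  moreover have "S (\<lambda>t x y z. g t (- x) (- y) (- z)) = S g"
    using f(1)[of "\<lambda>t x y z. g t x (- y) (- z)"] calculation(1) by simp
  ultimately have "S (\<lambda>t x y z. g t x y z + g t x y (- z) + (g t x (- y) z + g t x (- y) (- z)) +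
       (g t (- x) y z + g t (- x) y (- z) + (g t (- x) (- y) z + g t (- x) (- y) (- z)))) = 8 * S g"
    by (simp add: add f)
  then show ?thesis by (simp add: S_def)
qed

text \<open>
  Riemann's relation \<open>\<theta>\<^sub>2(2z) \<theta>\<^sub>2(0)\<^sup>3 = \<theta>\<^sub>2(z)\<^sup>4 - \<theta>\<^sub>1(z)\<^sup>4\<close> at a third of a period.
\<close>

lemma half_hadamard:
  "(\<Sum>(t, x, y, z) \<in> odd_squares4 M. (1 - sign_4 (t + x + y + z)) * trace_3 (t + x + y + z)) =
   (\<Sum>(t, x, y, z) \<in> odd_squares4 M. trace_3 t)"
proof -
  define A where "A = {(t, x, y, z) \<in> odd_squares4 M. \<not> 4 dvd t + x + y + z}"
  define B where "B = {(t, x, y, z) \<in> odd_squares4 M. 4 dvd t + x + y + z}"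
  have fin: "finite A" "finite B"
    by (rule finite_subset[OF _ finite_odd_squares4[of M]]; auto simp: A_def B_def)+
  have dis: "odd_squares4 M = A \<union> B" "A \<inter> B = {}" by (auto simp: A_def B_def)
  have split: "sum g (odd_squares4 M) = sum g A + sum g B" for g :: "int \<times> int \<times> int \<times> int \<Rightarrow> int"
    unfolding dis(1) by (rule sum.union_disjoint[OF fin dis(2)])
  \<comment> \<open>2 is -1 modulo 3 and \<open>trace_3\<close> is even.\<close>
  have double: "trace_3 (2 * k) = trace_3 k" for k
    by (simp add: trace_3_def) presburger
  have "(\<Sum>(t, x, y, z) \<in> A. (1 - sign_4 (t + x + y + z)) * trace_3 (t + x + y + z)) =
        (\<Sum>(t, x, y, z) \<in> A. 2 * trace_3 (t + x + y + z))"
    by (rule sum.cong) (auto simp: A_def sign_4_def)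
  moreover have "(\<Sum>(t, x, y, z) \<in> B. (1 - sign_4 (t + x + y + z)) * trace_3 (t + x + y + z)) = 0"
    by (rule sum.neutral) (auto simp: B_def sign_4_def)
  moreover have "(\<Sum>(t, x, y, z) \<in> A. 2 * trace_3 (t + x + y + z)) = (\<Sum>(t, x, y, z) \<in> A. 2 * trace_3 t)"
  proof -
    \<comment> \<open>Half a Hadamard matrix of order 4: symmetric and orthogonal, so it is an
      involution that preserves the sum of squares. Its values have odd coordinates precisely on
      \<open>A\<close>, where half the coordinate sum is odd.\<close>
    define h :: "int \<times> int \<times> int \<times> int \<Rightarrow> int \<times> int \<times> int \<times> int"
      where "h = (\<lambda>(t, x, y, z). ((t + x + y + z) div 2, (t + x - y - z) div 2,
        (t - x + y - z) div 2, (t - x - y + z) div 2))"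
    have h: "h q \<in> A \<and> h (h q) = q \<and> 2 * fst (h q) = (case q of (t, x, y, z) \<Rightarrow> t + x + y + z)"
      if q: "q \<in> A" for q
    proof -
      obtain t x y z where qq: "q = (t, x, y, z)" by (cases q)
      have o: "odd t" "odd x" "odd y" "odd z" and e: "t\<^sup>2 + x\<^sup>2 + y\<^sup>2 + z\<^sup>2 = M" and n4: "\<not> 4 dvd t + x + y + z"
        using q by (auto simp: qq A_def odd_squares4_def)
      have "even (t + x + y + z)" using o by simp
      then obtain m where m: "t + x + y + z = 2 * m" ..
      have "odd m" using n4 unfolding m by presburger
      have t: "t = 2 * m - x - y - z" using m by simp
      have "(2 * m - 2 * y - 2 * z) div 2 = m - y - z" "(2 * m - 2 * x - 2 * z) div 2 = m - x - z"
        "(2 * m - 2 * x - 2 * y) div 2 = m - x - y" by presburger+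
      then have hq: "h q = (m, m - y - z, m - x - z, m - x - y)" by (simp add: qq h_def t)
      have "m + (m - y - z) + (m - x - z) + (m - x - y) = 2 * t" by (simp add: t)
      moreover have "\<not> 4 dvd 2 * t" using o(1) by presburger
      moreover have "m\<^sup>2 + (m - y - z)\<^sup>2 + (m - x - z)\<^sup>2 + (m - x - y)\<^sup>2 = M"
        unfolding e[symmetric] t by (simp add: power2_eq_square algebra_simps)
      ultimately have "h q \<in> A" unfolding hq A_def odd_squares4_def using o \<open>odd m\<close> by simp
      moreover have "h (h q) = q" unfolding hq by (simp add: qq h_def t)
      moreover have "2 * fst (h q) = (case q of (t, x, y, z) \<Rightarrow> t + x + y + z)"
        using m unfolding hq by (simp add: qq)
      ultimately show ?thesis by blast
    qed
    show ?thesis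
    proof (rule sum.reindex_bij_witness[where i = h and j = h])
      fix q assume "q \<in> A"
      then show "(case h q of (t, x, y, z) \<Rightarrow> 2 * trace_3 t) = (case q of (t, x, y, z) \<Rightarrow> 2 * trace_3 (t + x + y + z))"
        using h[of q] double[of "fst (h q)"] by (simp add: case_prod_unfold)
    qed (use h in blast)+
  qed
  \<comment> \<open>Changing the sign of an odd \<open>z\<close> changes the sum of the coordinates
    by 2 modulo 4. So twice the sum over \<open>A\<close> is the sum over everything.\<close>
  moreover have "(\<Sum>(t, x, y, z) \<in> A. trace_3 t) = (\<Sum>(t, x, y, z) \<in> B. trace_3 t)"
  proof (rule sum.reindex_bij_witness[where i = "\<lambda>(t, x, y, z). (t, x, y, - z)" and j = "\<lambda>(t, x, y, z). (t, x, y, - z)"])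
    have "4 dvd t + x + y - z \<longleftrightarrow> \<not> 4 dvd t + x + y + z" if "odd t" "odd x" "odd y" "odd z" for t x y z :: int
      using that by presburger
    then show "\<And>q. q \<in> A \<Longrightarrow> (case q of (t, x, y, z) \<Rightarrow> (t, x, y, - z)) \<in> B"
      "\<And>q. q \<in> B \<Longrightarrow> (case q of (t, x, y, z) \<Rightarrow> (t, x, y, - z)) \<in> A"
      by (auto simp: A_def B_def odd_squares4_def)
  qed auto
  ultimately show ?thesis
    unfolding split by (simp add: sum_distrib_left[symmetric] case_prod_unfold)
qed

lemma square_mod3: "\<exists>j. (k :: int)\<^sup>2 = 3 * j + (1 - (if 3 dvd k then 1 else 0))"
proof -
  have "k\<^sup>2 mod 3 = ((k mod 3) * (k mod 3)) mod 3" by (simp add: power2_eq_square mod_mult_eq)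
  then have "k\<^sup>2 mod 3 = 1 - (if 3 dvd k then 1 else 0)"
    unfolding dvd_eq_mod_eq_0 using mod3_cases[of k] by (elim disjE) simp_all
  then show ?thesis by (metis mult_div_mod_eq)
qed

text \<open>Riemann's relation averaged over sign changes compares the product of the values of
  \<open>trace_3\<close>, the product of the values of \<open>chi_12\<close>, and the sum of
  \<open>trace_3 t\<close>. As 4n is 1 modulo 3, the number D of coordinates divisible by 3 is 0 or
  3. In both cases the product of the \<open>trace_3\<close> minus twice their sum is 9(1 -
  D).\<close>

theorem sum_chi_12_odd_squares4:
  assumes "n mod 3 = 1"
  shows "(\<Sum>(t, x, y, z) \<in> odd_squares4 (4 * n). chi_12 t * (chi_12 x * chi_12 y * chi_12 z)) =
    int (card (odd_squares4 (4 * n))) - 4 * (\<Sum>(t, x, y, z) \<in> odd_squares4 (4 * n). if 3 dvd t then 1 else 0)"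
proof -
  define Z where "Z = odd_squares4 (4 * n)"
  define d where "d k = (if 3 dvd k then 1 else 0 :: int)" for k :: int
  let ?X = "\<lambda>t x y z. chi_12 t * (chi_12 x * chi_12 y * chi_12 z)"
  let ?T = "\<lambda>t x y z. trace_3 t * trace_3 x * trace_3 y * trace_3 z"
  have "8 * (\<Sum>(t, x, y, z) \<in> Z. trace_3 t) =
    8 * (\<Sum>(t, x, y, z) \<in> Z. (1 - sign_4 (t + x + y + z)) * trace_3 (t + x + y + z))"
    unfolding Z_def half_hadamard ..
  also have "\<dots> = (\<Sum>(t, x, y, z) \<in> Z. ?T t x y z - 9 * ?X t x y z)"
    unfolding Z_def odd_squares4_flip_average[of "\<lambda>t x y z. (1 - sign_4 (t + x + y + z)) * trace_3 (t + x + y + z)"]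
  proof (rule sum.cong, goal_cases)
    case (2 q)
    obtain t x y z where q: "q = (t, x, y, z)" by (cases q)
    have o: "odd t" "odd x" "odd y" "odd z" using 2 by (auto simp: q odd_squares4_def)
    define f where "f = chi_minus_4 t * chi_minus_4 x * chi_minus_4 y * chi_minus_4 z"
    \<comment> \<open>The part of the average without \<open>sign_4\<close> adds the eight terms, a
      product of cosines; the alternating sign turns the other part into a product of sines, and
      \<open>f\<close> completes \<open>chi_minus_3\<close> to \<open>chi_12\<close>.\<close>
    have s: "sign_4 (t + x + y + z) = f" "sign_4 (t + x + y + - z) = - f"
      "sign_4 (t + x + - y + z) = - f" "sign_4 (t + x + - y + - z) = f"
      "sign_4 (t + - x + y + z) = - f" "sign_4 (t + - x + y + - z) = f"
      "sign_4 (t + - x + - y + z) = f" "sign_4 (t + - x + - y + - z) = - f"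
      using o by (simp_all only: sign_4_sum f_def even_minus chi_minus_4_uminus mult_minus_left mult_minus_right minus_minus simp_thms)
    note a = addition_formulas_mod3
    have even: "trace_3 (t + x + y + z) + trace_3 (t + x + y - z) + (trace_3 (t + x - y + z) + trace_3 (t + x - y - z)) +
       (trace_3 (t - x + y + z) + trace_3 (t - x + y - z) + (trace_3 (t - x - y + z) + trace_3 (t - x - y - z))) =
       ?T t x y z"
      unfolding a(1) distrib_right[symmetric] ..
    have "trace_3 (t + x + y + z) - trace_3 (t + x + y - z) - (trace_3 (t + x - y + z) - trace_3 (t + x - y - z)) -
       (trace_3 (t - x + y + z) - trace_3 (t - x + y - z) - (trace_3 (t - x - y + z) - trace_3 (t - x - y - z))) =
       - 3 * ((chi_minus_3 (t + x + y) - chi_minus_3 (t + x - y)) - (chi_minus_3 (t - x + y) - chi_minus_3 (t - x - y))) * chi_minus_3 z" (is "?O = _")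
      unfolding a(2) by (simp add: algebra_simps)
    also have "\<dots> = - 3 * (trace_3 (t + x) - trace_3 (t - x)) * chi_minus_3 y * chi_minus_3 z"
      unfolding a(3) by (simp add: algebra_simps)
    also have "\<dots> = 9 * chi_minus_3 t * chi_minus_3 x * chi_minus_3 y * chi_minus_3 z"
      unfolding a(2) by simp
    finally have odd: "?O =
       9 * chi_minus_3 t * chi_minus_3 x * chi_minus_3 y * chi_minus_3 z" .
    have "9 * ?X t x y z = f * (9 * chi_minus_3 t * chi_minus_3 x * chi_minus_3 y * chi_minus_3 z)"
      by (simp add: f_def chi_12_def mult_ac)
    then show ?case unfolding q prod.case s even[symmetric] odd[symmetric] by (simp add: algebra_simps)
  qed simp
  also have "\<dots> = (\<Sum>(t, x, y, z) \<in> Z. ?T t x y z) - 9 * (\<Sum>(t, x, y, z) \<in> Z. ?X t x y z)"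
    unfolding sum_distrib_left sum_subtractf[symmetric] by (rule sum.cong) auto
  finally have main: "9 * (\<Sum>(t, x, y, z) \<in> Z. ?X t x y z) =
     (\<Sum>(t, x, y, z) \<in> Z. ?T t x y z) - 8 * (\<Sum>(t, x, y, z) \<in> Z. trace_3 t)" by simp
  have "4 * (\<Sum>(t, x, y, z) \<in> Z. 1 * trace_3 t) = (\<Sum>(t, x, y, z) \<in> Z. 1 * (trace_3 t + trace_3 x + trace_3 y + trace_3 z))"
    unfolding Z_def by (rule odd_squares4_symmetrize[symmetric]) simp_all
  then have tr: "8 * (\<Sum>(t, x, y, z) \<in> Z. trace_3 t) = 2 * (\<Sum>(t, x, y, z) \<in> Z. trace_3 t + trace_3 x + trace_3 y + trace_3 z)"
    by simp
  have "4 * (\<Sum>(t, x, y, z) \<in> Z. 1 * d t) = (\<Sum>(t, x, y, z) \<in> Z. 1 * (d t + d x + d y + d z))"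
    unfolding Z_def by (rule odd_squares4_symmetrize[symmetric]) simp_all
  then have dd: "4 * (\<Sum>(t, x, y, z) \<in> Z. d t) = (\<Sum>(t, x, y, z) \<in> Z. d t + d x + d y + d z)"
    by simp
  have "9 * (\<Sum>(t, x, y, z) \<in> Z. ?X t x y z) = (\<Sum>(t, x, y, z) \<in> Z. ?T t x y z - 2 * (trace_3 t + trace_3 x + trace_3 y + trace_3 z))"
  proof -
    have "(\<Sum>(t, x, y, z) \<in> Z. ?T t x y z - 2 * (trace_3 t + trace_3 x + trace_3 y + trace_3 z)) =
      (\<Sum>(t, x, y, z) \<in> Z. ?T t x y z) - 2 * (\<Sum>(t, x, y, z) \<in> Z. trace_3 t + trace_3 x + trace_3 y + trace_3 z)"
      unfolding sum_distrib_left sum_subtractf[symmetric] by (rule sum.cong) auto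
    then show ?thesis using main tr by linarith
  qed
  also have "\<dots> = (\<Sum>(t, x, y, z) \<in> Z. 9 * (1 - (d t + d x + d y + d z)))"
  proof (rule sum.cong, goal_cases)
    case (2 q)
    obtain t x y z where q: "q = (t, x, y, z)" by (cases q)
    have e: "t\<^sup>2 + x\<^sup>2 + y\<^sup>2 + z\<^sup>2 = 4 * n" using 2 by (auto simp: q Z_def odd_squares4_def)
    obtain j1 j2 j3 j4 where j: "t\<^sup>2 = 3 * j1 + (1 - d t)" "x\<^sup>2 = 3 * j2 + (1 - d x)" "y\<^sup>2 = 3 * j3 + (1 - d y)"
      "z\<^sup>2 = 3 * j4 + (1 - d z)" unfolding d_def using square_mod3 by metis
    have "(4 - (d t + d x + d y + d z)) mod 3 = 1"
      using e assms unfolding j by presburger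
    then show ?case unfolding q trace_3_def d_def
      by (cases "3 dvd t"; cases "3 dvd x"; cases "3 dvd y"; cases "3 dvd z") simp_all
  qed simp
  also have "\<dots> = 9 * (int (card Z) - 4 * (\<Sum>(t, x, y, z) \<in> Z. d t))"
  proof -
    have "(\<Sum>(t, x, y, z) \<in> Z. 9 * (1 - (d t + d x + d y + d z))) =
      9 * (\<Sum>q \<in> Z. 1) - 9 * (\<Sum>(t, x, y, z) \<in> Z. d t + d x + d y + d z)"
      unfolding sum_distrib_left sum_subtractf[symmetric] by (rule sum.cong) auto
    then show ?thesis unfolding dd[symmetric] by simp
  qed
  finally show ?thesis by (simp add: Z_def d_def)
qed

text \<open>Two representations of p compose in two ways to p^2 = j^2 + 3k^2, and p divides k for
  one of them. Then k = 0, since otherwise 3k^2 > p^2.\<close>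

lemma prime_x2_3y2_unique:
  fixes p x y u v :: int
  assumes p: "prime p" and xy: "p = x\<^sup>2 + 3 * y\<^sup>2" and uv: "p = u\<^sup>2 + 3 * v\<^sup>2"
  shows "(u = x \<or> u = - x) \<and> (v = y \<or> v = - y)"
proof -
  have "0 < p" using p by (simp add: prime_gt_0_int)
  have zero: "k = 0" if pk: "p dvd k" and jk: "p\<^sup>2 = j\<^sup>2 + 3 * k\<^sup>2" for j k
  proof (rule ccontr)
    assume "k \<noteq> 0"
    obtain i where i: "k = p * i" using pk by (rule dvdE)
    with \<open>k \<noteq> 0\<close> have "i \<noteq> 0" by auto
    then have "1 \<le> i\<^sup>2" by (simp add: int_one_le_iff_zero_less)
    then have "p\<^sup>2 * 1 \<le> p\<^sup>2 * i\<^sup>2" by (intro mult_left_mono) auto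
    then have "p\<^sup>2 \<le> k\<^sup>2" unfolding i by (simp add: power_mult_distrib)
    moreover have "0 < p\<^sup>2" using \<open>0 < p\<close> by simp
    ultimately show False using jk zero_le_power2[of j] by linarith
  qed
  have "(x * v - u * y) * (x * v + u * y) = p * (v\<^sup>2 - y\<^sup>2)"
  proof -
    have "(x * v - u * y) * (x * v + u * y) = (x\<^sup>2 + 3 * y\<^sup>2) * v\<^sup>2 - (u\<^sup>2 + 3 * v\<^sup>2) * y\<^sup>2"
      by (simp add: power2_eq_square algebra_simps)
    then show ?thesis unfolding xy[symmetric] uv[symmetric] by (simp add: algebra_simps)
  qed
  then have "p dvd (x * v - u * y) * (x * v + u * y)" by simp
  then have "p dvd x * v - u * y \<or> p dvd x * v + u * y" using p by (simp add: prime_dvd_mult_iff)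
  moreover have "p\<^sup>2 = (x * u + 3 * y * v)\<^sup>2 + 3 * (x * v - u * y)\<^sup>2" "p\<^sup>2 = (x * u - 3 * y * v)\<^sup>2 + 3 * (x * v + u * y)\<^sup>2"
  proof -
    have "p\<^sup>2 = (x\<^sup>2 + 3 * y\<^sup>2) * (u\<^sup>2 + 3 * v\<^sup>2)" unfolding xy[symmetric] uv[symmetric] by (simp add: power2_eq_square)
    then show "p\<^sup>2 = (x * u + 3 * y * v)\<^sup>2 + 3 * (x * v - u * y)\<^sup>2" "p\<^sup>2 = (x * u - 3 * y * v)\<^sup>2 + 3 * (x * v + u * y)\<^sup>2"
      by (simp_all add: power2_eq_square algebra_simps)
  qed
  ultimately have "x * v - u * y = 0 \<or> x * v + u * y = 0" using zero by blast
  then have "p * (v\<^sup>2 - y\<^sup>2) = 0"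
    using \<open>(x * v - u * y) * (x * v + u * y) = p * (v\<^sup>2 - y\<^sup>2)\<close> by auto
  then have "v\<^sup>2 = y\<^sup>2" using \<open>0 < p\<close> by simp
  moreover from this have "u\<^sup>2 = x\<^sup>2" using xy uv by simp
  ultimately show ?thesis by (simp add: power2_eq_iff)
qed

text \<open>Multiplying u - v sqrt(-3) by 1 + sqrt(-3) gives (u + 3v) + (u - v) sqrt(-3), and all
  odd solutions for 4p arise so, up to the sign of b. The contributions of v cancel between (u, v)
  and (u, -v), and \<open>chi_minus_3 u * u\<close> does not depend on the sign of u, whence eight
  equal terms.\<close>

theorem sum_hex_pairs_prime:
  fixes p x y :: int
  assumes p: "prime p" "5 \<le> p" and xy: "p = x\<^sup>2 + 3 * y\<^sup>2"
  shows "(\<Sum>(a, b) \<in> hex_pairs (4 * p). chi_12 a * (chi_minus_4 b * b)) = 8 * (chi_minus_3 x * x)"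
proof -
  define R where "R = {(u, v). u\<^sup>2 + 3 * v\<^sup>2 = p}"
  have "odd p" using p prime_odd_int[of p] by simp
  have x0: "x \<noteq> 0"
  proof
    assume "x = 0"
    then have "3 dvd p" using xy by simp
    moreover have "\<forall>m. 0 \<le> m \<and> m dvd p \<longrightarrow> m = 1 \<or> m = p" using p(1) by (simp add: prime_int_iff)
    from this[rule_format, of 3] have "\<not> 3 dvd p" using p(2) by auto
    ultimately show False by blast
  qed
  have y0: "y \<noteq> 0"
  proof
    assume "y = 0"
    then have "p = \<bar>x\<bar> * \<bar>x\<bar>" using xy by (simp add: power2_eq_square)
    moreover from this have "\<bar>x\<bar> = 1 \<or> \<bar>x\<bar> = p" using p(1) by (metis abs_ge_zero dvd_triv_left prime_int_iff)
    ultimately obtain k where "p = k * k" "k = 1 \<or> k = p" by blast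
    then show False using p(2) by auto
  qed
  have R_odd: "odd (u + v)" if "(u, v) \<in> R" for u v
  proof
    assume "even (u + v)"
    then have "even (u\<^sup>2 + 3 * v\<^sup>2)" by auto
    moreover have e: "u\<^sup>2 + 3 * v\<^sup>2 = p" using that by (simp add: R_def)
    ultimately show False using \<open>odd p\<close> unfolding e by blast
  qed
  have R: "R = {(x, y), (x, - y), (- x, y), (- x, - y)}"
  proof (intro equalityI subsetI)
    fix q assume "q \<in> R"
    then obtain u v where q: "q = (u, v)" "p = u\<^sup>2 + 3 * v\<^sup>2" by (auto simp: R_def)
    show "q \<in> {(x, y), (x, - y), (- x, y), (- x, - y)}"
      using prime_x2_3y2_unique[OF p(1) xy q(2)] unfolding q(1) by blast
  qed (use xy in \<open>auto simp: R_def\<close>)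
  have "(\<Sum>(a, b) \<in> hex_pairs (4 * p). chi_12 a * (chi_minus_4 b * b)) =
    (\<Sum>((u, v), s) \<in> R \<times> {1, - 1 :: int}. chi_minus_3 u * (u - v))"
  proof (rule sum_reindex_onto[where h = "\<lambda>((u, v), s). (u + 3 * v, s * (u - v))"], goal_cases)
    case (1 q)
    then obtain u v s where q: "q = ((u, v), s)" "u\<^sup>2 + 3 * v\<^sup>2 = p" "s = 1 \<or> s = - 1" by (auto simp: R_def)
    then have "odd (u + v)" by (intro R_odd) (simp add: R_def)
    moreover have "(u + 3 * v)\<^sup>2 + 3 * (u - v)\<^sup>2 = 4 * p"
      unfolding q(2)[symmetric] by (simp add: power2_eq_square algebra_simps)
    ultimately show ?case using q(3) unfolding q(1) by (auto simp: hex_pairs_def power2_commute)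
  next
    case (2 q)
    then obtain a b where q: "q = (a, b)" "odd a" "odd b" "a\<^sup>2 + 3 * b\<^sup>2 = 4 * p" by (auto simp: hex_pairs_def)
    \<comment> \<open>The sign \<open>s\<close> is chosen so that division by 1 + sqrt(-3) is
      possible.\<close>
    have "4 dvd a - b \<or> 4 dvd a - (- b)" using q(2,3) by presburger
    then have "4 dvd a - 1 * b \<or> 4 dvd a - (- 1) * b" by simp
    then obtain s where s: "s = 1 \<or> s = - 1" "4 dvd a - s * b" by blast
    then obtain v where v: "a - s * b = 4 * v" by auto
    have ss: "s * s = 1" using s by auto
    define u where "u = s * b + v"
    have "a = u + 3 * v" "b = s * (u - v)" using v ss by (simp_all add: u_def algebra_simps mult.assoc[symmetric])
    moreover have "(u, v) \<in> R"
    proof -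
      have "4 * p = (u + 3 * v)\<^sup>2 + 3 * (s * s) * (u - v)\<^sup>2"
        using q(4) unfolding \<open>a = u + 3 * v\<close> \<open>b = s * (u - v)\<close> by (simp add: power2_eq_square mult_ac)
      then have "4 * p = 4 * (u\<^sup>2 + 3 * v\<^sup>2)" unfolding ss by (simp add: power2_eq_square algebra_simps)
      then show ?thesis by (simp add: R_def)
    qed
    ultimately show ?case using s unfolding q(1) by (intro bexI[of _ "((u, v), s)"]) auto
  next
    case 3
    show ?case
    proof (rule inj_onI)
      fix q q' assume mem: "q \<in> R \<times> {1, - 1}" "q' \<in> R \<times> {1, - 1 :: int}"
        and eq: "(\<lambda>((u, v), s). (u + 3 * v, s * (u - v))) q = (\<lambda>((u, v), s). (u + 3 * v, s * (u - v))) q'"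
      obtain u v s where q1: "q = ((u, v), s)" by (metis surj_pair)
      obtain u' v' s' where q2: "q' = ((u', v'), s')" by (metis surj_pair)
      note q = q1 q2
      have R: "(u, v) \<in> R" "(u', v') \<in> R" and s: "s = 1 \<or> s = - 1" "s' = 1 \<or> s' = - 1"
        using mem unfolding q by simp_all
      have e: "u + 3 * v = u' + 3 * v'" "s * (u - v) = s' * (u' - v')" using eq unfolding q by simp_all
      have "s = s'"
      proof (rule ccontr)
        assume "s \<noteq> s'"
        then have "s' = - s" "s \<noteq> 0" using s by auto
        then have "u' - v' = - (u - v)" using e(2) s(1) unfolding \<open>s' = - s\<close> by (elim disjE) simp_all
        then have "u - v = 2 * (v' - v)" using e(1) by presburger
        then show False using R_odd[OF R(1)] by presburger
      qed
      moreover from this have "u - v = u' - v'" using e(2) s by auto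
      then have "v = v'" "u = u'" using e(1) by presburger+
      ultimately show "q = q'" unfolding q by simp
    qed
  next
    case (4 q)
    then obtain u v s where q: "q = ((u, v), s)" "(u, v) \<in> R" "s = 1 \<or> s = - 1" by auto
    have "3 dvd u + 3 * v - u" by simp
    then have c3: "chi_minus_3 (u + 3 * v) = chi_minus_3 u" by (rule chi_minus_3_cong)
    have 1: "chi_minus_4 (u + 3 * v) * chi_minus_4 (u - v) = 1"
      using R_odd[OF q(2)] by (subst chi_minus_4_mult_odd) auto
    have 2: "chi_minus_4 (s * (u - v)) * (s * (u - v)) = chi_minus_4 (u - v) * (u - v)"
      using q(3) chi_minus_4_uminus[of "u - v"] by auto
    have "chi_12 (u + 3 * v) * (chi_minus_4 (s * (u - v)) * (s * (u - v))) =
        chi_minus_3 u * ((chi_minus_4 (u + 3 * v) * chi_minus_4 (u - v)) * (u - v))"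
      unfolding chi_12_def c3 2 by (simp only: mult.assoc)
    then have "chi_12 (u + 3 * v) * (chi_minus_4 (s * (u - v)) * (s * (u - v))) = chi_minus_3 u * (u - v)"
      unfolding 1 by simp
    then show ?case unfolding q(1) by simp
  qed
  also have "\<dots> = 8 * (chi_minus_3 x * x)"
    unfolding R using x0 y0 by (simp add: sum.cartesian_product[symmetric] algebra_simps)
  finally show ?thesis .
qed

section \<open>Class number sums\<close>

text \<open>The strict inequality keeps out H(0) = -1/12, which counts no triples.\<close>

definition class_sum :: "int \<Rightarrow> (int \<Rightarrow> real) \<Rightarrow> real" where
  "class_sum n f = (\<Sum>t \<in> {t. t\<^sup>2 < 4 * n}. f t * hurwitz_class_number (4 * n - t\<^sup>2))"

lemma class_sum_trace_selling:
  "3 * class_sum n f = (\<Sum>(t, l, m, v) \<in> trace_selling n. half_weight l * half_weight m * half_weight v * f t)"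
proof -
  have "3 * class_sum n f = (\<Sum>t \<in> {t. t\<^sup>2 < 4 * n}. \<Sum>T \<in> selling_triples (4 * n - t\<^sup>2). f t * selling_weight T)"
    unfolding class_sum_def sum_distrib_left
    by (rule sum.cong) (simp_all add: sum_distrib_left[symmetric] sum_selling_weight)
  also have "\<dots> = (\<Sum>(t, T) \<in> trace_selling n. f t * selling_weight T)"
    unfolding trace_selling_Sigma
    by (rule sum.Sigma) (auto simp: finite_square_less intro!: finite_selling_triples)
  also have "\<dots> = (\<Sum>(t, l, m, v) \<in> trace_selling n. half_weight l * half_weight m * half_weight v * f t)"
    by (rule sum.cong) (auto simp: selling_weight_def)
  finally show ?thesis .
qed

lemma class_sum_add: "class_sum n (\<lambda>t. f t + g t) = class_sum n f + class_sum n g"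
  unfolding class_sum_def sum.distrib[symmetric] by (rule sum.cong) (auto simp: algebra_simps)

lemma class_sum_reflect: "class_sum n (\<lambda>t. f (- t)) = class_sum n f"
  unfolding class_sum_def
  by (rule sum.reindex_bij_witness[where i = uminus and j = uminus]) auto

lemma sum_selling_weight_odd:
  assumes "odd N"
  shows "sum selling_weight (selling_triples N) = real (card (selling_triples N))"
proof -
  have "selling_weight T = 1" if T: "T \<in> selling_triples N" for T
  proof -
    obtain l m v where q: "T = (l, m, v)" by (cases T)
    have "even (l - m)" "even (m - v)" "l * m + m * v + v * l = N"
      using T by (auto simp: q selling_triples_def)
    then have "odd l" "odd m" "odd v" using assms by auto
    then show ?thesis by (auto simp: q selling_weight_def half_weight_def)
  qed
  then show ?thesis by simp
qed

lemma odd_le_square_less: "odd_le (4 * n) = {t. odd t \<and> t\<^sup>2 < 4 * n}"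
proof -
  have "t\<^sup>2 \<noteq> 4 * n" if "odd t" for t :: int
  proof
    assume "t\<^sup>2 = 4 * n"
    then have "even (t\<^sup>2)" by simp
    then show False using that by simp
  qed
  then show ?thesis by (auto simp: odd_le_def order_le_less)
qed

lemma class_sum_odd:
  "3 * class_sum n (\<lambda>t. if odd t then g t else 0) =
   (\<Sum>t \<in> odd_le (4 * n). g t * real (card (selling_triples (4 * n - t\<^sup>2))))"
proof -
  have "3 * class_sum n (\<lambda>t. if odd t then g t else 0) =
    (\<Sum>t \<in> {t. t\<^sup>2 < 4 * n}. if odd t then g t * real (card (selling_triples (4 * n - t\<^sup>2))) else 0)"
    unfolding class_sum_def sum_distrib_left
  proof (rule sum.cong)
    fix t assume "t \<in> {t. t\<^sup>2 < 4 * n}"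
    then have "3 * hurwitz_class_number (4 * n - t\<^sup>2) = real (card (selling_triples (4 * n - t\<^sup>2)))" if "odd t"
      using sum_selling_weight[of "4 * n - t\<^sup>2"] sum_selling_weight_odd[of "4 * n - t\<^sup>2"] that by simp
    then show "3 * ((if odd t then g t else 0) * hurwitz_class_number (4 * n - t\<^sup>2)) =
       (if odd t then g t * real (card (selling_triples (4 * n - t\<^sup>2))) else 0)" by simp
  qed simp
  also have "\<dots> = (\<Sum>t \<in> odd_le (4 * n). g t * real (card (selling_triples (4 * n - t\<^sup>2))))"
    unfolding odd_le_square_less
    by (subst sum.inter_filter[OF finite_square_less, symmetric]) (auto intro!: sum.cong)
  finally show ?thesis .
qed

text \<open>\<open>trace_selling_sum_odd_moment\<close> read as the recursion for w = 1. The factor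
  8 fits the initial value: (1, 1, 1) is the only triple for N = 3, and 3 has eight representations
  by odd squares.\<close>

lemma selling_triples_recursion:
  assumes M: "M mod 8 = 4"
  shows "(\<Sum>t \<in> odd_le M. 1 * (M - 4 * t\<^sup>2) * (8 * int (card (selling_triples (M - t\<^sup>2))))) = 0"
proof -
  define n where "n = M div 4"
  have n: "M = 4 * n" "odd n" using M unfolding n_def by presburger+
  show ?thesis
  proof (cases "0 < n")
    case True
    have "(\<Sum>t \<in> odd_le (4 * n). real_of_int (n - t\<^sup>2) * real (card (selling_triples (4 * n - t\<^sup>2)))) = 0"
      unfolding class_sum_odd[symmetric] class_sum_trace_selling
      by (rule trace_selling_sum_odd_moment[OF True n(2)])
    then have "real_of_int (\<Sum>t \<in> odd_le (4 * n). (n - t\<^sup>2) * int (card (selling_triples (4 * n - t\<^sup>2)))) = 0"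
      by simp
    then have "(\<Sum>t \<in> odd_le (4 * n). (n - t\<^sup>2) * int (card (selling_triples (4 * n - t\<^sup>2)))) = 0"
      by (simp only: of_int_eq_0_iff)
    moreover have "(\<Sum>t \<in> odd_le M. 1 * (M - 4 * t\<^sup>2) * (8 * int (card (selling_triples (M - t\<^sup>2))))) =
      32 * (\<Sum>t \<in> odd_le (4 * n). (n - t\<^sup>2) * int (card (selling_triples (4 * n - t\<^sup>2))))"
      unfolding sum_distrib_left n(1) by (rule sum.cong) (auto simp: algebra_simps)
    ultimately show ?thesis by simp
  next
    case False
    have "odd_le M = {}"
    proof -
      have "\<not> t\<^sup>2 \<le> M" if "odd t" for t :: int
      proof -
        have "0 < t\<^sup>2" using that by auto
        then show ?thesis using False n by linarith
      qed
      then show ?thesis by (auto simp: odd_le_def)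
    qed
    then show ?thesis by simp
  qed
qed

lemma selling_triples_3: "selling_triples 3 = {(1, 1, 1)}"
proof (intro equalityI subsetI)
  fix T assume T: "T \<in> selling_triples 3"
  obtain l m v where q: "T = (l, m, v)" by (cases T)
  have D: "0 \<le> l" "0 \<le> m" "0 \<le> v" "even (l - m)" "even (m - v)" "l * m + m * v + v * l = 3"
    using T by (auto simp: q selling_triples_def)
  have "odd (l * m + m * v + v * l)" using D(6) by simp
  then have "odd l" "odd m" "odd v" using D(4,5) by auto
  then have p: "1 \<le> l" "1 \<le> m" "1 \<le> v" using D by (auto simp: order_less_le int_one_le_iff_zero_less)
  then have "1 \<le> l * m" "1 \<le> m * v" "1 \<le> v * l" by (auto simp: int_one_le_iff_zero_less)
  then have "l * m = 1" "m * v = 1" "v * l = 1" using D(6) by linarith+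
  then show "T \<in> {(1, 1, 1)}" using p by (auto simp: q zmult_eq_1_iff)
qed (auto simp: selling_triples_def)

text \<open>Gauss's three squares theorem for N congruent to 3 modulo 8: both sides satisfy the same
  recursion and agree at N = 3.\<close>

theorem card_odd_squares3:
  assumes "0 \<le> N" "N mod 8 = 3"
  shows "8 * int (card (selling_triples N)) = cube_coeff (\<lambda>_. 1) N"
proof (rule cube_recursion_unique[where w = "\<lambda>_. 1", OF _ _ _ selling_triples_recursion cube_coeff_recursion assms])
  show "8 * int (card (selling_triples 3)) = cube_coeff (\<lambda>_. 1) 3"
    unfolding cube_coeff_def odd_squares3_3 selling_triples_3 by (simp add: sum.cartesian_product[symmetric])
qed simp_all

lemma sub_odd_square_mod8:
  fixes n t :: int
  assumes "odd n" "odd t"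
  shows "(4 * n - t\<^sup>2) mod 8 = 3"
  using odd_square_mod8[OF assms(2)] assms(1) by presburger

lemma class_sum_odd_squares4:
  assumes "odd n"
  shows "24 * class_sum n (\<lambda>t. if odd t then real_of_int (g t) else 0) =
    real_of_int (\<Sum>(t, x, y, z) \<in> odd_squares4 (4 * n). g t)"
proof -
  have "(\<Sum>(t, x, y, z) \<in> odd_squares4 (4 * n). g t * (1 * 1 * 1)) =
    (\<Sum>t \<in> odd_le (4 * n). g t * cube_coeff (\<lambda>_. 1) (4 * n - t\<^sup>2))"
    by (rule sum_odd_squares4)
  also have "\<dots> = 8 * (\<Sum>t \<in> odd_le (4 * n). g t * int (card (selling_triples (4 * n - t\<^sup>2))))"
    unfolding sum_distrib_left
    by (rule sum.cong) (auto simp: odd_le_def card_odd_squares3[symmetric] sub_odd_square_mod8 assms)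
  finally have "real_of_int (\<Sum>(t, x, y, z) \<in> odd_squares4 (4 * n). g t) =
    8 * (\<Sum>t \<in> odd_le (4 * n). real_of_int (g t) * real (card (selling_triples (4 * n - t\<^sup>2))))"
    by simp
  then show ?thesis unfolding class_sum_odd[symmetric] by simp
qed

lemma class_sum_prime_odd:
  fixes p :: int
  assumes "prime p" "5 \<le> p"
  shows "class_sum p (\<lambda>t. if odd t then 1 else 0) = 2 * (real_of_int p + 1) / 3"
proof -
  have "odd p" using assms prime_odd_int[of p] by simp
  have "3 * class_sum p (\<lambda>t. if odd t then 1 else 0) = 2 * (\<Sum>d \<in> {d. 0 < d \<and> d dvd p}. real_of_int d)"
    unfolding class_sum_trace_selling using assms \<open>odd p\<close> by (intro trace_selling_sum_odd_count) auto
  also have "\<dots> = 2 * (real_of_int p + 1)"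
    unfolding pos_divisors_prime[OF assms(1)] using assms(2) by simp
  finally show ?thesis by simp
qed

text \<open>Jacobi's count 16 \<sigma>(n) of the representations of 4n by four odd squares, n odd,
  at a prime.\<close>

lemma card_odd_squares4_prime:
  fixes p :: int
  assumes "prime p" "5 \<le> p"
  shows "int (card (odd_squares4 (4 * p))) = 16 * (p + 1)"
proof -
  have "odd p" using assms prime_odd_int[of p] by simp
  have "real_of_int (\<Sum>(t, x, y, z) \<in> odd_squares4 (4 * p). 1) = 24 * class_sum p (\<lambda>t. if odd t then real_of_int 1 else 0)"
    by (rule class_sum_odd_squares4[OF \<open>odd p\<close>, symmetric])
  then have "real_of_int (int (card (odd_squares4 (4 * p)))) = real_of_int (16 * (p + 1))"
    unfolding of_int_1 class_sum_prime_odd[OF assms] by (simp add: case_prod_unfold)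
  then show ?thesis by (simp only: of_int_eq_iff)
qed

lemma class_sum_prime_odd_mod3_eq_2:
  fixes p :: int
  assumes p: "prime p" "5 \<le> p" "p mod 3 = 2"
  shows "class_sum p (\<lambda>t. if odd t then real_of_int (if 3 dvd t then 1 else 0) else 0) = (real_of_int p + 1) / 3"
proof -
  define d where "d k = (if 3 dvd k then 1 else 0 :: int)" for k :: int
  have "odd p" using p prime_odd_int[of p] by simp
  have "4 * (\<Sum>(t, x, y, z) \<in> odd_squares4 (4 * p). 1 * d t) =
      (\<Sum>(t, x, y, z) \<in> odd_squares4 (4 * p). 1 * (d t + d x + d y + d z))"
    by (rule odd_squares4_symmetrize[symmetric]) simp_all
  also have "\<dots> = (\<Sum>(t, x, y, z) \<in> odd_squares4 (4 * p). 2)"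
  proof (rule sum.cong, goal_cases)
    case (2 q)
    obtain t x y z where q: "q = (t, x, y, z)" by (cases q)
    have e: "t\<^sup>2 + x\<^sup>2 + y\<^sup>2 + z\<^sup>2 = 4 * p" using 2 by (auto simp: q odd_squares4_def)
    obtain j1 j2 j3 j4 where j: "t\<^sup>2 = 3 * j1 + (1 - d t)" "x\<^sup>2 = 3 * j2 + (1 - d x)" "y\<^sup>2 = 3 * j3 + (1 - d y)"
      "z\<^sup>2 = 3 * j4 + (1 - d z)" unfolding d_def using square_mod3 by metis
    have "(4 - (d t + d x + d y + d z)) mod 3 = 2"
      using e p(3) unfolding j by presburger
    then show ?case unfolding q d_def
      by (cases "3 dvd t"; cases "3 dvd x"; cases "3 dvd y"; cases "3 dvd z") simp_all
  qed simp
  also have "\<dots> = 2 * int (card (odd_squares4 (4 * p)))" by (simp add: case_prod_unfold)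
  finally have "(\<Sum>(t, x, y, z) \<in> odd_squares4 (4 * p). d t) = 8 * (p + 1)"
    unfolding card_odd_squares4_prime[OF p(1,2)] by simp
  then have "24 * class_sum p (\<lambda>t. if odd t then real_of_int (d t) else 0) = real_of_int (8 * (p + 1))"
    unfolding class_sum_odd_squares4[OF \<open>odd p\<close>] by (simp only:)
  then show ?thesis unfolding d_def by simp
qed

lemma class_sum_prime_odd_mod3_eq_1:
  fixes p x y :: int
  assumes p: "prime p" "5 \<le> p" "p mod 3 = 1" and xy: "p = x\<^sup>2 + 3 * y\<^sup>2"
  shows "class_sum p (\<lambda>t. if odd t then real_of_int (if 3 dvd t then 1 else 0) else 0) =
    (real_of_int p + 1) / 6 - real_of_int (chi_minus_3 x * x) / 3"
proof -
  define D where "D = (\<Sum>(t, x, y, z) \<in> odd_squares4 (4 * p). if 3 dvd t then 1 else 0 :: int)"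
  have "odd p" using p prime_odd_int[of p] by simp
  \<comment> \<open>Both ends of this chain are the coefficient of q^(4p) in (2 \<eta>(24\<tau>))^4,
    first as \<eta> times Jacobi's \<eta>^3 and finally as a fourth power.\<close>
  have "32 * (chi_minus_3 x * x) = 4 * (\<Sum>(a, b) \<in> hex_pairs (4 * p). chi_12 a * (chi_minus_4 b * b))"
    unfolding sum_hex_pairs_prime[OF p(1,2) xy] by simp
  also have "\<dots> = (\<Sum>t \<in> odd_le (4 * p). chi_12 t * cm_coeff (4 * p - t\<^sup>2))"
    by (rule sum_hex_pairs)
  also have "\<dots> = (\<Sum>t \<in> odd_le (4 * p). chi_12 t * cube_coeff chi_12 (4 * p - t\<^sup>2))"
    by (rule sum.cong) (auto simp: odd_le_def cube_chi_12 sub_odd_square_mod8 \<open>odd p\<close>)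
  also have "\<dots> = (\<Sum>(t, x, y, z) \<in> odd_squares4 (4 * p). chi_12 t * (chi_12 x * chi_12 y * chi_12 z))"
    by (rule sum_odd_squares4[symmetric])
  also have "\<dots> = 16 * (p + 1) - 4 * D"
    unfolding sum_chi_12_odd_squares4[OF p(3)] card_odd_squares4_prime[OF p(1,2)] D_def ..
  finally have "D = 4 * (p + 1) - 8 * (chi_minus_3 x * x)" by simp
  then have "24 * class_sum p (\<lambda>t. if odd t then real_of_int (if 3 dvd t then 1 else 0) else 0) =
      real_of_int (4 * (p + 1) - 8 * (chi_minus_3 x * x))"
    unfolding class_sum_odd_squares4[OF \<open>odd p\<close>] D_def by (simp only:)
  then show ?thesis by (simp add: field_simps)
qed

text \<open>4p is not a square, so the term H(0) does not occur.\<close>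

lemma hurwitz_sum_class_sum:
  assumes "prime p"
  shows "hurwitz_sum m M p = class_sum (int p) (\<lambda>t. if [t = m] (mod int M) then 1 else 0)"
proof -
  have "t\<^sup>2 \<noteq> 4 * int p" for t :: int
  proof
    assume e: "t\<^sup>2 = 4 * int p"
    then have "even (t\<^sup>2)" by simp
    then obtain s where "t = 2 * s" by auto
    then have "int p = \<bar>s\<bar> * \<bar>s\<bar>" using e by (simp add: power2_eq_square)
    then have "p = nat \<bar>s\<bar> * nat \<bar>s\<bar>" by (metis nat_int nat_mult_distrib abs_ge_zero)
    then show False using assms by (metis prime_product nat_mult_1 not_prime_1)
  qed
  then have "{t. [t = m] (mod int M) \<and> t\<^sup>2 \<le> 4 * int p} = {t \<in> {t. t\<^sup>2 < 4 * int p}. [t = m] (mod int M)}"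
    by (auto simp: order_le_less)
  then show ?thesis
    unfolding hurwitz_sum_eq_finite_sum class_sum_def
    by (simp only: sum.inter_filter[OF finite_square_less]) (rule sum.cong, auto)
qed

lemma hurwitz_sum_mod6:
  fixes p :: nat
  assumes p: "prime p" "5 \<le> p"
  defines "A \<equiv> class_sum (int p) (\<lambda>t. if 3 dvd t then 1 else 0)"
    and "B \<equiv> class_sum (int p) (\<lambda>t. if odd t then real_of_int (if 3 dvd t then 1 else 0) else 0)"
  shows "[m = 0] (mod 6) \<Longrightarrow> hurwitz_sum m 6 p = A - B"
    and "[m = 1] (mod 6) \<or> [m = 5] (mod 6) \<Longrightarrow> hurwitz_sum m 6 p = (real p + 1) / 3 - B / 2"
    and "[m = 2] (mod 6) \<or> [m = 4] (mod 6) \<Longrightarrow> hurwitz_sum m 6 p = (2 * real p - 1) / 3 - (A - B) / 2"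
    and "[m = 3] (mod 6) \<Longrightarrow> hurwitz_sum m 6 p = B"
proof -
  have P: "prime (int p)" "5 \<le> int p" using p by simp_all
  define c where "c r = class_sum (int p) (\<lambda>t. if t mod 6 = r then 1 else 0)" for r
  have h: "hurwitz_sum m 6 p = c r" if "[m = r] (mod 6)" "0 \<le> r" "r < 6" for r
  proof -
    have "[t = m] (mod 6) \<longleftrightarrow> t mod 6 = r" for t using that by (auto simp: cong_def)
    then show ?thesis unfolding hurwitz_sum_class_sum[OF p(1)] c_def by simp
  qed
  have mod6: "t mod 6 = 0 \<or> t mod 6 = 1 \<or> t mod 6 = 2 \<or> t mod 6 = 3 \<or> t mod 6 = 4 \<or> t mod 6 = 5"
    for t :: int by presburger
  have cong: "class_sum (int p) f = class_sum (int p) g" if "\<And>t. f t = g t" for f g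
    using that by (simp add: class_sum_def)
  have reflect: "c r = c (6 - r)" if "0 < r" "r < 6" for r
  proof -
    have r: "t mod 6 = r \<longleftrightarrow> (- t) mod 6 = 6 - r" for t
      using that by (auto simp: zmod_zminus1_eq_if)
    have "c r = class_sum (int p) (\<lambda>t. if (- t) mod 6 = 6 - r then 1 else 0)"
      unfolding c_def by (rule cong) (simp only: r)
    then show ?thesis
      unfolding c_def by (simp only: class_sum_reflect[of "int p" "\<lambda>t. if t mod 6 = 6 - r then 1 else 0"])
  qed
  have c1: "c 1 = c 5" and c2: "c 2 = c 4" using reflect[of 1] reflect[of 2] by simp_all
  have par: "odd t \<longleftrightarrow> t mod 6 = 1 \<or> t mod 6 = 3 \<or> t mod 6 = 5" "3 dvd t \<longleftrightarrow> t mod 6 = 0 \<or> t mod 6 = 3"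
    for t :: int by presburger+
  have "class_sum (int p) (\<lambda>_. 1) = c 0 + c 1 + c 2 + c 3 + c 4 + c 5"
    unfolding c_def class_sum_add[symmetric]
  proof (rule cong)
    show "1 = (if t mod 6 = 0 then 1 else 0) + (if t mod 6 = 1 then 1 else 0) + (if t mod 6 = 2 then 1 else 0) +
      (if t mod 6 = 3 then 1 else 0) + (if t mod 6 = 4 then 1 else 0) + (if t mod 6 = 5 then 1 else 0 :: real)" for t :: int
      using mod6[of t] by (elim disjE) simp_all
  qed
  moreover have "3 * class_sum (int p) (\<lambda>_. 1) = 6 * real p"
    unfolding class_sum_trace_selling using trace_selling_sum_prime_count[OF P] by simp
  moreover have "class_sum (int p) (\<lambda>t. if odd t then 1 else 0) = c 1 + c 3 + c 5"
    unfolding c_def class_sum_add[symmetric] by (rule cong) (auto simp: par)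
  then have "c 1 + c 3 + c 5 = 2 * (real p + 1) / 3" using class_sum_prime_odd[OF P] by simp
  moreover have A: "A = c 0 + c 3"
    unfolding A_def c_def class_sum_add[symmetric] by (rule cong) (auto simp: par)
  moreover have B: "B = c 3"
    unfolding B_def c_def by (rule cong) (auto simp: par)
  \<comment> \<open>The system is c0 + 2 c1 + 2 c2 + c3 = 2p and 2 c1 + c3 = 2(p + 1)/3, with c0 +
    c3 = A and c3 = B.\<close>
  ultimately have val: "c 0 = A - B" "c 1 = (real p + 1) / 3 - B / 2" "c 2 = (2 * real p - 1) / 3 - (A - B) / 2"
    using c1 c2 by (simp_all add: field_simps)
  show "[m = 0] (mod 6) \<Longrightarrow> hurwitz_sum m 6 p = A - B" using h[of 0] val by simp
  show "[m = 1] (mod 6) \<or> [m = 5] (mod 6) \<Longrightarrow> hurwitz_sum m 6 p = (real p + 1) / 3 - B / 2"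
    using h[of 1] h[of 5] val c1 by auto
  show "[m = 2] (mod 6) \<or> [m = 4] (mod 6) \<Longrightarrow> hurwitz_sum m 6 p = (2 * real p - 1) / 3 - (A - B) / 2"
    using h[of 2] h[of 4] val c2 by auto
  show "[m = 3] (mod 6) \<Longrightarrow> hurwitz_sum m 6 p = B" using h[of 3] B by simp
qed

theorem theorem4p4:
  fixes p :: nat and m x y :: int
  assumes "prime p" and "p \<ge> 5"
    and "[p = 1] (mod 3) \<Longrightarrow> int p = x^2 + 3 * y^2"
  shows
    "([m = 0] (mod 6) \<and> [p = 1] (mod 3) \<longrightarrow>
        hurwitz_sum m 6 p = (real p + 1) / 3 + 1 / 3 * of_int (chi_minus_3 x) * of_int x) \<and>
     ([m = 0] (mod 6) \<and> [p = 2] (mod 3) \<longrightarrow>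
        hurwitz_sum m 6 p = (2 * real p - 4) / 3) \<and>
     (([m = 1] (mod 6) \<or> [m = 5] (mod 6)) \<and> [p = 1] (mod 3) \<longrightarrow>
        hurwitz_sum m 6 p = (real p + 1) / 4 + 1 / 6 * of_int (chi_minus_3 x) * of_int x) \<and>
     (([m = 1] (mod 6) \<or> [m = 5] (mod 6)) \<and> [p = 2] (mod 3) \<longrightarrow>
        hurwitz_sum m 6 p = (real p + 1) / 6) \<and>
     (([m = 2] (mod 6) \<or> [m = 4] (mod 6)) \<and> [p = 1] (mod 3) \<longrightarrow>
        hurwitz_sum m 6 p = (real p - 1) / 2 - 1 / 6 * of_int (chi_minus_3 x) * of_int x) \<and>
     (([m = 2] (mod 6) \<or> [m = 3] (mod 6) \<or> [m = 4] (mod 6)) \<and> [p = 2] (mod 3) \<longrightarrow>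
        hurwitz_sum m 6 p = (real p + 1) / 3) \<and>
     ([m = 3] (mod 6) \<and> [p = 1] (mod 3) \<longrightarrow>
        hurwitz_sum m 6 p = (real p + 1) / 6 - 1 / 3 * of_int (chi_minus_3 x) * of_int x)"
proof -
  define A where "A = class_sum (int p) (\<lambda>t. if 3 dvd t then 1 else 0)"
  define B where "B = class_sum (int p) (\<lambda>t. if odd t then real_of_int (if 3 dvd t then 1 else 0) else 0)"
  have P: "prime (int p)" "5 \<le> int p" using assms by simp_all
  note H = hurwitz_sum_mod6[OF assms(1,2), of m, folded A_def B_def]
  have one: "A = (real p + 1) / 2 \<and> B = (real p + 1) / 6 - of_int (chi_minus_3 x) * of_int x / 3"
    if "[p = 1] (mod 3)"
  proof -
    have "p mod 3 = 1" using that by (simp add: cong_def)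
    then have r: "int p mod 3 = 1" by presburger
    show ?thesis
      using trace_selling_sum_prime_mod3(1)[OF P r] class_sum_prime_odd_mod3_eq_1[OF P r assms(3)[OF that]]
      unfolding class_sum_trace_selling[symmetric] A_def[symmetric] B_def[symmetric] by simp
  qed
  have two: "A = real p - 1 \<and> B = (real p + 1) / 3" if "[p = 2] (mod 3)"
  proof -
    have "p mod 3 = 2" using that by (simp add: cong_def)
    then have r: "int p mod 3 = 2" by presburger
    show ?thesis
      using trace_selling_sum_prime_mod3(2)[OF P r] class_sum_prime_odd_mod3_eq_2[OF P r]
      unfolding class_sum_trace_selling[symmetric] A_def[symmetric] B_def[symmetric] by simp
  qed
  show ?thesis
  proof (intro conjI impI; elim conjE)
    assume "[m = 0] (mod 6)" "[p = 1] (mod 3)"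
    then show "hurwitz_sum m 6 p = (real p + 1) / 3 + 1 / 3 * of_int (chi_minus_3 x) * of_int x"
      using H(1) one by (simp add: field_simps)
  next
    assume "[m = 0] (mod 6)" "[p = 2] (mod 3)"
    then show "hurwitz_sum m 6 p = (2 * real p - 4) / 3" using H(1) two by (simp add: field_simps)
  next
    assume "[m = 1] (mod 6) \<or> [m = 5] (mod 6)" "[p = 1] (mod 3)"
    then show "hurwitz_sum m 6 p = (real p + 1) / 4 + 1 / 6 * of_int (chi_minus_3 x) * of_int x"
      using H(2) one by (simp add: field_simps)
  next
    assume "[m = 1] (mod 6) \<or> [m = 5] (mod 6)" "[p = 2] (mod 3)"
    then show "hurwitz_sum m 6 p = (real p + 1) / 6" using H(2) two by (simp add: field_simps)
  next
    assume "[m = 2] (mod 6) \<or> [m = 4] (mod 6)" "[p = 1] (mod 3)"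
    then show "hurwitz_sum m 6 p = (real p - 1) / 2 - 1 / 6 * of_int (chi_minus_3 x) * of_int x"
      using H(3) one by (simp add: field_simps)
  next
    assume "[m = 2] (mod 6) \<or> [m = 3] (mod 6) \<or> [m = 4] (mod 6)" "[p = 2] (mod 3)"
    then show "hurwitz_sum m 6 p = (real p + 1) / 3" using H(3,4) two by (auto simp: field_simps)
  next
    assume "[m = 3] (mod 6)" "[p = 1] (mod 3)"
    then show "hurwitz_sum m 6 p = (real p + 1) / 6 - 1 / 3 * of_int (chi_minus_3 x) * of_int x"
      using H(4) one by (simp add: field_simps)
  qed
qed

end
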